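(* Suppose $n>8$, and let $X$ be an admissible graph of genus $m\le 2n$ which realizes the alternating group $A=A_n$ (i.e. is equipped with a faithful action of $A_n$ by isometries). Let $X_A$ be the subgraph of $X$ spanned by the edges with non-trivial $A$-orbits. (1) If $m<n-1$, there are no admissible graphs of genus $m$ realizing $A$. (2) If $n-1\le m<2n-2$, then $X_A=R_n$ or $C_n$. (3) If $m=2n-2$, then $X_A$ is $R_n$, $C_n$, $C_n\vee C_n$ or $K(3,n)$. (4) If $m=2n-1$, then $X_A$ is one of the graphs listed in (3), or $CL_n$, or is $C_{2n}$, $C_n\vee R_n$ or $C_n\sqcup C_n$ with diagonal action. (5) If $m=2n$, then $X_A$ is one of the graphs listed in (3) and (4), or $R_{2n}=R_n\vee R_n$ with diagonal action, $R_n\sqcup C_n$, $RL_n$ or $\bigvee_n C_3$. Moreover, $X$ is obtained from $X_A$ by adding additional edges and vertices, fixed by $A$, in an arbitrary manner subject to the requirement that $X$ must be connected and must not contain a non-trivial forest that is invariant under the action of $\mathrm{Aut}(X)$.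
   Context: Graphs are one-dimensional CW complexes (loops and multiple edges allowed). The genus of a graph is the rank of its $H_1$. A graph is admissible if it is finite, connected, has no vertices of valence 1 or 2, and has no non-trivial forest (a subgraph without cycles containing at least one edge) that is invariant under the full automorphism group $\mathrm{Aut}(X)$ of the graph. A graph $X$ realizes a group if it is equipped with a faithful action of the group by isometries (graph automorphisms). An edge has non-trivial orbit if its orbit as an unoriented edge has more than one element. Graphs named in the statement: $R_k$ is the $k$-rose (one vertex, $k$ loops). $C_k$ is the $k$-cage (two vertices joined by $k$ edges). $K(3,n)$ is the complete bipartite graph on $3+n$ vertices. $CL_n$ ("cage with loops") is obtained from $C_n$ by adding a vertex at the midpoint of each of the $n$ edges and attaching one loop at each of these new vertices (genus $2n-1$). $RL_n$ ("rose with loops") is obtained from $R_n$ by adding a vertex at the midpoint of each petal and attaching one loop at each of these new vertices (genus $2n$). $\bigvee_n C_3$ is the wedge of $n$ copies of the 3-cage, identified at one vertex of each. If $X_1,X_2$ are graphs with distinguished vertices, $X_1\vee X_2$ is obtained from $X_1\sqcup X_2$ by identifying these vertices; in the case of cages the distinguished vertex is one of the two vertices. If $X_1$ and $X_2$ are equipped with an action of a group, the induced action on $X_1\sqcup X_2$ and $X_1\vee X_2$ is called diagonal; the diagonal action on $C_{2n}=C_n\cup C_n$ is obtained similarly, dividing the edges into two sets of $n$ on each of which $A_n$ acts in the standard way. On $R_n$ and $C_n$, $A_n$ acts by permuting the $n$ edges in the standard way. *)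

theory Defs
  imports Complex_Main "HOL-Algebra.Sym_Groups" "HOL-Algebra.Group_Action" "HOL-Library.Function_Algebras"
begin

section \<open>Graphs\<close>

text \<open>
  A graph (one-dimensional CW complex, loops and multiple edges allowed) is given by its vertices
  and its darts (oriented edges): every edge contributes two darts, which are exchanged by
  \<open>opp\<close>; \<open>tail d\<close> is the initial vertex of \<open>d\<close>. The unoriented edge carrying
  \<open>d\<close> is the set \<open>{d, opp d}\<close>. Working with darts makes the reversal of a loop a
  non-trivial automorphism, as it is for isometries.
\<close>

record ('v, 'd) graph =
  verts :: "'v set"
  darts :: "'d set"
  tail :: "'d \<Rightarrow> 'v"
  opp :: "'d \<Rightarrow> 'd"

definition is_graph :: "('v, 'd) graph \<Rightarrow> bool" where
  "is_graph X \<longleftrightarrow>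
     (\<forall>d \<in> darts X. tail X d \<in> verts X \<and> opp X d \<in> darts X \<and>
                    opp X d \<noteq> d \<and> opp X (opp X d) = d)"

definition finite_graph :: "('v, 'd) graph \<Rightarrow> bool" where
  "finite_graph X \<longleftrightarrow> finite (verts X) \<and> finite (darts X)"

definition head :: "('v, 'd) graph \<Rightarrow> 'd \<Rightarrow> 'v" where
  "head X d = tail X (opp X d)"

definition edge :: "('v, 'd) graph \<Rightarrow> 'd \<Rightarrow> 'd set" where
  "edge X d = {d, opp X d}"

definition connected_graph :: "('v, 'd) graph \<Rightarrow> bool" where
  "connected_graph X \<longleftrightarrow> verts X \<noteq> {} \<and>
     (\<forall>u \<in> verts X. \<forall>v \<in> verts X. (u, v) \<in> {(tail X d, head X d) | d. d \<in> darts X}\<^sup>*)"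

text \<open>A loop contributes two darts, hence counts twice.\<close>

definition valence :: "('v, 'd) graph \<Rightarrow> 'v \<Rightarrow> nat" where
  "valence X v = card {d \<in> darts X. tail X d = v}"

text \<open>
  Cellular first homology with integer coefficients. A 1-chain is an integer-valued function on
  darts that changes sign when a dart is reversed; as there are no 2-cells, \<open>H\<^sub>1\<close> is
  the group of 1-cycles. The genus is its rank, the maximal number of elements linearly
  independent over the integers.
\<close>

definition H1 :: "('v, 'd) graph \<Rightarrow> ('d \<Rightarrow> int) set" where
  "H1 X = {c. (\<forall>d. d \<notin> darts X \<longrightarrow> c d = 0) \<and>
              (\<forall>d \<in> darts X. c (opp X d) = - c d) \<and>
              (\<forall>v \<in> verts X. (\<Sum>d | d \<in> darts X \<and> tail X d = v. c d) = 0)}"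

definition genus :: "('v, 'd) graph \<Rightarrow> nat" where
  "genus X = Max {card B | B. finite B \<and> B \<subseteq> H1 X \<and>
                 \<not> module.dependent (\<lambda>(k::int) c d. k * c d) B}"

section \<open>Subgraphs, forests, automorphisms\<close>

definition subgraph :: "('v, 'd) graph \<Rightarrow> ('v, 'd) graph \<Rightarrow> bool" where
  "subgraph Y X \<longleftrightarrow> is_graph Y \<and> verts Y \<subseteq> verts X \<and> darts Y \<subseteq> darts X \<and>
     tail Y = tail X \<and> opp Y = opp X"

text \<open>
  An embedded cycle, as the cyclic sequence of its darts. The condition on \<open>opp\<close> excludes
  running back and forth along one edge.
\<close>

definition is_cycle :: "('v, 'd) graph \<Rightarrow> 'd list \<Rightarrow> bool" where
  "is_cycle X ds \<longleftrightarrow> ds \<noteq> [] \<and> set ds \<subseteq> darts X \<and> distinct (map (tail X) ds) \<and>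
     (\<forall>i < length ds. let e = ds ! (Suc i mod length ds) in
        head X (ds ! i) = tail X e \<and> e \<noteq> opp X (ds ! i))"

definition nontrivial_forest :: "('v, 'd) graph \<Rightarrow> bool" where
  "nontrivial_forest F \<longleftrightarrow> darts F \<noteq> {} \<and> (\<nexists>ds. is_cycle F ds)"

definition Aut :: "('v, 'd) graph \<Rightarrow> (('v \<Rightarrow> 'v) \<times> ('d \<Rightarrow> 'd)) monoid" where
  "Aut X = (BijGroup (verts X) \<times>\<times> BijGroup (darts X))
     \<lparr>carrier := {(f, g). f \<in> Bij (verts X) \<and> g \<in> Bij (darts X) \<and>
        (\<forall>d \<in> darts X. tail X (g d) = f (tail X d) \<and> opp X (g d) = g (opp X d))}\<rparr>"

definition Aut_invariant :: "('v, 'd) graph \<Rightarrow> ('v, 'd) graph \<Rightarrow> bool" where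
  "Aut_invariant X Y \<longleftrightarrow>
     (\<forall>(f, g) \<in> carrier (Aut X). f ` verts Y = verts Y \<and> g ` darts Y = darts Y)"

definition has_invariant_forest :: "('v, 'd) graph \<Rightarrow> bool" where
  "has_invariant_forest X \<longleftrightarrow> (\<exists>F. subgraph F X \<and> nontrivial_forest F \<and> Aut_invariant X F)"

definition admissible :: "('v, 'd) graph \<Rightarrow> bool" where
  "admissible X \<longleftrightarrow> is_graph X \<and> finite_graph X \<and> connected_graph X \<and>
     (\<forall>v \<in> verts X. valence X v \<noteq> 1 \<and> valence X v \<noteq> 2) \<and> \<not> has_invariant_forest X"

section \<open>Group actions on graphs\<close>

type_synonym ('g, 'v, 'd) action = "'g \<Rightarrow> ('v \<Rightarrow> 'v) \<times> ('d \<Rightarrow> 'd)"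

definition acts_on :: "('g, 'm) monoid_scheme \<Rightarrow> ('g, 'v, 'd) action \<Rightarrow> ('v, 'd) graph \<Rightarrow> bool" where
  "acts_on G \<rho> X \<longleftrightarrow> \<rho> \<in> hom G (Aut X)"

definition realizes :: "('g, 'm) monoid_scheme \<Rightarrow> ('g, 'v, 'd) action \<Rightarrow> ('v, 'd) graph \<Rightarrow> bool" where
  "realizes G \<rho> X \<longleftrightarrow> acts_on G \<rho> X \<and> inj_on \<rho> (carrier G)"

definition edge_orbit ::
  "('g, 'm) monoid_scheme \<Rightarrow> ('g, 'v, 'd) action \<Rightarrow> ('v, 'd) graph \<Rightarrow> 'd \<Rightarrow> 'd set set" where
  "edge_orbit G \<rho> X d = (\<lambda>g. snd (\<rho> g) ` edge X d) ` carrier G"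

text \<open>
  The subgraph \<open>X\<^sub>G\<close> spanned by the edges with non-trivial orbit.
\<close>

definition moved_subgraph ::
  "('g, 'm) monoid_scheme \<Rightarrow> ('g, 'v, 'd) action \<Rightarrow> ('v, 'd) graph \<Rightarrow> ('v, 'd) graph" where
  "moved_subgraph G \<rho> X =
     (let D = {d \<in> darts X. card (edge_orbit G \<rho> X d) > 1}
      in X\<lparr>verts := tail X ` D, darts := D\<rparr>)"

text \<open>Equivariant isomorphism. Only the values of the actions on the two graphs matter.\<close>

definition equivariantly_isomorphic ::
  "('g, 'm) monoid_scheme \<Rightarrow> ('v, 'd) graph \<Rightarrow> ('g, 'v, 'd) action \<Rightarrow>
   ('w, 'e) graph \<Rightarrow> ('g, 'w, 'e) action \<Rightarrow> bool" where
  "equivariantly_isomorphic G X \<rho> Y \<sigma> \<longleftrightarrow>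
     (\<exists>f g. bij_betw f (verts X) (verts Y) \<and> bij_betw g (darts X) (darts Y) \<and>
        (\<forall>d \<in> darts X. tail Y (g d) = f (tail X d) \<and> opp Y (g d) = g (opp X d)) \<and>
        (\<forall>p \<in> carrier G.
           (\<forall>v \<in> verts X. f (fst (\<rho> p) v) = fst (\<sigma> p) (f v)) \<and>
           (\<forall>d \<in> darts X. g (snd (\<rho> p) d) = snd (\<sigma> p) (g d))))"

text \<open>
  \<open>X\<close> arises from its subgraph \<open>Y\<close> by adding vertices and edges fixed by the group
  (the edges being fixed pointwise).
\<close>

definition obtained_by_adding_fixed ::
  "('g, 'm) monoid_scheme \<Rightarrow> ('g, 'v, 'd) action \<Rightarrow> ('v, 'd) graph \<Rightarrow> ('v, 'd) graph \<Rightarrow> bool" where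
  "obtained_by_adding_fixed G \<rho> X Y \<longleftrightarrow> subgraph Y X \<and>
     (\<forall>p \<in> carrier G.
        (\<forall>v \<in> verts X - verts Y. fst (\<rho> p) v = v) \<and>
        (\<forall>d \<in> darts X - darts Y. snd (\<rho> p) d = d))"

section \<open>Constructions\<close>

definition disjoint_union ::
  "('v, 'd) graph \<Rightarrow> ('w, 'e) graph \<Rightarrow> ('v + 'w, 'd + 'e) graph" where
  "disjoint_union X Y =
     \<lparr>verts = verts X <+> verts Y, darts = darts X <+> darts Y,
      tail = map_sum (tail X) (tail Y), opp = map_sum (opp X) (opp Y)\<rparr>"

text \<open>The common vertex of \<open>wedge X x Y y\<close> is represented by \<open>Inl x\<close>.\<close>

definition wedge ::
  "('v, 'd) graph \<Rightarrow> 'v \<Rightarrow> ('w, 'e) graph \<Rightarrow> 'w \<Rightarrow> ('v + 'w, 'd + 'e) graph" where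
  "wedge X x Y y =
     (let q = (\<lambda>v. if v = Inr y then Inl x else v); U = disjoint_union X Y
      in U\<lparr>verts := q ` verts U, tail := (\<lambda>d. q (tail U d))\<rparr>)"

text \<open>
  The diagonal action on \<open>disjoint_union\<close>, and on \<open>wedge\<close> if both base points are fixed.
\<close>

definition diagonal ::
  "('g, 'v, 'd) action \<Rightarrow> ('g, 'w, 'e) action \<Rightarrow> ('g, 'v + 'w, 'd + 'e) action" where
  "diagonal \<rho> \<sigma> =
     (\<lambda>p. (map_sum (fst (\<rho> p)) (fst (\<sigma> p)), map_sum (snd (\<rho> p)) (snd (\<sigma> p))))"

text \<open>
  The wedge of \<open>n\<close> copies of \<open>X\<close> at the vertex \<open>x\<close>, the common vertex being
  \<open>None\<close>, and the action permuting the copies.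
\<close>

definition wedge_copies ::
  "nat \<Rightarrow> ('v, 'd) graph \<Rightarrow> 'v \<Rightarrow> ((nat \<times> 'v) option, nat \<times> 'd) graph" where
  "wedge_copies n X x =
     (let q = (\<lambda>(i, v). if v = x then None else Some (i, v))
      in \<lparr>verts = insert None (q ` ({1..n} \<times> verts X)), darts = {1..n} \<times> darts X,
          tail = (\<lambda>(i, d). q (i, tail X d)), opp = (\<lambda>(i, d). (i, opp X d))\<rparr>)"

definition permute_copies :: "(nat \<Rightarrow> nat, (nat \<times> 'v) option, nat \<times> 'd) action" where
  "permute_copies = (\<lambda>p. (map_option (map_prod p id), map_prod p id))"

text \<open>
  Adding a vertex at the midpoint of every edge and attaching a loop there. The midpoint of an
  edge is \<open>Inr {d, opp d}\<close>. \<open>To_Mid d\<close> runs along the first half of \<open>d\<close>,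
  \<open>From_Mid d\<close> is its opposite; the two darts of the loop at the midpoint of \<open>{d, opp d}\<close>
  are \<open>Mid_Loop d\<close> and \<open>Mid_Loop (opp d)\<close>.
\<close>

datatype 'd loop_dart = To_Mid 'd | From_Mid 'd | Mid_Loop 'd

definition with_loops :: "('v, 'd) graph \<Rightarrow> ('v + 'd set, 'd loop_dart) graph" where
  "with_loops X =
     \<lparr>verts = verts X <+> edge X ` darts X,
      darts = To_Mid ` darts X \<union> From_Mid ` darts X \<union> Mid_Loop ` darts X,
      tail = (\<lambda>a. case a of To_Mid d \<Rightarrow> Inl (tail X d)
                          | From_Mid d \<Rightarrow> Inr (edge X d)
                          | Mid_Loop d \<Rightarrow> Inr (edge X d)),
      opp = (\<lambda>a. case a of To_Mid d \<Rightarrow> From_Mid d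
                         | From_Mid d \<Rightarrow> To_Mid d
                         | Mid_Loop d \<Rightarrow> Mid_Loop (opp X d))\<rparr>"

definition with_loops_action ::
  "('g, 'v, 'd) action \<Rightarrow> ('g, 'v + 'd set, 'd loop_dart) action" where
  "with_loops_action \<rho> =
     (\<lambda>p. (map_sum (fst (\<rho> p)) (image (snd (\<rho> p))), map_loop_dart (snd (\<rho> p))))"

section \<open>Roses, cages and complete bipartite graphs\<close>

text \<open>The two darts of the \<open>i\<close>-th edge are \<open>(i, False)\<close> and \<open>(i, True)\<close>.\<close>

definition rose :: "nat \<Rightarrow> (unit, nat \<times> bool) graph" where
  "rose k = \<lparr>verts = {()}, darts = {1..k} \<times> UNIV, tail = (\<lambda>_. ()),
             opp = (\<lambda>(i, b). (i, \<not> b))\<rparr>"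

definition cage :: "nat \<Rightarrow> (bool, nat \<times> bool) graph" where
  "cage k = \<lparr>verts = UNIV, darts = {1..k} \<times> UNIV, tail = snd, opp = (\<lambda>(i, b). (i, \<not> b))\<rparr>"

text \<open>
  The standard action on \<open>rose n\<close> and \<open>cage n\<close>: vertices are fixed and edges are permuted
  via their indices, orientations being preserved.
\<close>

definition permute_edges :: "(nat \<Rightarrow> nat, 'v, nat \<times> bool) action" where
  "permute_edges = (\<lambda>p. (id, map_prod p id))"

text \<open>
  The diagonal action on \<open>cage (2 * n)\<close>: permutations of \<open>{1..n}\<close> act on
  \<open>{1..n}\<close> and, by translation, on \<open>{n+1..2*n}\<close>.
\<close>

definition permute_edges_twice :: "nat \<Rightarrow> (nat \<Rightarrow> nat, 'v, nat \<times> bool) action" where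
  "permute_edges_twice n = (\<lambda>p. permute_edges (\<lambda>i. if i \<le> n then p i else n + p (i - n)))"

definition complete_bipartite :: "nat \<Rightarrow> nat \<Rightarrow> (nat + nat, (nat \<times> nat) \<times> bool) graph" where
  "complete_bipartite k n =
     \<lparr>verts = {1..k} <+> {1..n}, darts = ({1..k} \<times> {1..n}) \<times> UNIV,
      tail = (\<lambda>((j, i), b). if b then Inr i else Inl j), opp = (\<lambda>(e, b). (e, \<not> b))\<rparr>"

definition permute_right :: "(nat \<Rightarrow> nat, nat + nat, (nat \<times> nat) \<times> bool) action" where
  "permute_right = (\<lambda>p. (map_sum id p, map_prod (map_prod id p) id))"

section \<open>The lists of possible graphs\<close>

text \<open>
  Here \<open>Y\<close> is a graph on which the alternating group acts via \<open>\<rho>\<close>; the members of the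
  lists carry the actions induced by the standard one on \<open>{1..n}\<close>. The base point of a cage is
  its vertex \<open>False\<close>.
\<close>

definition is_rose_or_cage :: "nat \<Rightarrow> (nat \<Rightarrow> nat, 'v, 'd) action \<Rightarrow> ('v, 'd) graph \<Rightarrow> bool" where
  "is_rose_or_cage n \<rho> Y \<longleftrightarrow>
     equivariantly_isomorphic (alt_group n) Y \<rho> (rose n) permute_edges \<or>
     equivariantly_isomorphic (alt_group n) Y \<rho> (cage n) permute_edges"

definition in_list_3 :: "nat \<Rightarrow> (nat \<Rightarrow> nat, 'v, 'd) action \<Rightarrow> ('v, 'd) graph \<Rightarrow> bool" where
  "in_list_3 n \<rho> Y \<longleftrightarrow>
     is_rose_or_cage n \<rho> Y \<or>
     equivariantly_isomorphic (alt_group n) Y \<rho>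
       (wedge (cage n) False (cage n) False) (diagonal permute_edges permute_edges) \<or>
     equivariantly_isomorphic (alt_group n) Y \<rho> (complete_bipartite 3 n) permute_right"

definition in_list_4 :: "nat \<Rightarrow> (nat \<Rightarrow> nat, 'v, 'd) action \<Rightarrow> ('v, 'd) graph \<Rightarrow> bool" where
  "in_list_4 n \<rho> Y \<longleftrightarrow>
     in_list_3 n \<rho> Y \<or>
     equivariantly_isomorphic (alt_group n) Y \<rho>
       (with_loops (cage n)) (with_loops_action permute_edges) \<or>
     equivariantly_isomorphic (alt_group n) Y \<rho> (cage (2 * n)) (permute_edges_twice n) \<or>
     equivariantly_isomorphic (alt_group n) Y \<rho>
       (wedge (cage n) False (rose n) ()) (diagonal permute_edges permute_edges) \<or>
     equivariantly_isomorphic (alt_group n) Y \<rho>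
       (disjoint_union (cage n) (cage n)) (diagonal permute_edges permute_edges)"

definition in_list_5 :: "nat \<Rightarrow> (nat \<Rightarrow> nat, 'v, 'd) action \<Rightarrow> ('v, 'd) graph \<Rightarrow> bool" where
  "in_list_5 n \<rho> Y \<longleftrightarrow>
     in_list_4 n \<rho> Y \<or>
     equivariantly_isomorphic (alt_group n) Y \<rho>
       (wedge (rose n) () (rose n) ()) (diagonal permute_edges permute_edges) \<or>
     equivariantly_isomorphic (alt_group n) Y \<rho>
       (disjoint_union (rose n) (cage n)) (diagonal permute_edges permute_edges) \<or>
     equivariantly_isomorphic (alt_group n) Y \<rho>
       (with_loops (rose n)) (with_loops_action permute_edges) \<or>
     equivariantly_isomorphic (alt_group n) Y \<rho>
       (wedge_copies n (cage 3) False) permute_copies"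

end

theory Submission
  imports Defs
begin

text \<open>
  The genus is at least the first Betti number \<open>E - V + 1\<close>, and all valences are at least 3, so
  genus at most \<open>2 n\<close> leaves room only for orbits of fewer than \<open>n choose 2\<close> vertices and edges.
  By an argument of Bochert the stabilizers of points in such orbits contain 3-cycles, and counting
  the maximal alternating subgroups generated by these shows that each stabilizer is the whole
  group or the stabilizer of a label in \<open>{1..n}\<close>. Hence the moved part of the graph consists of
  \<open>n\<close> copies, permuted in the standard way, of one slice glued to fixed vertices. Comparing
  valences in the slice with the genus leaves a handful of slices. Those not in the lists are
  excluded by two invariant forests: the edges that alone separate some set of vertices, and the
  edges at a trivalent vertex whose other two edges are parallel.
\<close>

section \<open>Subgroups of small index in alternating groups\<close>

text \<open>The hypothesis n > 8 enters through two constants. Vertex and edge orbits turn out to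
  have at most 4 n - 1 elements, and 4 n - 1 < n (n - 1) / 2 begins to hold at n = 9. The statement
  on stabilizers itself fails for n = 8, because the alternating group of degree 8 also acts
  transitively on 15 points, and 15 is less than the number 28 of pairs. The obstacle in the count
  is the part of the graph fixed by the group, which may be arbitrarily large. Each fixed vertex
  that meets no moved edge is paid for by a fixed edge leading one step closer to the moved edges.
  So the fixed part cannot lower the genus, and an inequality remains that mentions only one slice
  and the fixed vertices it touches. Vertices have to be treated before edges: the number of edges
  in an orbit is bounded by the valences at the orbits of its end points, and these orbits must
  already be known to have at most n elements.\<close>

definition alternating :: "'a set \<Rightarrow> ('a \<Rightarrow> 'a) set" where
  "alternating S = {p. p permutes S \<and> evenperm p}"

definition three_cycle :: "'a \<Rightarrow> 'a \<Rightarrow> 'a \<Rightarrow> 'a \<Rightarrow> 'a" where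
  "three_cycle a b c = transpose a b \<circ> transpose b c"

text \<open>Vacuous for sets of fewer than three points, hence the bounds
  \<open>card B \<ge> 3\<close> below.\<close>

definition three_full :: "('a \<Rightarrow> 'a) set \<Rightarrow> 'a set \<Rightarrow> bool" where
  "three_full H B \<longleftrightarrow> (\<forall>a\<in>B. \<forall>b\<in>B. \<forall>c\<in>B. distinct [a, b, c] \<longrightarrow> three_cycle a b c \<in> H)"

section \<open>Three-cycles and even permutations\<close>

lemma three_cycle_apply:
  assumes "distinct [a, b, c]"
  shows "three_cycle a b c x = (if x = a then b else if x = b then c else if x = c then a else x)"
  using assms by (auto simp: three_cycle_def transpose_def)

lemma three_cycle_permutes:
  assumes "a \<in> S" "b \<in> S" "c \<in> S"
  shows "three_cycle a b c permutes S"
  unfolding three_cycle_def using assms by (intro permutes_compose permutes_swap_id)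

lemma three_cycle_alternating:
  assumes "a \<in> S" "b \<in> S" "c \<in> S" "distinct [a, b, c]"
  shows "three_cycle a b c \<in> alternating S"
  using assms three_cycle_permutes[of a S b c]
  by (auto simp: alternating_def three_cycle_def evenperm_comp permutation_swap_id evenperm_swap)

lemma three_cycle_conjugate:
  assumes "bij h"
  shows "h \<circ> three_cycle a b c \<circ> inv' h = three_cycle (h a) (h b) (h c)"
proof -
  have tr: "h \<circ> transpose a b = transpose (h a) (h b) \<circ> h" for a b
    using assms by (auto simp: fun_eq_iff transpose_def bij_def inj_def)
  have "h \<circ> three_cycle a b c = three_cycle (h a) (h b) (h c) \<circ> h"
    unfolding three_cycle_def by (metis comp_assoc tr)
  then show ?thesis
    using assms by (metis bij_def comp_assoc comp_id surj_iff)
qed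

lemma alternatingD:
  assumes "p \<in> alternating S"
  shows "p permutes S" "evenperm p"
  using assms by (auto simp: alternating_def)

lemma alternating_id: "id \<in> alternating S"
  by (simp add: alternating_def)

lemma alternating_comp:
  assumes "finite S" "p \<in> alternating S" "q \<in> alternating S"
  shows "p \<circ> q \<in> alternating S"
  using assms permutes_imp_permutation[of S]
  by (auto simp: alternating_def permutes_compose evenperm_comp)

lemma alternating_inv:
  assumes "finite S" "p \<in> alternating S"
  shows "inv' p \<in> alternating S"
  using assms permutes_imp_permutation[of S]
  by (auto simp: alternating_def permutes_inv evenperm_inv)

lemma alternating_mono: "S \<subseteq> T \<Longrightarrow> alternating S \<subseteq> alternating T"
  by (auto simp: alternating_def intro: permutes_subset)

lemma finite_alternating: "finite S \<Longrightarrow> finite (alternating S)"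
  by (rule finite_subset[OF _ finite_permutations[of S]]) (auto simp: alternating_def)

lemma card_alternating:
  assumes "finite S" "card S \<ge> 2"
  shows "2 * card (alternating S) = fact (card S)"
proof -
  obtain a b where ab: "a \<in> S" "b \<in> S" "a \<noteq> b"
    using assms by (metis card_2_iff' card_le_Suc0_iff_eq not_less_eq_eq numeral_2_eq_2)
  let ?O = "{p. p permutes S \<and> \<not> evenperm p}"
  have perm: "permutation p" if "p permutes S" for p
    using that assms(1) permutes_imp_permutation by blast
  have "bij_betw (\<lambda>p. transpose a b \<circ> p) (alternating S) ?O"
  proof (rule bij_betwI[where g = "\<lambda>p. transpose a b \<circ> p"])
    show "(\<circ>) (transpose a b) \<in> alternating S \<rightarrow> ?O"
      using ab perm
      by (auto simp: alternating_def evenperm_comp permutation_swap_id evenperm_swap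
          intro!: permutes_compose permutes_swap_id)
    show "(\<circ>) (transpose a b) \<in> ?O \<rightarrow> alternating S"
      using ab perm
      by (auto simp: alternating_def evenperm_comp permutation_swap_id evenperm_swap
          intro!: permutes_compose permutes_swap_id)
  qed (auto simp: fun_eq_iff)
  then have "card (alternating S) = card ?O" by (rule bij_betw_same_card)
  moreover have "card {p. p permutes S} = card (alternating S) + card ?O"
  proof -
    have "{p. p permutes S} = alternating S \<union> ?O" "alternating S \<inter> ?O = {}"
      by (auto simp: alternating_def)
    then show ?thesis
      using finite_permutations[OF assms(1)] by (metis card_Un_disjoint finite_Un)
  qed
  ultimately show ?thesis using card_permutations[OF refl assms(1)] by simp
qed

text \<open>A product of two transpositions is trivial, a 3-cycle or, for disjoint supports, a
  product of two 3-cycles.\<close>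

lemma three_cycles_generate:
  assumes "finite B" "p \<in> alternating B" "three_full K B" "id \<in> K"
    and comp: "\<And>p q. p \<in> K \<Longrightarrow> q \<in> K \<Longrightarrow> p \<circ> q \<in> K"
  shows "p \<in> K"
proof -
  have two: "transpose c d \<circ> transpose a b \<in> K"
    if "a \<in> B" "b \<in> B" "c \<in> B" "d \<in> B" "a \<noteq> b" "c \<noteq> d" for a b c d
  proof -
    consider "c = a" "d = b" | "c = b" "d = a" | "c = a" "d \<noteq> b" | "d = a" "c \<noteq> b"
      | "c = b" "d \<noteq> a" | "d = b" "c \<noteq> a" | "c \<noteq> a" "c \<noteq> b" "d \<noteq> a" "d \<noteq> b"
      by blast
    then show ?thesis
    proof cases
      case 1
      then have "transpose c d \<circ> transpose a b = id" by (auto simp: fun_eq_iff)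
      then show ?thesis using assms(4) by metis
    next
      case 2
      then have "transpose c d \<circ> transpose a b = id"
        by (auto simp: fun_eq_iff transpose_commute[of b a])
      then show ?thesis using assms(4) by metis
    next
      case 3
      then have "transpose c d \<circ> transpose a b = three_cycle d a b"
        by (simp add: three_cycle_def transpose_commute)
      then show ?thesis using assms(3) that 3 by (auto simp: three_full_def)
    next
      case 4
      then have "transpose c d \<circ> transpose a b = three_cycle c a b"
        by (simp add: three_cycle_def transpose_commute)
      then show ?thesis using assms(3) that 4 by (auto simp: three_full_def)
    next
      case 5
      then have "transpose c d \<circ> transpose a b = three_cycle d b a"
        by (simp add: three_cycle_def transpose_commute)
      then show ?thesis using assms(3) that 5 by (auto simp: three_full_def)
    next
      case 6
      then have "transpose c d \<circ> transpose a b = three_cycle c b a"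
        by (simp add: three_cycle_def transpose_commute)
      then show ?thesis using assms(3) that 6 by (auto simp: three_full_def)
    next
      case 7
      \<comment> \<open>The inner factors \<open>transpose d a\<close> of the two 3-cycles
        cancel.\<close>
      have "transpose c d \<circ> transpose a b = three_cycle c d a \<circ> three_cycle d a b"
        by (simp add: three_cycle_def fun_eq_iff)
      then show ?thesis using assms(3) that 7 by (auto simp: three_full_def intro!: comp)
    qed
  qed
  have perm: "permutation p" if "p permutes B" for p
    using that assms(1) permutes_imp_permutation by blast
  \<comment> \<open>Each transposition changes the parity, so the induction also needs a claim about
    odd permutations: composing with any transposition puts them into \<open>K\<close>.\<close>
  have "(evenperm p \<longrightarrow> p \<in> K) \<and>
      (\<not> evenperm p \<longrightarrow> (\<forall>a\<in>B. \<forall>b\<in>B. a \<noteq> b \<longrightarrow> transpose a b \<circ> p \<in> K))"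
    using alternatingD(1)[OF assms(2)] assms(1)
  proof (induction rule: permutes_induct)
    case id
    then show ?case using assms(4) unfolding id_def by simp
  next
    case (swap a b p)
    have ev: "evenperm (transpose a b \<circ> p) \<longleftrightarrow> \<not> evenperm p"
      using swap perm by (simp add: evenperm_comp permutation_swap_id evenperm_swap)
    show ?case
    proof (cases "evenperm p")
      case True
      then have "p \<in> K" using swap by blast
      then have "transpose c d \<circ> (transpose a b \<circ> p) \<in> K"
        if "c \<in> B" "d \<in> B" "c \<noteq> d" for c d
        using comp[OF two[of a b c d]] swap that by (simp add: o_assoc)
      then show ?thesis using ev True by blast
    next
      case False
      then show ?thesis using ev swap by blast
    qed
  qed
  then show ?thesis using alternatingD(2)[OF assms(2)] by blast
qed

text \<open>If the bijection found first is odd, swapping two points of \<open>T\<close> beforehand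
  corrects the parity without changing the image; this is where \<open>card T \<ge> 2\<close>
  enters.\<close>

lemma alternating_moves_subset:
  assumes "finite S" "T \<subseteq> S" "U \<subseteq> S" "card T = card U" "card T \<ge> 2"
  obtains p where "p \<in> alternating S" "p ` T = U"
proof -
  have fin: "finite T" "finite U" using assms finite_subset by auto
  obtain f where f: "bij_betw f T U" using fin assms(4) finite_same_card_bij by blast
  have "card (S - T) = card (S - U)" using assms fin by (simp add: card_Diff_subset)
  then obtain g where g: "bij_betw g (S - T) (S - U)"
    using assms(1) finite_same_card_bij by (metis finite_Diff)
  define p where "p x = (if x \<in> T then f x else if x \<in> S then g x else x)" for x
  have "bij_betw p T U" using f by (subst bij_betw_cong[of _ _ f]) (auto simp: p_def)
  moreover have "bij_betw p (S - T) (S - U)"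
    using g by (subst bij_betw_cong[of _ _ g]) (auto simp: p_def)
  ultimately have "bij_betw p (T \<union> (S - T)) (U \<union> (S - U))"
    by (rule bij_betw_combine) auto
  then have "bij_betw p S S" using assms by (simp add: Un_absorb1)
  then have p: "p permutes S" using assms(2) by (intro bij_imp_permutes) (auto simp: p_def)
  have pT: "p ` T = U" using \<open>bij_betw p T U\<close> by (simp add: bij_betw_def)
  obtain a b where ab: "a \<in> T" "b \<in> T" "a \<noteq> b"
    using assms fin by (metis card_2_iff' card_le_Suc0_iff_eq not_less_eq_eq numeral_2_eq_2)
  show ?thesis
  proof (cases "evenperm p")
    case True
    then show ?thesis using that[of p] p pT by (auto simp: alternating_def)
  next
    case False
    let ?q = "p \<circ> transpose a b"
    have "?q permutes S" using p ab assms(2) by (auto intro!: permutes_compose permutes_swap_id)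
    moreover have "evenperm ?q"
      using permutes_imp_permutation[OF assms(1) p] False ab
      by (auto simp: evenperm_comp permutation_swap_id evenperm_swap)
    moreover have "?q ` T = U" using pT ab by (simp only: image_comp [symmetric] transpose_image_eq)
    ultimately show ?thesis using that[of ?q] by (auto simp: alternating_def)
  qed
qed

section \<open>Subgroups and the 3-cycles they contain\<close>

locale alternating_subgroup =
  fixes S :: "'a set" and H :: "('a \<Rightarrow> 'a) set"
  assumes fin: "finite S"
    and sub: "H \<subseteq> alternating S"
    and id_mem: "id \<in> H"
    and comp_mem: "\<And>p q. p \<in> H \<Longrightarrow> q \<in> H \<Longrightarrow> p \<circ> q \<in> H"
    and inv_mem: "\<And>p. p \<in> H \<Longrightarrow> inv' p \<in> H"
begin

lemma permutes: "p \<in> H \<Longrightarrow> p permutes S"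
  using sub by (auto simp: alternating_def)

lemma bij: "p \<in> H \<Longrightarrow> bij p"
  using permutes permutes_bij by blast

text \<open>In the commutator of \<open>x\<close> and \<open>y\<close> everything cancels where only
  one of them acts; what survives is the cycle through \<open>d\<close>, \<open>x d\<close> and
  \<open>y d\<close>.\<close>

lemma commutator_three_cycle:
  assumes "x \<in> H" "y \<in> H" "x d \<noteq> d" "y d \<noteq> d"
    and meet: "\<And>i. x i \<noteq> i \<Longrightarrow> y i \<noteq> i \<Longrightarrow> i = d"
  shows "three_cycle d (x d) (y d) \<in> H" "distinct [d, x d, y d]"
proof -
  have bx: "bij x" and by': "bij y" using assms(1,2) by (simp_all add: bij)
  have ix [simp]: "x (inv' x i) = i" "inv' x (x i) = i" for i
    using bx by (auto simp: bij_def surj_f_inv_f inv_f_f)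
  have iy [simp]: "y (inv' y i) = i" "inv' y (y i) = i" for i
    using by' by (auto simp: bij_def surj_f_inv_f inv_f_f)
  have xinj: "x i = x j \<longleftrightarrow> i = j" for i j using bx by (auto simp: bij_def inj_def)
  have yinj: "y i = y j \<longleftrightarrow> i = j" for i j using by' by (auto simp: bij_def inj_def)
  have yx: "y (x d) = x d" using meet[of "x d"] assms(3) xinj by metis
  have xy: "x (y d) = y d" using meet[of "y d"] assms(4) yinj by metis
  show dist: "distinct [d, x d, y d]" using assms(3,4) xy xinj[of "y d" d] by auto
  have inv_fix: "inv' x i = i \<longleftrightarrow> x i = i" "inv' y i = i \<longleftrightarrow> y i = i" for i
    by (metis ix, metis iy)
  have disj: "x i = i \<or> y i = i" if "i \<noteq> d" for i using meet that by blast
  have "(x \<circ> y \<circ> inv' x \<circ> inv' y) i = three_cycle d (x d) (y d) i" for i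
  proof -
    consider "i = d" | "i = x d" | "i = y d" | "i \<notin> {d, x d, y d}" by blast
    then show ?thesis
    proof cases
      case 1
      have "inv' y d \<noteq> d" "y (inv' y d) \<noteq> inv' y d" using assms(4) inv_fix(2)[of d] by auto
      then have "x (inv' y d) = inv' y d" using disj by blast
      then have "inv' x (inv' y d) = inv' y d" using inv_fix by blast
      then show ?thesis using 1 dist by (auto simp: three_cycle_apply)
    next
      case 2
      have "inv' y (x d) = x d" using yx inv_fix by blast
      then show ?thesis using 2 dist xy by (auto simp: three_cycle_apply)
    next
      case 3
      have "inv' x d \<noteq> d" "x (inv' x d) \<noteq> inv' x d" using assms(3) inv_fix(1)[of d] by auto
      then have "y (inv' x d) = inv' x d" using disj by blast
      then show ?thesis using 3 dist by (auto simp: three_cycle_apply)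
    next
      case 4
      have tc: "three_cycle d (x d) (y d) i = i" using 4 dist by (auto simp: three_cycle_apply)
      show ?thesis
      proof (cases "y i = i")
        case True
        then have "inv' y i = i" using inv_fix by blast
        moreover have "inv' x i \<noteq> d" using 4 ix by (metis insertCI)
        then have "y (inv' x i) = inv' x i"
          using True inv_fix disj by (metis ix(1))
        ultimately show ?thesis using tc by simp
      next
        case False
        then have "x i = i" using 4 disj by blast
        have "inv' y i \<noteq> d" using 4 iy by (metis insertCI)
        moreover have "y (inv' y i) \<noteq> inv' y i" using False inv_fix(2)[of i] by auto
        ultimately have "x (inv' y i) = inv' y i" using disj by blast
        then have "inv' x (inv' y i) = inv' y i" using inv_fix by blast
        then show ?thesis using tc \<open>x i = i\<close> by simp
      qed
    qed
  qed
  then have "x \<circ> y \<circ> inv' x \<circ> inv' y = three_cycle d (x d) (y d)" by blast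
  then show "three_cycle d (x d) (y d) \<in> H"
    using assms(1,2) comp_mem inv_mem by metis
qed

text \<open>
  Bochert's argument: take a set \<open>D\<close> of least cardinality whose pointwise stabilizer in
  \<open>H\<close> is trivial. Either its complement is large, or the complement fails to have a trivial
  stabilizer and a commutator is a 3-cycle.
\<close>

lemma three_cycle_or_trivial_on_half:
  "(\<exists>a\<in>S. \<exists>b\<in>S. \<exists>c\<in>S. distinct [a, b, c] \<and> three_cycle a b c \<in> H) \<or>
   (\<exists>C\<subseteq>S. card S \<le> 2 * card C \<and> (\<forall>p\<in>H. p permutes C \<longrightarrow> p = id))"
proof -
  define P where "P D \<longleftrightarrow> D \<subseteq> S \<and> (\<forall>p\<in>H. (\<forall>i\<in>D. p i = i) \<longrightarrow> p = id)" for D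
  have "P S"
    unfolding P_def using permutes by (fastforce simp: fun_eq_iff permutes_def)
  then obtain D where D: "P D" and minD: "\<And>D'. P D' \<Longrightarrow> card D \<le> card D'"
    using ex_has_least_nat[of P S card] by blast
  have DS: "D \<subseteq> S" "finite D" using D fin finite_subset by (auto simp: P_def)
  show ?thesis
  proof (cases "card S \<le> 2 * card (S - D)")
    case True
    moreover have "p = id" if "p \<in> H" "p permutes S - D" for p
      using D that by (auto simp: P_def permutes_def)
    ultimately show ?thesis by blast
  next
    case False
    then have "card (S - D) < card D" using DS fin by (simp add: card_Diff_subset)
    \<comment> \<open>By minimality neither \<open>S - D\<close> nor, below, \<open>D - {d}\<close>
      has a trivial pointwise stabilizer. The witness \<open>x\<close> moves only points of
      \<open>D\<close>, the witness \<open>y\<close> only \<open>d\<close> and points of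
      \<open>S - D\<close>, so their supports meet in \<open>d\<close> alone.\<close>
    then have "\<not> P (S - D)" using minD by fastforce
    then obtain x where x: "x \<in> H" "\<And>i. i \<in> S - D \<Longrightarrow> x i = i" "x \<noteq> id"
      by (auto simp: P_def)
    then obtain d where d: "x d \<noteq> d" by (auto simp: fun_eq_iff)
    have dD: "d \<in> D" using d x permutes[OF x(1)] by (metis DiffI permutes_not_in)
    have "card (D - {d}) < card D" using dD DS by (meson card_Diff1_less)
    then have "\<not> P (D - {d})" using minD by fastforce
    then obtain y where y: "y \<in> H" "\<And>i. i \<in> D - {d} \<Longrightarrow> y i = i" "y \<noteq> id"
      using DS by (auto simp: P_def)
    have yd: "y d \<noteq> d" using y D unfolding P_def by (metis DiffI singletonD)
    have meet: "i = d" if "x i \<noteq> i" "y i \<noteq> i" for i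
      using that x y permutes[OF x(1)] by (metis DiffI permutes_not_in singletonD)
    have "d \<in> S" using dD DS by auto
    then have "x d \<in> S" "y d \<in> S" using permutes x y by (auto simp: permutes_in_image)
    with commutator_three_cycle[OF x(1) y(1) d yd meet] \<open>d \<in> S\<close> show ?thesis by blast
  qed
qed

lemma conjugate_three_cycle:
  assumes "h \<in> H" "three_cycle a b c \<in> H"
  shows "three_cycle (h a) (h b) (h c) \<in> H"
  using assms three_cycle_conjugate[OF bij] comp_mem inv_mem by metis

lemma inverse_three_cycle:
  assumes "three_cycle a b c \<in> H" "distinct [a, b, c]"
  shows "three_cycle b a c \<in> H"
proof -
  have eq: "three_cycle a b c (three_cycle b a c x) = x" "three_cycle b a c (three_cycle a b c x) = x" for x
    using assms(2) by (auto simp: three_cycle_def transpose_def)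
  have "three_cycle a b c \<circ> three_cycle b a c = id" "three_cycle b a c \<circ> three_cycle a b c = id"
    by (auto simp: fun_eq_iff eq)
  then have "inv' (three_cycle a b c) = three_cycle b a c" by (metis inv_unique_comp)
  then show ?thesis using inv_mem assms by metis
qed

lemma rotate_three_cycle:
  assumes "distinct [a, b, c]"
  shows "three_cycle a b c = three_cycle b c a"
proof
  show "three_cycle a b c x = three_cycle b c a x" for x
    using assms by (auto simp: three_cycle_def transpose_def)
qed

text \<open>Conjugation spreads a single 3-cycle through \<open>d\<close>: the 3-cycles of
  \<open>B\<close> carry the first two entries of (x y d) to any other two points of
  \<open>B\<close>. If the given cycle leaves \<open>B\<close> at \<open>e\<close>, it still carries
  \<open>a\<close> to \<open>d\<close> and so turns a cycle (x y a) of \<open>B\<close> into (x y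
  d).\<close>

lemma three_full_insert:
  assumes full: "three_full H B" and B: "card B \<ge> 3" and d: "d \<notin> B"
    and t: "a \<in> B" "three_cycle a d e \<in> H" "distinct [a, d, e]"
  shows "three_full H (insert d B)"
proof -
  have fB: "finite B" using B by (metis card.infinite not_numeral_le_zero)
  define R where "R x y \<longleftrightarrow> three_cycle x y d \<in> H" for x y
  have Rsym: "R y x" if "R x y" "x \<in> B" "y \<in> B" "x \<noteq> y" for x y
    using that d inverse_three_cycle[of x y d] by (auto simp: R_def)
  have others: "\<exists>z\<in>B. z \<noteq> x \<and> z \<noteq> y" for x y
  proof -
    have "card {x, y} \<le> 2" by (simp add: card_insert_if)
    then have "\<not> B \<subseteq> {x, y}" using B card_mono[of "{x, y}" B] by auto
    then show ?thesis by blast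
  qed
  have inB: "three_cycle x y z \<in> H" if "x \<in> B" "y \<in> B" "z \<in> B" "distinct [x, y, z]" for x y z
    using full that by (auto simp: three_full_def)
  \<comment> \<open>Conjugating by (x y z) rotates (x y d) into (y z d) and then (z x d); inversion
    turns the last one into (x z d).\<close>
  have Rmove: "R x z" if "R x y" "x \<in> B" "y \<in> B" "z \<in> B" "distinct [x, y, z]" for x y z
  proof -
    have nd: "d \<noteq> x" "d \<noteq> y" "d \<noteq> z" using that d by auto
    have "three_cycle x y z \<in> H" using that inB by blast
    from conjugate_three_cycle[OF this that(1)[unfolded R_def]]
    have "R y z" using that nd by (auto simp: R_def three_cycle_apply)
    from conjugate_three_cycle[OF \<open>three_cycle x y z \<in> H\<close> \<open>R y z\<close>[unfolded R_def]]
    have "R z x" using that nd by (auto simp: R_def three_cycle_apply)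
    then show ?thesis using that Rsym by auto
  qed
  obtain x y where xy: "x \<in> B" "y \<in> B" "x \<noteq> y" "R x y"
  proof (cases "e \<in> B")
    case True
    then have "R e a" using t rotate_three_cycle[of e a d] by (auto simp: R_def)
    then show ?thesis using that[of e a] True t by auto
  next
    case False
    obtain x where x: "x \<in> B" "x \<noteq> a" using others[of a a] by blast
    obtain y where y: "y \<in> B" "y \<noteq> a" "y \<noteq> x" using others[of a x] by blast
    have "three_cycle x y a \<in> H" using inB x y t by auto
    moreover have "x \<noteq> d" "x \<noteq> e" "y \<noteq> d" "y \<noteq> e" using x y False d by auto
    ultimately have "R x y"
      using conjugate_three_cycle[OF t(2), of x y a] t(3) x y unfolding R_def
      by (simp add: three_cycle_apply[OF t(3)])
    then show ?thesis using y by (intro that[OF x(1) y(1)]) auto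
  qed
  have Rany: "R u v" if "u \<in> B" "v \<in> B" "u \<noteq> v" for u v
  proof -
    have step: "R x v" if "v \<in> B" "v \<noteq> x" for v
      using Rmove[OF xy(4) xy(1,2), of v] that xy by (cases "v = y") auto
    show ?thesis
    proof (cases "u = x")
      case True
      then show ?thesis using step that by auto
    next
      case False
      then have "R u x" using step[of u] Rsym[of x u] that xy by auto
      show ?thesis
        using Rmove[OF \<open>R u x\<close>, of v] that xy False \<open>R u x\<close> by (cases "v = x") auto
    qed
  qed
  show ?thesis
    unfolding three_full_def
  proof (intro ballI impI)
    fix u v w assume uvw: "u \<in> insert d B" "v \<in> insert d B" "w \<in> insert d B" "distinct [u, v, w]"
    consider "u = d" | "v = d" | "w = d" | "u \<in> B" "v \<in> B" "w \<in> B" using uvw by blast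
    then show "three_cycle u v w \<in> H"
    proof cases
      case 1
      then show ?thesis using uvw Rany[of v w] rotate_three_cycle[of d v w] by (auto simp: R_def)
    next
      case 2
      then have "three_cycle u d w = three_cycle w u d"
        using uvw rotate_three_cycle[of w u d] by auto
      then show ?thesis using 2 uvw Rany[of w u] by (auto simp: R_def)
    next
      case 3
      then show ?thesis using uvw Rany[of u v] by (auto simp: R_def)
    next
      case 4
      then show ?thesis using uvw inB by blast
    qed
  qed
qed

lemma three_full_triple:
  assumes "three_cycle a b c \<in> H" "distinct [a, b, c]"
  shows "three_full H {a, b, c}"
proof -
  have "three_cycle b c a \<in> H" "three_cycle c a b \<in> H"
    using assms rotate_three_cycle[of a b c] rotate_three_cycle[of b c a] by auto
  then show ?thesis
    using assms inverse_three_cycle[of a b c] inverse_three_cycle[of b c a]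
      inverse_three_cycle[of c a b]
    by (auto simp: three_full_def)
qed

lemma three_full_alternating:
  assumes "three_full H B" "B \<subseteq> S"
  shows "alternating B \<subseteq> H"
  using assms three_cycles_generate[OF finite_subset[OF _ fin], of B _ H] id_mem comp_mem by blast

text \<open>A point \<open>d\<close> of \<open>C\<close> outside \<open>B\<close> could be adjoined
  to \<open>B\<close> by \<open>three_full_insert\<close>, using a 3-cycle of \<open>C\<close>
  through \<open>a\<close> and \<open>d\<close>. Consequently full sets of maximal size are equal or
  disjoint.\<close>

lemma three_full_absorbs:
  assumes B: "three_full H B" "B \<subseteq> S" "card B \<ge> 3"
    and max: "\<And>B'. three_full H B' \<Longrightarrow> B' \<subseteq> S \<Longrightarrow> card B' \<le> card B"
    and C: "three_full H C" "C \<subseteq> S" "card C \<ge> 3" and a: "a \<in> B" "a \<in> C"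
  shows "C \<subseteq> B"
proof
  fix d assume d: "d \<in> C"
  show "d \<in> B"
  proof (rule ccontr)
    assume nd: "d \<notin> B"
    have "card {a, d} \<le> 2" by (simp add: card_insert_if)
    then have "\<not> C \<subseteq> {a, d}" using C card_mono[of "{a, d}" C] by auto
    then obtain e where e: "e \<in> C" "e \<noteq> a" "e \<noteq> d" by blast
    have "distinct [a, d, e]" using e a nd by auto
    moreover from this have "three_cycle a d e \<in> H"
      using C(1) a(2) d e(1) unfolding three_full_def by blast
    ultimately have "three_full H (insert d B)"
      using three_full_insert[OF B(1,3) nd a(1)] by blast
    then have "card (insert d B) \<le> card B" using d C B by (intro max) auto
    then show False using nd finite_subset[OF B(2) fin] by simp
  qed
qed

end

text \<open>Compares the order of the alternating group on half of the points with the number of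
  pairs. It fails at k = 4, where 56 > 24; nine points guarantee k \<ge> 5.\<close>

lemma fact_ge_choose: "k \<ge> 5 \<Longrightarrow> (2 * k choose 2) * 2 \<le> fact k"
proof (induction k rule: nat_induct_at_least)
  case base
  then show ?case by (simp add: choose_two fact_numeral)
next
  case (Suc k)
  have e: "(2 * k choose 2) * 2 = 2 * k * (2 * k - 1)" for k :: nat
    by (simp add: choose_two)
  have "(2 * Suc k choose 2) * 2 \<le> Suc k * ((2 * k choose 2) * 2)"
    unfolding e
  proof -
    obtain j where "k = j + 5" using Suc by (metis add.commute le_Suc_ex)
    then show "2 * Suc k * (2 * Suc k - 1) \<le> Suc k * (2 * k * (2 * k - 1))"
      by (simp add: algebra_simps)
  qed
  also have "\<dots> \<le> Suc k * fact k" using Suc by (intro mult_left_mono) auto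
  finally show ?case by simp
qed

text \<open>For m = \<open>card S - 1\<close>: a lower bound m choose 3 on an orbit already reaches
  the number of pairs of points.\<close>

lemma choose_three_ge: "m \<ge> 8 \<Longrightarrow> Suc m choose 2 \<le> m choose 3"
proof (induction m rule: nat_induct_at_least)
  case base
  then show ?case by (simp add: choose_two eval_nat_numeral)
next
  case (Suc m)
  have "Suc (Suc m) choose 2 = Suc m + (Suc m choose 2)" by (simp add: numeral_2_eq_2)
  moreover have "Suc m choose 3 = (m choose 2) + (m choose 3)"
    by (simp add: numeral_2_eq_2 numeral_3_eq_3)
  moreover have "Suc m \<le> m choose 2"
  proof -
    have "2 * Suc m \<le> m * (m - 1)"
    proof -
      have "2 * Suc m \<le> m * 7" using Suc(1) by simp
      also have "\<dots> \<le> m * (m - 1)" using Suc(1) by (intro mult_le_mono2) simp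
      finally show ?thesis .
    qed
    then show ?thesis by (simp add: choose_two)
  qed
  ultimately show ?case using Suc by linarith
qed

section \<open>Orbits and stabilizers of the alternating group\<close>

locale alternating_action =
  fixes S :: "'a set" and \<Omega> :: "'b set" and act :: "('a \<Rightarrow> 'a) \<Rightarrow> 'b \<Rightarrow> 'b"
  assumes finite_points: "finite S"
    and act_closed: "\<And>p x. p \<in> alternating S \<Longrightarrow> x \<in> \<Omega> \<Longrightarrow> act p x \<in> \<Omega>"
    and act_id: "\<And>x. x \<in> \<Omega> \<Longrightarrow> act id x = x"
    and act_comp: "\<And>p q x. p \<in> alternating S \<Longrightarrow> q \<in> alternating S \<Longrightarrow> x \<in> \<Omega> \<Longrightarrow>
      act (p \<circ> q) x = act p (act q x)"
begin

definition stab :: "'b \<Rightarrow> ('a \<Rightarrow> 'a) set" where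
  "stab x = {p \<in> alternating S. act p x = x}"

definition orb :: "'b \<Rightarrow> 'b set" where
  "orb x = (\<lambda>p. act p x) ` alternating S"

lemma inv_alternating: "p \<in> alternating S \<Longrightarrow> inv' p \<in> alternating S"
  using alternating_inv finite_points by blast

lemma comp_alternating: "p \<in> alternating S \<Longrightarrow> q \<in> alternating S \<Longrightarrow> p \<circ> q \<in> alternating S"
  using alternating_comp finite_points by blast

lemma bij_alternating: "p \<in> alternating S \<Longrightarrow> bij p"
  by (auto simp: alternating_def permutes_bij)

lemma act_inv:
  assumes "p \<in> alternating S" "x \<in> \<Omega>"
  shows "act (inv' p) (act p x) = x" "act p (act (inv' p) x) = x"
proof -
  have "inv' p \<circ> p = id" "p \<circ> inv' p = id"
    using alternatingD(1)[OF assms(1)] permutes_inv_o by auto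
  then show "act (inv' p) (act p x) = x" "act p (act (inv' p) x) = x"
    using act_comp[OF inv_alternating[OF assms(1)] assms(1) assms(2)]
      act_comp[OF assms(1) inv_alternating[OF assms(1)] assms(2)] act_id assms(2) by metis+
qed

lemma act_inj:
  assumes "p \<in> alternating S" "x \<in> \<Omega>" "y \<in> \<Omega>" "act p x = act p y"
  shows "x = y"
  using assms act_inv by metis

lemma act_eq_iff:
  assumes "p \<in> alternating S" "q \<in> alternating S" "x \<in> \<Omega>"
  shows "act p x = act q x \<longleftrightarrow> inv' q \<circ> p \<in> stab x"
proof -
  have "act (inv' q \<circ> p) x = act (inv' q) (act p x)"
    using act_comp assms inv_alternating by blast
  moreover have "act (inv' q) (act p x) = x \<longleftrightarrow> act p x = act q x"
    using act_inv[OF assms(2)] act_inv(1)[OF assms(2,3)] act_closed assms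
    by metis
  ultimately show ?thesis
    using assms comp_alternating inv_alternating by (simp add: stab_def)
qed

lemma stab_subgroup:
  assumes "x \<in> \<Omega>"
  shows "alternating_subgroup S (stab x)"
proof
  show "p \<circ> q \<in> stab x" if "p \<in> stab x" "q \<in> stab x" for p q
    using that assms by (simp add: stab_def comp_alternating act_comp)
  show "inv' p \<in> stab x" if "p \<in> stab x" for p
    using that assms act_inv[of p x] inv_alternating by (auto simp: stab_def)
qed (use assms finite_points in \<open>auto simp: stab_def act_id alternating_id\<close>)

lemma finite_orb: "finite (orb x)"
  unfolding orb_def using finite_alternating finite_points by blast

lemma orb_subset: "x \<in> \<Omega> \<Longrightarrow> orb x \<subseteq> \<Omega>"
  by (auto simp: orb_def act_closed)

lemma act_orb: "x \<in> \<Omega> \<Longrightarrow> y \<in> orb x \<Longrightarrow> p \<in> alternating S \<Longrightarrow> act p y \<in> orb x"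
  by (auto simp: orb_def act_comp[symmetric] comp_alternating)

lemma orb_refl: "x \<in> \<Omega> \<Longrightarrow> x \<in> orb x"
  unfolding orb_def using act_id alternating_id by (metis image_eqI)

text \<open>The alternating group of \<open>C\<close> meets the stabilizer trivially, so its
  elements send \<open>x\<close> to distinct points.\<close>

lemma card_alternating_le_orbit:
  assumes "x \<in> \<Omega>" "C \<subseteq> S" and triv: "\<And>p. p \<in> stab x \<Longrightarrow> p permutes C \<Longrightarrow> p = id"
  shows "card (alternating C) \<le> card (orb x)"
proof (rule card_inj_on_le)
  show "inj_on (\<lambda>p. act p x) (alternating C)"
  proof (rule inj_onI)
    fix p q assume pq: "p \<in> alternating C" "q \<in> alternating C" "act p x = act q x"
    have "p \<in> alternating S" "q \<in> alternating S" using pq alternating_mono[OF assms(2)] by auto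
    then have "inv' q \<circ> p \<in> stab x" using act_eq_iff assms(1) pq(3) by blast
    moreover have "inv' q \<circ> p permutes C"
      using pq by (auto simp: alternating_def intro: permutes_compose permutes_inv)
    ultimately have "inv' q \<circ> p = id" using triv by blast
    then show "p = q"
      using alternatingD(1)[OF pq(2)] permutes_inv_o(1) by (metis comp_assoc comp_id id_comp)
  qed
  show "(\<lambda>p. act p x) ` alternating C \<subseteq> orb x"
    using alternating_mono[OF assms(2)] by (auto simp: orb_def)
qed (rule finite_orb)

lemma three_full_act:
  assumes "x \<in> \<Omega>" "p \<in> alternating S" "three_full (stab x) B"
  shows "three_full (stab (act p x)) (p ` B)"
  unfolding three_full_def
proof (intro ballI impI)
  fix a' b' c' assume "a' \<in> p ` B" "b' \<in> p ` B" "c' \<in> p ` B" "distinct [a', b', c']"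
  then obtain a b c where abc: "a \<in> B" "b \<in> B" "c \<in> B" "distinct [a, b, c]"
    and eq: "a' = p a" "b' = p b" "c' = p c" by auto
  let ?t = "three_cycle a b c"
  have t: "?t \<in> alternating S" "act ?t x = x"
    using assms(3) abc by (auto simp: three_full_def stab_def)
  have "act (p \<circ> ?t \<circ> inv' p) (act p x) = act p x"
    using assms t act_inv[OF assms(2,1)] act_closed
    by (simp add: act_comp inv_alternating comp_alternating)
  then show "three_cycle a' b' c' \<in> stab (act p x)"
    using assms t unfolding eq three_cycle_conjugate[OF bij_alternating[OF assms(2)], symmetric]
    by (auto simp: stab_def intro!: comp_alternating inv_alternating)
qed

lemma three_full_act_iff:
  assumes "x \<in> \<Omega>" "p \<in> alternating S"
  shows "three_full (stab (act p x)) (p ` B) \<longleftrightarrow> three_full (stab x) B"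
proof
  assume "three_full (stab (act p x)) (p ` B)"
  from three_full_act[OF _ inv_alternating[OF assms(2)] this]
  have "three_full (stab x) (inv' p ` p ` B)" using assms act_closed act_inv by metis
  moreover have "inv' p ` p ` B = B"
    using bij_alternating[OF assms(2)] by (simp add: bij_def image_inv_f_f)
  ultimately show "three_full (stab x) B" by simp
qed (use three_full_act assms in blast)

text \<open>
  The maximal sets all of whose 3-cycles lie in a stabilizer are pairwise disjoint, and the orbit
  realizes every set of their cardinality \<open>k\<close>: double counting bounds the orbit from below.
\<close>

lemma large_three_full:
  assumes x: "x \<in> \<Omega>" and S: "card S \<ge> 9" and small: "card (orb x) < card S choose 2"
  obtains B where "B \<subseteq> S" "three_full (stab x) B" "card B \<ge> card S - 1"
proof -
  let ?n = "card S"
  interpret alternating_subgroup S "stab x" by (rule stab_subgroup[OF x])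
  \<comment> \<open>Otherwise there is a set \<open>C\<close> with at least half of the points on
    which the stabilizer is trivial, and the orbit has at least \<open>fact (card C)\<close> / 2
    elements.\<close>
  have "\<exists>a\<in>S. \<exists>b\<in>S. \<exists>c\<in>S. distinct [a, b, c] \<and> three_cycle a b c \<in> stab x"
  proof (rule ccontr)
    assume "\<not> ?thesis"
    then obtain C where C: "C \<subseteq> S" "?n \<le> 2 * card C" "\<And>p. p \<in> stab x \<Longrightarrow> p permutes C \<Longrightarrow> p = id"
      using three_cycle_or_trivial_on_half by blast
    have "finite C" using C(1) finite_points finite_subset by blast
    have "(?n choose 2) * 2 \<le> (2 * card C choose 2) * 2"
      using C(2) by (intro mult_right_mono binomial_right_mono) auto
    also have "\<dots> \<le> fact (card C)" using C(2) S by (intro fact_ge_choose) linarith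
    also have "\<dots> = 2 * card (alternating C)"
      using card_alternating[OF \<open>finite C\<close>] C(2) S by simp
    also have "\<dots> \<le> 2 * card (orb x)" using card_alternating_le_orbit[OF x C(1,3)] by simp
    finally show False using small by simp
  qed
  then obtain a b c where abc: "{a, b, c} \<subseteq> S" "distinct [a, b, c]" "three_cycle a b c \<in> stab x"
    by auto
  let ?P = "\<lambda>B. B \<subseteq> S \<and> three_full (stab x) B"
  have P: "?P {a, b, c}" using abc three_full_triple by blast
  have bound: "\<forall>B. ?P B \<longrightarrow> card B < Suc ?n"
    using finite_points card_mono less_Suc_eq_le by blast
  obtain B where B: "B \<subseteq> S" "three_full (stab x) B" and max: "\<And>B'. ?P B' \<Longrightarrow> card B' \<le> card B"
    using ex_has_greatest_nat[of ?P "{a, b, c}" card, OF P bound] by blast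
  define k where "k = card B"
  have k3: "k \<ge> 3" using max[OF P] abc(2) by (simp add: k_def)
  show ?thesis
  proof (cases "k \<ge> ?n - 1")
    case True
    then show ?thesis using that B by (simp add: k_def)
  next
    case False
    \<comment> \<open>The full sets of maximal size k for the stabilizer of \<open>y\<close>. They
      are disjoint, so there are at most n / k of them.\<close>
    define \<B> where "\<B> y = {T. T \<subseteq> S \<and> card T = k \<and> three_full (stab y) T}" for y
    have finB: "finite (\<B> y)" for y
      by (rule finite_subset[of _ "Pow S"]) (auto simp: \<B>_def finite_points)
    have maxy: "card T \<le> k" if yx: "y \<in> orb x" and TS: "T \<subseteq> S" and full: "three_full (stab y) T" for y T
    proof -
      obtain p where p: "p \<in> alternating S" "y = act p x" using yx by (auto simp: orb_def)
      have bp: "bij p" using p bij_alternating by blast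
      have T: "T = p ` (inv' p ` T)" using bp by (simp add: bij_def image_f_inv_f)
      have "inv' p ` T \<subseteq> S"
        using TS permutes_image[OF permutes_inv[OF alternatingD(1)[OF p(1)]]] by auto
      moreover have "three_full (stab x) (inv' p ` T)"
        using full three_full_act_iff[OF x p(1)] T p(2) by metis
      ultimately have "card (inv' p ` T) \<le> k" using max unfolding k_def by blast
      moreover have "card (inv' p ` T) = card T"
        using bp by (meson bij_imp_bij_inv card_image bij_is_inj inj_on_subset subset_UNIV)
      ultimately show ?thesis by simp
    qed
    have disj: "T = T'" if y: "y \<in> orb x" and TT: "T \<in> \<B> y" "T' \<in> \<B> y" "T \<inter> T' \<noteq> {}" for y T T'
    proof -
      obtain i where i: "i \<in> T" "i \<in> T'" using TT by blast
      interpret y: alternating_subgroup S "stab y"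
        using stab_subgroup orb_subset[OF x] y by blast
      have "T' \<subseteq> T"
        using TT i k3 maxy[OF y]
        by (intro y.three_full_absorbs[of T T' i]) (auto simp: \<B>_def)
      moreover have "T \<subseteq> T'"
        using TT i k3 maxy[OF y]
        by (intro y.three_full_absorbs[of T' T i]) (auto simp: \<B>_def)
      ultimately show ?thesis by blast
    qed
    have cardB: "card (\<B> y) * k \<le> ?n" if "y \<in> orb x" for y
    proof -
      have "card (\<Union> (\<B> y)) = (\<Sum>T\<in>\<B> y. card T)"
      proof (rule card_Union_disjoint)
        show "pairwise disjnt (\<B> y)"
          using disj[OF that] by (auto simp: pairwise_def disjnt_def)
      qed (auto simp: \<B>_def intro: finite_subset[OF _ finite_points])
      also have "\<dots> = card (\<B> y) * k" by (simp add: \<B>_def)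
      finally show ?thesis
        using card_mono[OF finite_points, of "\<Union> (\<B> y)"] by (auto simp: \<B>_def)
    qed
    define \<T> where "\<T> = {T. T \<subseteq> S \<and> card T = k}"
    have finT: "finite \<T>" by (rule finite_subset[of _ "Pow S"]) (auto simp: \<T>_def finite_points)
    have cT: "card \<T> = ?n choose k" unfolding \<T>_def by (rule n_subsets[OF finite_points])
    have count: "(\<Sum>y\<in>orb x. card (\<B> y)) = (\<Sum>T\<in>\<T>. card {y \<in> orb x. T \<in> \<B> y})"
    proof -
      have "(\<Sum>y\<in>orb x. card (\<B> y)) = (\<Sum>y\<in>orb x. \<Sum>T | T \<in> \<T> \<and> T \<in> \<B> y. 1)"
        by (intro sum.cong) (auto simp: \<T>_def \<B>_def intro!: arg_cong[where f = card])
      also have "\<dots> = (\<Sum>T\<in>\<T>. \<Sum>y | y \<in> orb x \<and> T \<in> \<B> y. 1)"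
        using finite_orb finT by (rule sum.swap_restrict)
      finally show ?thesis by simp
    qed
    have ex: "\<exists>y\<in>orb x. T \<in> \<B> y" if T: "T \<in> \<T>" for T
    proof -
      obtain p where p: "p \<in> alternating S" "p ` B = T"
        using alternating_moves_subset[OF finite_points, of B T] T B k3
        by (auto simp: \<T>_def k_def)
      then have "T \<in> \<B> (act p x)"
        using three_full_act[OF x p(1) B(2)] T by (auto simp: \<B>_def \<T>_def)
      then show ?thesis using p by (auto simp: orb_def)
    qed
    \<comment> \<open>Together with \<open>abs\<close> this says that the orbit has at least c times
      (n - 1 choose k - 1) elements.\<close>
    have lower: "c * (?n choose k) * k \<le> card (orb x) * ?n"
      if "\<And>T. T \<in> \<T> \<Longrightarrow> c \<le> card {y \<in> orb x. T \<in> \<B> y}" for c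
    proof -
      have "c * (?n choose k) = (\<Sum>T\<in>\<T>. c)" by (simp add: cT)
      also have "\<dots> \<le> (\<Sum>y\<in>orb x. card (\<B> y))" unfolding count by (intro sum_mono that)
      finally have "c * (?n choose k) * k \<le> (\<Sum>y\<in>orb x. card (\<B> y)) * k" by simp
      also have "\<dots> = (\<Sum>y\<in>orb x. card (\<B> y) * k)" by (rule sum_distrib_right)
      also have "\<dots> \<le> (\<Sum>y\<in>orb x. ?n)" by (intro sum_mono cardB)
      finally show ?thesis by simp
    qed
    have pos: "1 \<le> card {y \<in> orb x. T \<in> \<B> y}" if "T \<in> \<T>" for T
    proof -
      have "{y \<in> orb x. T \<in> \<B> y} \<noteq> {}" using ex[OF that] by blast
      then show ?thesis using finite_orb by (simp add: Suc_le_eq card_gt_0_iff)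
    qed
    have abs: "?n * (?n - 1 choose (k - 1)) = (?n choose k) * k"
      using binomial_absorption[of "k - 1" ?n] k3 S by (simp add: mult.commute)
    consider "k = 3" | "k \<ge> 4" "2 * k \<le> ?n" | "2 * k > ?n" using k3 by linarith
    then have "?n choose 2 \<le> card (orb x)"
    proof cases
      case 1
      \<comment> \<open>For k = 3 the count with c = 1 yields only n - 1 choose 2. If a single
        \<open>y\<close> had \<open>T\<close> as a full set, every even permutation of
        \<open>S - T\<close> would fix this \<open>y\<close>, and \<open>S - T\<close> would be a
        full set with more than three points.\<close>
      have "2 \<le> card {y \<in> orb x. T \<in> \<B> y}" if T: "T \<in> \<T>" for T
      proof (rule ccontr)
        assume "\<not> ?thesis"
        then have "card {y \<in> orb x. T \<in> \<B> y} \<le> 1" by simp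
        then have uniq: "y = y'" if "y \<in> orb x" "y' \<in> orb x" "T \<in> \<B> y" "T \<in> \<B> y'" for y y'
          using that finite_orb by (auto simp: card_le_Suc0_iff_eq)
        obtain y where y: "y \<in> orb x" "T \<in> \<B> y" using ex[OF T] by blast
        have y\<Omega>: "y \<in> \<Omega>" using y orb_subset[OF x] by blast
        have TS: "T \<subseteq> S" "card T = k" using T by (auto simp: \<T>_def)
        have stabT: "p \<in> stab y" if "p \<in> alternating (S - T)" for p
        proof -
          have p: "p \<in> alternating S" using that alternating_mono[of "S - T" S] by auto
          have "p ` T = T"
            using that by (auto simp: alternating_def permutes_def image_iff)
          then have "T \<in> \<B> (act p y)"
            using three_full_act[OF y\<Omega> p, of T] y TS by (auto simp: \<B>_def)
          then have "act p y = y" using uniq[OF act_orb[OF x y(1) p] y(1)] y by blast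
          then show ?thesis using p by (simp add: stab_def)
        qed
        have "three_full (stab y) (S - T)"
          unfolding three_full_def by (intro ballI impI stabT three_cycle_alternating) auto
        then have "card (S - T) \<le> k" using maxy[OF y(1)] by blast
        moreover have "card (S - T) = ?n - k"
          using TS finite_points finite_subset by (metis card_Diff_subset)
        ultimately show False using 1 S by linarith
      qed
      then have "2 * (?n choose k) * k \<le> card (orb x) * ?n" by (rule lower)
      moreover have "?n * (2 * (?n - 1 choose 2)) = 2 * (?n choose k) * k"
        using abs 1 by simp
      ultimately have "?n * (2 * (?n - 1 choose 2)) \<le> ?n * card (orb x)"
        by (simp only: mult.commute)
      then have le: "2 * (?n - 1 choose 2) \<le> card (orb x)" using S by simp
      obtain j where j: "?n = j + 9" using S by (metis add.commute le_Suc_ex)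
      have "Suc (j + 8) choose Suc 1 = (j + 8 choose 1) + (j + 8 choose Suc 1)"
        by (rule binomial_Suc_Suc)
      then have "?n choose 2 = (?n - 1) + (?n - 1 choose 2)"
        by (simp add: j numeral_2_eq_2 add.commute)
      moreover have "?n - 1 \<le> ?n - 1 choose 2"
        unfolding j by (simp add: choose_two less_eq_div_iff_mult_less_eq algebra_simps)
      ultimately show ?thesis using le by linarith
    next
      case 2
      have "1 * (?n choose k) * k \<le> card (orb x) * ?n" by (rule lower[OF pos])
      then have "?n * (?n - 1 choose (k - 1)) \<le> ?n * card (orb x)"
        using abs by (simp add: ac_simps)
      then have le: "?n - 1 choose (k - 1) \<le> card (orb x)" using S by (simp add: ac_simps)
      have "?n choose 2 \<le> ?n - 1 choose 3" using choose_three_ge[of "?n - 1"] S by simp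
      also have "\<dots> \<le> ?n - 1 choose (k - 1)" using 2 by (intro binomial_mono) auto
      finally show ?thesis using le by linarith
    next
      case 3
      \<comment> \<open>Two disjoint sets of more than half of the points do not exist, so a point
        of the orbit has at most one full set of size k.\<close>
      have "?n choose k = (\<Sum>T\<in>\<T>. 1)" by (simp add: cT)
      also have "\<dots> \<le> (\<Sum>y\<in>orb x. card (\<B> y))" unfolding count by (intro sum_mono pos)
      also have "\<dots> \<le> (\<Sum>y\<in>orb x. 1)"
      proof (rule sum_mono)
        fix y assume "y \<in> orb x"
        then have "card (\<B> y) * k < 2 * k" using cardB[of y] 3 by linarith
        then show "card (\<B> y) \<le> 1" by simp
      qed
      finally have "?n choose k \<le> card (orb x)" by simp
      moreover have "?n choose 2 \<le> ?n choose k"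
      proof -
        have "?n choose (?n - 2) \<le> ?n choose k" using False 3 by (intro binomial_antimono) auto
        moreover have "?n choose (?n - 2) = ?n choose 2"
          using binomial_symmetric[of 2 ?n] S by simp
        ultimately show ?thesis by simp
      qed
      ultimately show ?thesis by linarith
    qed
    then show ?thesis using small by linarith
  qed
qed

text \<open>Suppose the full set \<open>B\<close> misses one point \<open>i\<close>. An element of
  the stabilizer moving \<open>i\<close> would carry \<open>B\<close> to a full set that contains
  \<open>i\<close> and meets \<open>B\<close>, against \<open>three_full_absorbs\<close>. The bound
  is the right one: the pairs of points form an orbit of size n choose 2.\<close>

theorem small_orbit_stabilizer:
  assumes x: "x \<in> \<Omega>" and S: "card S \<ge> 9" and small: "card (orb x) < card S choose 2"
  shows "stab x = alternating S \<or> (\<exists>i\<in>S. stab x = {p \<in> alternating S. p i = i})"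
proof -
  interpret alternating_subgroup S "stab x" by (rule stab_subgroup[OF x])
  obtain B where B: "B \<subseteq> S" "three_full (stab x) B" "card B \<ge> card S - 1"
    using large_three_full[OF assms] .
  show ?thesis
  proof (cases "three_full (stab x) S")
    case True
    then show ?thesis using three_full_alternating[OF True] by (auto simp: stab_def)
  next
    case False
    have finB: "finite B" using B finite_points finite_subset by blast
    have "B \<noteq> S" using B False by blast
    then obtain i where i: "i \<in> S" "i \<notin> B" using B by blast
    have "B \<subseteq> S - {i}" "card (S - {i}) \<le> card B" using B i finite_points by auto
    then have B_eq: "B = S - {i}" using finite_points by (metis card_seteq finite_Diff)
    have cB: "card B \<ge> 3" using B S by linarith
    have max: "card B' \<le> card B" if "three_full (stab x) B'" "B' \<subseteq> S" for B'
    proof -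
      have "B' \<noteq> S" using that False by blast
      then have "card B' < card S" using that finite_points by (simp add: psubset_card_mono psubsetI)
      then show ?thesis using B(3) by linarith
    qed
    have "p i = i" if p: "p \<in> stab x" for p
    proof (rule ccontr)
      assume ne: "p i \<noteq> i"
      have pS: "p permutes S" using p permutes by blast
      let ?C = "p ` B"
      have "p \<in> alternating S" "act p x = x" using p by (auto simp: stab_def)
      then have C: "three_full (stab x) ?C" using three_full_act[OF x _ B(2), of p] by simp
      have CS: "?C \<subseteq> S" using B(1) permutes_image[OF pS] by blast
      have cC: "card ?C = card B" using permutes_inj[OF pS] by (simp add: card_image inj_on_subset)
      have "i \<in> ?C"
      proof -
        obtain j where j: "j \<in> S" "p j = i" using pS i by (metis permutes_image imageE)
        then show ?thesis using ne by (auto simp: B_eq)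
      qed
      have "\<not> ?C \<subseteq> {i}" using cC cB card_mono[of "{i}" ?C] by auto
      then obtain a where a: "a \<in> ?C" "a \<noteq> i" by blast
      have "a \<in> B" using a CS by (auto simp: B_eq)
      then have "?C \<subseteq> B"
        using three_full_absorbs[OF B(2,1) cB max C CS] cC cB a by simp
      then show False using \<open>i \<in> ?C\<close> i by blast
    qed
    moreover have "p \<in> stab x" if "p \<in> alternating S" "p i = i" for p
    proof -
      have "p permutes (S - {i})"
        using that by (auto simp: alternating_def permutes_def)
      then have "p \<in> alternating B" using that by (auto simp: alternating_def B_eq)
      then show ?thesis using three_full_alternating[OF B(2,1)] by blast
    qed
    ultimately have "stab x = {p \<in> alternating S. p i = i}" by (auto simp: stab_def)
    then show ?thesis using i by blast
  qed
qed

end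

section \<open>Genus and Euler characteristic\<close>

abbreviation (input) chain_scale :: "int \<Rightarrow> ('d \<Rightarrow> int) \<Rightarrow> 'd \<Rightarrow> int" where
  "chain_scale \<equiv> \<lambda>k c d. k * c d"

text \<open>The scaling is literally the term inside \<open>genus\<close>, so that
  \<open>module.dependent\<close> there is \<open>chains.dependent\<close>.\<close>

interpretation chains: module "chain_scale :: int \<Rightarrow> ('d \<Rightarrow> int) \<Rightarrow> 'd \<Rightarrow> int"
  by unfold_locales (auto simp: fun_eq_iff algebra_simps plus_fun_def)

lemma chains_independent_iff:
  assumes "finite B"
  shows "\<not> chains.dependent B \<longleftrightarrow>
    (\<forall>u. (\<forall>d. (\<Sum>b\<in>B. u b * b d) = 0) \<longrightarrow> (\<forall>b\<in>B. u b = 0))"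
proof -
  have "(\<Sum>b\<in>B. (\<lambda>d. u b * b d)) = (\<lambda>d. \<Sum>b\<in>B. u b * b d)" for u
    by (induction B rule: infinite_finite_induct) (auto simp: fun_eq_iff)
  then show ?thesis
    using assms by (auto simp: chains.dependent_finite fun_eq_iff)
qed

text \<open>Fraction-free elimination, which avoids passing to rational coefficients.\<close>

lemma eliminate:
  fixes l :: "('d \<Rightarrow> int) \<Rightarrow> int"
  assumes B: "finite B" "\<not> chains.dependent B" "B \<subseteq> M"
    and M: "\<And>b c i j. b \<in> M \<Longrightarrow> c \<in> M \<Longrightarrow> (\<lambda>d. i * b d + j * c d) \<in> M"
    and l: "\<And>b c i j. b \<in> M \<Longrightarrow> c \<in> M \<Longrightarrow> l (\<lambda>d. i * b d + j * c d) = i * l b + j * l c"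
  obtains B' where "finite B'" "\<not> chains.dependent B'" "B' \<subseteq> {c \<in> M. l c = 0}"
    "card B \<le> Suc (card B')"
proof (cases "\<forall>b\<in>B. l b = 0")
  case True
  then show ?thesis using that[of B] B by auto
next
  case False
  then obtain a where a: "a \<in> B" "l a \<noteq> 0" by blast
  \<comment> \<open>An integral combination of \<open>b\<close> and the pivot \<open>a\<close> that
    \<open>l\<close> annihilates.\<close>
  define g where "g b = (\<lambda>d. l a * b d + (- l b) * a d)" for b
  have ind: "\<forall>b\<in>B. u b = 0" if "\<And>d. (\<Sum>b\<in>B. u b * b d) = 0" for u
    using B that by (simp add: chains_independent_iff)
  have comb: "\<forall>b\<in>B - {a}. u b = 0" if "\<And>d. (\<Sum>b\<in>B - {a}. u b * g b d) = 0" for u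
  proof -
    \<comment> \<open>A relation among the \<open>g b\<close> turns into a relation among
      \<open>B\<close> with these coefficients. Off \<open>a\<close> they are multiples of
      \<open>l a\<close>, which is nonzero and can be cancelled.\<close>
    let ?u = "\<lambda>b. if b = a then - (\<Sum>b\<in>B - {a}. u b * l b) else u b * l a"
    have "(\<Sum>b\<in>B. ?u b * b d) = 0" for d
    proof -
      have "(\<Sum>b\<in>B. ?u b * b d) = ?u a * a d + (\<Sum>b\<in>B - {a}. ?u b * b d)"
        using B a by (simp add: sum.remove)
      also have "(\<Sum>b\<in>B - {a}. ?u b * b d) = (\<Sum>b\<in>B - {a}. u b * l a * b d)"
        by (intro sum.cong) auto
      also have "?u a * a d = (\<Sum>b\<in>B - {a}. - (u b * l b * a d))"
        by (simp add: sum_distrib_right sum_negf)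
      finally have "(\<Sum>b\<in>B. ?u b * b d) = (\<Sum>b\<in>B - {a}. u b * g b d)"
        by (simp add: sum.distrib[symmetric] g_def algebra_simps)
      then show ?thesis using that by simp
    qed
    then have u: "\<forall>b\<in>B. ?u b = 0" by (rule ind)
    show ?thesis
    proof
      fix b assume "b \<in> B - {a}"
      then show "u b = 0" using bspec[OF u, of b] a by simp
    qed
  qed
  have inj: "inj_on g (B - {a})"
  proof (rule inj_onI, rule ccontr)
    fix b c assume bc: "b \<in> B - {a}" "c \<in> B - {a}" "g b = g c" "b \<noteq> c"
    let ?u = "\<lambda>x. if x = b then 1 else if x = c then - 1 else (0::int)"
    have "(\<Sum>x\<in>B - {a}. ?u x * g x d) = 0" for d
    proof -
      have "(\<Sum>x\<in>B - {a}. ?u x * g x d) = (\<Sum>x\<in>{b, c}. ?u x * g x d)"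
        using bc B by (intro sum.mono_neutral_right) auto
      then show ?thesis using bc by simp
    qed
    then have u: "\<forall>x\<in>B - {a}. ?u x = 0" by (rule comb)
    show False using bspec[OF u bc(1)] by simp
  qed
  let ?B = "g ` (B - {a})"
  have "\<forall>c\<in>?B. u c = 0" if "\<And>d. (\<Sum>c\<in>?B. u c * c d) = 0" for u
  proof -
    have "\<forall>b\<in>B - {a}. (u \<circ> g) b = 0"
      using that by (intro comb) (simp add: sum.reindex[OF inj])
    then show ?thesis by auto
  qed
  then have "\<not> chains.dependent ?B" using B by (simp add: chains_independent_iff)
  moreover have "l (g b) = 0" "g b \<in> M" if "b \<in> B" for b
    unfolding g_def using l[of b a "l a" "- l b"] M[of b a "l a" "- l b"] that a B by auto
  then have "?B \<subseteq> {c \<in> M. l c = 0}" by auto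
  moreover have "card B \<le> Suc (card ?B)"
    using B a by (simp add: card_image[OF inj] card_Suc_Diff1)
  ultimately show ?thesis using B(1) by (intro that[of ?B]) auto
qed

text \<open>One elimination for each dart. This bounds the cardinalities collected in
  \<open>genus\<close>, as the use of \<open>Max\<close> requires.\<close>

lemma independent_chains_card_le:
  assumes "finite D" "finite B" "\<not> chains.dependent B" "\<And>b d. b \<in> B \<Longrightarrow> d \<notin> D \<Longrightarrow> b d = 0"
  shows "card B \<le> card D"
  using assms
proof (induction D arbitrary: B rule: finite_induct)
  case empty
  have "(\<forall>d. (\<Sum>b\<in>B. 1 * b d) = 0) \<longrightarrow> (\<forall>b\<in>B. (1::int) = 0)"
    using empty(2) unfolding chains_independent_iff[OF empty(1)] by (rule spec)
  moreover have "(\<Sum>b\<in>B. 1 * b d) = 0" for d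
    using empty(3) by (intro sum.neutral) simp
  ultimately show ?case by auto
next
  case (insert x D)
  let ?M = "{c :: 'a \<Rightarrow> int. \<forall>d. d \<notin> insert x D \<longrightarrow> c d = 0}"
  obtain B' where B': "finite B'" "\<not> chains.dependent B'" "B' \<subseteq> {c \<in> ?M. c x = 0}"
    "card B \<le> Suc (card B')"
    using eliminate[of B ?M "\<lambda>c. c x"] insert.prems by auto
  have "card B' \<le> card D" using B' by (intro insert.IH) auto
  then show ?case using B' insert by simp
qed

lemma eliminate_many:
  fixes l :: "'i \<Rightarrow> ('d \<Rightarrow> int) \<Rightarrow> int"
  assumes "finite I" and B: "finite B" "\<not> chains.dependent B" "B \<subseteq> M"
    and M: "\<And>b c i j. b \<in> M \<Longrightarrow> c \<in> M \<Longrightarrow> (\<lambda>d. i * b d + j * c d) \<in> M"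
    and l: "\<And>v b c i j. v \<in> I \<Longrightarrow> b \<in> M \<Longrightarrow> c \<in> M \<Longrightarrow>
      l v (\<lambda>d. i * b d + j * c d) = i * l v b + j * l v c"
  shows "\<exists>B'. finite B' \<and> \<not> chains.dependent B' \<and> B' \<subseteq> {c \<in> M. \<forall>v\<in>I. l v c = 0} \<and>
    card B \<le> card B' + card I"
  using assms(1) l
proof (induction I rule: finite_induct)
  case empty
  then show ?case using B by auto
next
  case (insert v I)
  then obtain B' where B': "finite B'" "\<not> chains.dependent B'"
    "B' \<subseteq> {c \<in> M. \<forall>v\<in>I. l v c = 0}" "card B \<le> card B' + card I"
    by auto
  obtain B'' where B'': "finite B''" "\<not> chains.dependent B''"
    "B'' \<subseteq> {c \<in> {c \<in> M. \<forall>v\<in>I. l v c = 0}. l v c = 0}" "card B' \<le> Suc (card B'')"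
    by (rule eliminate[OF B'(1-3), of "l v"]) (use M insert.prems in auto)
  show ?case
    using B'' B'(4) insert.hyps by (intro exI[of _ B'']) auto
qed

lemma H1_card_le:
  assumes "finite_graph X" "finite B" "B \<subseteq> H1 X" "\<not> chains.dependent B"
  shows "card B \<le> card (darts X)"
  using assms by (intro independent_chains_card_le) (auto simp: finite_graph_def H1_def)

lemma genus_ge:
  assumes "finite_graph X" "finite B" "B \<subseteq> H1 X" "\<not> chains.dependent B"
  shows "card B \<le> genus X"
  unfolding genus_def
proof (rule Max_ge)
  show "finite {card B |B. finite B \<and> B \<subseteq> H1 X \<and> \<not> chains.dependent B}"
    using H1_card_le[OF assms(1)] by (intro finite_subset[OF _ finite_atMost[of "card (darts X)"]]) auto
qed (use assms in auto)

text \<open>The set \<open>P\<close> is an orientation: it has one dart of each edge.\<close>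

lemma oriented_edges:
  assumes "is_graph X" "finite (darts X)"
  obtains P where "P \<subseteq> darts X" "opp X ` P = darts X - P" "card (darts X) = 2 * card P"
proof -
  have "\<exists>P\<subseteq>D. opp X ` P = D - P \<and> card D = 2 * card P"
    if "finite D" "D \<subseteq> darts X" "opp X ` D \<subseteq> D" for D
    using that
  proof (induction "card D" arbitrary: D rule: less_induct)
    case less
    show ?case
    proof (cases "D = {}")
      case False
      then obtain d where d: "d \<in> D" by blast
      let ?e = "opp X d"
      have e: "?e \<in> D" "?e \<noteq> d" "opp X ?e = d"
        using d less.prems assms by (auto simp: is_graph_def)
      let ?D = "D - {d, ?e}"
      have sub: "opp X ` ?D \<subseteq> ?D"
      proof
        fix y assume "y \<in> opp X ` ?D"
        then obtain z where z: "z \<in> D" "z \<noteq> d" "z \<noteq> ?e" "y = opp X z" by auto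
        have "opp X y = z" using z less.prems assms by (auto simp: is_graph_def)
        then show "y \<in> ?D" using z e less.prems by auto
      qed
      have card: "card D = Suc (Suc (card ?D))"
        using d e less.prems(1) by (metis DiffI Diff_insert2 card_Suc_Diff1 finite_Diff singletonD)
      obtain P where P: "P \<subseteq> ?D" "opp X ` P = ?D - P" "card ?D = 2 * card P"
        using less.hyps[of ?D] card sub less.prems by auto
      have "finite P" "d \<notin> P" using P(1) finite_subset[OF P(1)] less.prems(1) by auto
      moreover have "opp X ` insert d P = D - insert d P"
        using P d e by auto
      ultimately show ?thesis
        using P d card by (intro exI[of _ "insert d P"]) auto
    qed auto
  qed
  from this[OF assms(2) subset_refl] show ?thesis
    using that assms(1) by (auto simp: is_graph_def image_subset_iff)
qed

text \<open>The elementary chains of an orientation are independent, and each vertex condition costs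
  at most one of them. The condition at the last vertex \<open>w\<close> follows from the others,
  because an antisymmetric chain sums to 0 over all darts; this saves the 1 in E - V + 1.\<close>

theorem genus_lower_bound:
  assumes X: "is_graph X" "finite_graph X" "verts X \<noteq> {}"
  shows "card (darts X) + 2 \<le> 2 * genus X + 2 * card (verts X)"
proof -
  have fin: "finite (darts X)" "finite (verts X)" using X by (auto simp: finite_graph_def)
  obtain P where P: "P \<subseteq> darts X" "opp X ` P = darts X - P" "card (darts X) = 2 * card P"
    using oriented_edges[OF X(1) fin(1)] .
  have finP: "finite P" using P fin finite_subset by blast
  have oppP: "opp X d \<notin> P" "opp X (opp X d) = d" "opp X d \<in> darts X" "opp X d \<noteq> d" if "d \<in> P" for d
    using P that X(1) by (auto simp: is_graph_def)
  define e where "e p = (\<lambda>d. if d = p then 1 else if d = opp X p then -1 else (0::int))" for p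
  define M where "M = {c :: 'b \<Rightarrow> int. (\<forall>d. d \<notin> darts X \<longrightarrow> c d = 0) \<and>
    (\<forall>d\<in>darts X. c (opp X d) = - c d)}"
  have eP: "e p q = (if p = q then 1 else 0)" if "p \<in> P" "q \<in> P" for p q
    using that oppP by (auto simp: e_def)
  have inj: "inj_on e P"
  proof (rule inj_onI)
    fix p q assume "p \<in> P" "q \<in> P" "e p = e q"
    then show "p = q" using eP[of p q] eP[of q q] by (auto split: if_splits)
  qed
  have ind: "\<not> chains.dependent (e ` P)"
  proof -
    have "\<forall>b\<in>e ` P. u b = 0" if "\<And>d. (\<Sum>b\<in>e ` P. u b * b d) = 0" for u
    proof (intro ballI)
      fix b assume "b \<in> e ` P"
      then obtain q where q: "q \<in> P" "b = e q" by blast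
      have "0 = (\<Sum>p\<in>P. u (e p) * e p q)" using that[of q] by (simp add: sum.reindex[OF inj])
      also have "\<dots> = (\<Sum>p\<in>P. if p = q then u (e p) else 0)"
        using q eP by (intro sum.cong) auto
      also have "\<dots> = u b" using q finP by simp
      finally show "u b = 0" by simp
    qed
    then show ?thesis using finP by (simp add: chains_independent_iff)
  qed
  have eM: "e ` P \<subseteq> M"
  proof
    fix c assume "c \<in> e ` P"
    then obtain p where p: "p \<in> P" "c = e p" by blast
    have "e p (opp X d) = - e p d" if "d \<in> darts X" for d
    proof -
      have "opp X d = p \<longleftrightarrow> d = opp X p" "opp X d = opp X p \<longleftrightarrow> d = p"
        using that X(1) p P by (metis is_graph_def subsetD)+
      then show ?thesis using oppP p by (auto simp: e_def)
    qed
    then show "c \<in> M" using p P oppP by (auto simp: M_def e_def)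
  qed
  obtain w where w: "w \<in> verts X" using X(3) by blast
  let ?l = "\<lambda>v (c :: 'b \<Rightarrow> int). \<Sum>d | d \<in> darts X \<and> tail X d = v. c d"
  obtain B where B: "finite B" "\<not> chains.dependent B"
    "B \<subseteq> {c \<in> M. \<forall>v\<in>verts X - {w}. ?l v c = 0}"
    "card (e ` P) \<le> card B + card (verts X - {w})"
    using eliminate_many[of "verts X - {w}" "e ` P" M ?l] fin ind eM finP
    by (auto simp: M_def algebra_simps sum.distrib sum_distrib_left)
  have "?l w c = 0" if c: "c \<in> M" "\<forall>v\<in>verts X - {w}. ?l v c = 0" for c
  proof -
    have "(\<Sum>d\<in>darts X. c d) = (\<Sum>d\<in>P. c d) + (\<Sum>d\<in>darts X - P. c d)"
      using P fin by (simp add: sum.subset_diff)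
    also have "(\<Sum>d\<in>darts X - P. c d) = (\<Sum>d\<in>P. c (opp X d))"
      unfolding P(2)[symmetric] by (intro sum.reindex[unfolded comp_def])
        (metis inj_onI oppP(2))
    also have "\<dots> = - (\<Sum>d\<in>P. c d)"
      using c P by (auto simp: M_def sum_negf[symmetric] intro!: sum.cong)
    finally have "(\<Sum>d\<in>darts X. c d) = 0" by simp
    moreover have "(\<Sum>d\<in>darts X. c d) = (\<Sum>v\<in>verts X. ?l v c)"
      using fin X(1) by (intro sum.group[symmetric]) (auto simp: is_graph_def)
    moreover have "(\<Sum>v\<in>verts X. ?l v c) = ?l w c + (\<Sum>v\<in>verts X - {w}. ?l v c)"
      using fin(2) w by (rule sum.remove)
    ultimately show ?thesis using c(2) by simp
  qed
  note lw = this
  have "c \<in> H1 X" if "c \<in> B" for c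
  proof -
    have c: "c \<in> M" "\<forall>v\<in>verts X - {w}. ?l v c = 0" using that B(3) by auto
    have "?l v c = 0" if "v \<in> verts X" for v using c(2) lw[OF c] that by (cases "v = w") auto
    then show ?thesis using c(1) by (simp add: H1_def M_def)
  qed
  then have "B \<subseteq> H1 X" by blast
  then have "card B \<le> genus X" using genus_ge X(2) B by blast
  moreover have "card (e ` P) = card P" by (rule card_image[OF inj])
  moreover have "card (verts X) = Suc (card (verts X - {w}))"
    using fin w by (metis card_Suc_Diff1)
  ultimately show ?thesis using B(4) P(3) by linarith
qed

section \<open>Edges contained in invariant forests\<close>

lemma tail_in_verts: "is_graph X \<Longrightarrow> d \<in> darts X \<Longrightarrow> tail X d \<in> verts X"
  and opp_in_darts: "is_graph X \<Longrightarrow> d \<in> darts X \<Longrightarrow> opp X d \<in> darts X"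
  and opp_neq: "is_graph X \<Longrightarrow> d \<in> darts X \<Longrightarrow> opp X d \<noteq> d"
  and opp_opp: "is_graph X \<Longrightarrow> d \<in> darts X \<Longrightarrow> opp X (opp X d) = d"
  by (auto simp: is_graph_def)

lemma head_opp: "is_graph X \<Longrightarrow> d \<in> darts X \<Longrightarrow> head X (opp X d) = tail X d"
  by (simp add: head_def opp_opp)

lemma head_in_verts: "is_graph X \<Longrightarrow> d \<in> darts X \<Longrightarrow> head X d \<in> verts X"
  by (simp add: head_def tail_in_verts opp_in_darts)

lemma AutD:
  assumes "(f, g) \<in> carrier (Aut X)"
  shows "bij_betw f (verts X) (verts X)" "bij_betw g (darts X) (darts X)"
    "\<And>d. d \<in> darts X \<Longrightarrow> tail X (g d) = f (tail X d)"
    "\<And>d. d \<in> darts X \<Longrightarrow> opp X (g d) = g (opp X d)"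
  using assms by (auto simp: Aut_def Bij_def)

lemma Aut_head:
  assumes "is_graph X" "(f, g) \<in> carrier (Aut X)" "d \<in> darts X"
  shows "head X (g d) = f (head X d)"
  using AutD[OF assms(2)] assms by (simp add: head_def opp_in_darts)

text \<open>The forest keeps all vertices of \<open>X\<close>, so its invariance is a matter of
  darts, and finiteness turns an inclusion of the image into an equality.\<close>

lemma has_invariant_forestI:
  assumes X: "is_graph X" "finite_graph X"
    and D: "D \<subseteq> darts X" "D \<noteq> {}" "\<And>d. d \<in> D \<Longrightarrow> opp X d \<in> D"
    and inv: "\<And>f g d. (f, g) \<in> carrier (Aut X) \<Longrightarrow> d \<in> D \<Longrightarrow> g d \<in> D"
    and acyclic: "\<And>ds. is_cycle X ds \<Longrightarrow> set ds \<subseteq> D \<Longrightarrow> False"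
  shows "has_invariant_forest X"
proof -
  let ?F = "X\<lparr>darts := D\<rparr>"
  have "subgraph ?F X" using X D by (auto simp: subgraph_def is_graph_def)
  moreover have "is_cycle X ds \<and> set ds \<subseteq> D" if "is_cycle ?F ds" for ds
    using that D(1) by (auto simp: is_cycle_def head_def)
  then have "nontrivial_forest ?F" using D(2) acyclic unfolding nontrivial_forest_def by fastforce
  moreover have "g ` D = D" if "(f, g) \<in> carrier (Aut X)" for f g
  proof (rule card_subset_eq)
    show "finite D" using X(2) D(1) finite_subset by (auto simp: finite_graph_def)
    show "g ` D \<subseteq> D" using inv that by blast
    have "inj_on g D"
      using AutD(2)[OF that] D(1) by (auto simp: bij_betw_def intro: inj_on_subset)
    then show "card (g ` D) = card D" by (rule card_image)
  qed
  then have "Aut_invariant X ?F"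
    using AutD(1) by (force simp: Aut_invariant_def bij_betw_def)
  ultimately show ?thesis by (auto simp: has_invariant_forest_def)
qed

text \<open>The cut of \<open>U\<close>, oriented outwards; when it has a single dart, that edge is
  a bridge.\<close>

definition leaving :: "('v, 'd) graph \<Rightarrow> 'v set \<Rightarrow> 'd set" where
  "leaving X U = {d \<in> darts X. tail X d \<in> U \<and> head X d \<notin> U}"

lemma leaving_complement:
  assumes "is_graph X"
  shows "leaving X (verts X - U) = opp X ` leaving X U"
proof
  show "leaving X (verts X - U) \<subseteq> opp X ` leaving X U"
  proof
    fix d assume "d \<in> leaving X (verts X - U)"
    then have d: "d \<in> darts X" "tail X d \<notin> U" "head X d \<in> U"
      using head_in_verts[OF assms] by (auto simp: leaving_def)
    then have "opp X d \<in> leaving X U"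
      using assms by (simp add: leaving_def opp_in_darts head_opp) (simp add: head_def)
    then show "d \<in> opp X ` leaving X U"
      using opp_opp[OF assms d(1)] by (metis image_eqI)
  qed
  show "opp X ` leaving X U \<subseteq> leaving X (verts X - U)"
  proof
    fix e assume "e \<in> opp X ` leaving X U"
    then obtain d where d: "d \<in> leaving X U" "e = opp X d" by blast
    then have dX: "d \<in> darts X" by (simp add: leaving_def)
    have "tail X e = head X d" "head X e = tail X d"
      using d dX assms by (simp_all add: head_def opp_opp)
    then show "e \<in> leaving X (verts X - U)"
      using d dX assms head_in_verts[OF assms dX] opp_in_darts[OF assms dX]
      by (auto simp: leaving_def)
  qed
qed

lemma leaving_Aut:
  assumes X: "is_graph X" and fg: "(f, g) \<in> carrier (Aut X)" and U: "U \<subseteq> verts X"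
  shows "leaving X (f ` U) = g ` leaving X U"
proof -
  have f: "f v \<in> f ` U \<longleftrightarrow> v \<in> U" if "v \<in> verts X" for v
    using AutD(1)[OF fg] U that by (auto simp: bij_betw_def inj_on_def)
  have "g d \<in> leaving X (f ` U) \<longleftrightarrow> d \<in> leaving X U" if "d \<in> darts X" for d
    using that f tail_in_verts[OF X that] head_in_verts[OF X that] AutD(2,3)[OF fg] Aut_head[OF X fg]
    by (auto simp: leaving_def bij_betw_def)
  moreover have "leaving X (f ` U) \<subseteq> g ` darts X"
    using AutD(2)[OF fg] by (auto simp: bij_betw_def leaving_def)
  moreover have "leaving X U \<subseteq> darts X" by (auto simp: leaving_def)
  ultimately show ?thesis by blast
qed

text \<open>
  A closed path that leaves \<open>U\<close> has to return, and it can only do so by reversing the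
  unique leaving dart: the edges which are the only connection of some vertex set to its complement
  form an invariant forest.
\<close>

lemma no_single_leaving_dart:
  assumes X: "is_graph X" "finite_graph X" and no_forest: "\<not> has_invariant_forest X"
    and U: "U \<subseteq> verts X"
  shows "card (leaving X U) \<noteq> 1"
proof
  assume "card (leaving X U) = 1"
  then obtain d0 where d0: "leaving X U = {d0}" by (auto simp: card_1_singleton_iff)
  let ?D = "{d. \<exists>U\<subseteq>verts X. leaving X U = {d}}"
  have "has_invariant_forest X"
  proof (rule has_invariant_forestI[OF X, of ?D])
    show "?D \<subseteq> darts X" by (auto simp: leaving_def)
    show "?D \<noteq> {}" using d0 U by blast
    show "opp X d \<in> ?D" if d: "d \<in> ?D" for d
    proof -
      obtain U where "U \<subseteq> verts X" "leaving X U = {d}" using d by blast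
      then have "leaving X (verts X - U) = {opp X d}" using leaving_complement[OF X(1)] by simp
      then show ?thesis by blast
    qed
    show "g d \<in> ?D" if fg: "(f, g) \<in> carrier (Aut X)" and d: "d \<in> ?D" for f g d
    proof -
      obtain U where U: "U \<subseteq> verts X" "leaving X U = {d}" using d by blast
      then have "leaving X (f ` U) = {g d}" using leaving_Aut[OF X(1) fg U(1)] by simp
      moreover have "f ` U \<subseteq> verts X" using AutD(1)[OF fg] U(1) by (auto simp: bij_betw_def)
      ultimately show ?thesis by blast
    qed
    show False if cyc: "is_cycle X ds" and sub: "set ds \<subseteq> ?D" for ds
    proof -
      let ?L = "length ds"
      have ne: "ds \<noteq> []" and dist: "distinct (map (tail X) ds)" and inX: "set ds \<subseteq> darts X"
        and nxt: "\<And>i. i < ?L \<Longrightarrow> head X (ds ! i) = tail X (ds ! (Suc i mod ?L))"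
        and nrev: "\<And>i. i < ?L \<Longrightarrow> ds ! (Suc i mod ?L) \<noteq> opp X (ds ! i)"
        using cyc by (auto simp: is_cycle_def Let_def)
      have L: "?L > 0" using ne by simp
      have "ds ! 0 \<in> ?D" using sub L nth_mem by blast
      then obtain U where U: "leaving X U = {ds ! 0}" by blast
      have out: "tail X (ds ! 0) \<in> U" "head X (ds ! 0) \<notin> U" using U by (auto simp: leaving_def)
      \<comment> \<open>The cycle leaves \<open>U\<close> through its first dart and stays outside
        for ever; after a full turn this contradicts the position of its starting point.\<close>
      have "tail X (ds ! (Suc k mod ?L)) \<notin> U" for k
      proof (induction k)
        case 0
        then show ?case using out(2) nxt[OF L] by simp
      next
        case (Suc k)
        let ?e = "ds ! (Suc k mod ?L)"
        have lt: "Suc k mod ?L < ?L" using L by simp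
        have e: "?e \<in> darts X" using inX nth_mem[OF lt] by blast
        have tl: "head X ?e = tail X (ds ! (Suc (Suc k) mod ?L))"
          using nxt[OF lt] by (simp add: mod_Suc_eq)
        show ?case
        proof
          assume in_U: "tail X (ds ! (Suc (Suc k) mod ?L)) \<in> U"
          then have "opp X ?e \<in> leaving X U"
            using Suc e tl X(1)
            by (auto simp: leaving_def head_opp opp_in_darts) (simp add: head_def)
          then have eq: "opp X ?e = ds ! 0" using U by simp
          then have "tail X (ds ! (Suc (Suc k) mod ?L)) = tail X (ds ! 0)"
            using tl by (simp add: head_def)
          \<comment> \<open>The tails on a cycle are distinct, so the next dart is the first one,
            which is the reverse of \<open>?e\<close>.\<close>
          then have "Suc (Suc k) mod ?L = 0"
            using dist L by (auto simp: distinct_conv_nth)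
              (metis L distinct_conv_nth dist length_map mod_less_divisor nth_map)
          then show False using nrev[OF lt] eq by (simp add: mod_Suc_eq)
        qed
      qed
      from this[of "?L - 1"] show False using out(1) L by simp
    qed
  qed
  then show False using no_forest by simp
qed

text \<open>
  If two of the three darts at a vertex are parallel, the third edge lies in an invariant forest:
  the edges of this kind are pendant in the subgraph which they span.
\<close>

lemma no_trivalent_digon:
  assumes adm: "admissible X" and dX: "d \<in> darts X"
    and star: "{x \<in> darts X. tail X x = tail X d} = {d, d1, d2}" "distinct [d, d1, d2]"
    and par: "head X d1 = head X d2" "head X d1 \<noteq> tail X d"
  shows "head X d = head X d1"
proof (rule ccontr)
  assume third: "head X d \<noteq> head X d1"
  have X: "is_graph X" "finite_graph X" using adm by (auto simp: admissible_def)
  define Q where "Q d d1 d2 \<longleftrightarrow> {x \<in> darts X. tail X x = tail X d} = {d, d1, d2} \<and> distinct [d, d1, d2] \<and>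
    head X d1 = head X d2 \<and> head X d1 \<noteq> tail X d \<and> head X d \<noteq> head X d1" for d d1 d2
  define P where "P d \<longleftrightarrow> (\<exists>d1 d2. Q d d1 d2)" for d
  have PX: "d \<in> darts X" if "P d" for d
    using that unfolding P_def Q_def by blast
  let ?D = "{d \<in> darts X. P d \<or> P (opp X d)}"
  \<comment> \<open>A parallel dart does not lie on an edge of \<open>?D\<close>: otherwise, at one
    of its ends, the third dart would have the same head as the two parallel ones, which
    \<open>Q\<close> forbids.\<close>
  have no1: False if Q: "Q d d1 d2" and "P d1 \<or> P (opp X d1)" for d d1 d2
    using that(2)
  proof
    assume "P d1"
    then obtain e1 e2 where e: "Q d1 e1 e2" by (auto simp: P_def)
    have t: "tail X d1 = tail X d" using Q by (auto simp: Q_def)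
    have "{d, d1, d2} = {d1, e1, e2}" using Q e t by (auto simp: Q_def)
    then have "d \<in> {e1, e2}" "d2 \<in> {e1, e2}" using Q by (auto simp: Q_def)
    then have "head X d = head X d2" using e by (auto simp: Q_def)
    then show False using Q by (auto simp: Q_def)
  next
    assume "P (opp X d1)"
    then obtain e1 e2 where e: "Q (opp X d1) e1 e2" by (auto simp: P_def)
    have d12: "d1 \<in> darts X" "d2 \<in> darts X" "tail X d1 = tail X d" "tail X d2 = tail X d"
      using Q by (auto simp: Q_def)
    have "tail X (opp X d2) = tail X (opp X d1)" using Q by (simp add: Q_def head_def)
    moreover have "d1 \<noteq> d2" using Q by (auto simp: Q_def)
    then have "opp X d2 \<noteq> opp X d1"
      using opp_opp[OF X(1) d12(1)] opp_opp[OF X(1) d12(2)] by metis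
    ultimately have "opp X d2 \<in> {e1, e2}"
      using e d12 opp_in_darts[OF X(1)] unfolding Q_def by blast
    then have "head X (opp X d2) = head X e1" using e by (auto simp: Q_def)
    then have "head X e1 = head X (opp X d1)" using d12 X by (simp add: head_opp)
    then show False using e by (simp add: Q_def)
  qed
  have sym: "Q d d2 d1" if "Q d d1 d2" for d d1 d2
    using that by (auto simp: Q_def insert_commute)
  \<comment> \<open>Hence the tail of a dart satisfying \<open>P\<close> is a leaf of the subgraph,
    and a cycle through it would have to reverse.\<close>
  have uniq: "x = d" if Pd: "P d" and x: "x \<in> ?D" "tail X x = tail X d" for x d
  proof -
    obtain d1 d2 where Q: "Q d d1 d2" using Pd by (auto simp: P_def)
    then have "x \<in> {d, d1, d2}" using x unfolding Q_def by blast
    then show ?thesis using no1[OF Q] no1[OF sym[OF Q]] x(1) by auto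
  qed
  have Dopp: "opp X x \<in> ?D" if "x \<in> ?D" for x
    using that X(1) by (auto simp: opp_opp opp_in_darts)
  have "has_invariant_forest X"
  proof (rule has_invariant_forestI[OF X, of ?D])
    show "?D \<noteq> {}" using dX star par third by (auto simp: P_def Q_def)
    show "g x \<in> ?D" if fg: "(f, g) \<in> carrier (Aut X)" and x: "x \<in> ?D" for f g x
    proof -
      have inj: "inj_on g (darts X)" "g ` darts X = darts X" "inj_on f (verts X)"
        using AutD[OF fg] by (auto simp: bij_betw_def)
      have Pg: "P (g d)" if Pd: "P d" for d
      proof -
        obtain d1 d2 where Q: "Q d d1 d2" using Pd by (auto simp: P_def)
        have d: "d \<in> darts X" "d1 \<in> darts X" "d2 \<in> darts X" using Q unfolding Q_def by blast+
        have "{x \<in> darts X. tail X x = tail X (g d)} = g ` {x \<in> darts X. tail X x = tail X d}"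
        proof -
          have "tail X (g x) = tail X (g d) \<longleftrightarrow> tail X x = tail X d" if "x \<in> darts X" for x
            using that d AutD(3)[OF fg] inj(3) tail_in_verts[OF X(1)] by (auto simp: inj_on_def)
          then have "g ` {x \<in> darts X. tail X x = tail X d} = {x \<in> g ` darts X. tail X x = tail X (g d)}"
            by auto
          then show ?thesis using inj(2) by simp
        qed
        also have "\<dots> = {g d, g d1, g d2}" using Q by (simp add: Q_def)
        finally have "Q (g d) (g d1) (g d2)"
          using Q d inj(1,3) tail_in_verts[OF X(1)] head_in_verts[OF X(1)]
          by (auto simp: Q_def Aut_head[OF X(1) fg] AutD(3)[OF fg] inj_on_def)
        then show ?thesis by (auto simp: P_def)
      qed
      have "g x \<in> darts X" "opp X (g x) = g (opp X x)" using x inj(2) AutD(4)[OF fg] by auto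
      then show ?thesis using x Pg by auto
    qed
    show False if cyc: "is_cycle X ds" and sub: "set ds \<subseteq> ?D" for ds
    proof -
      let ?L = "length ds"
      have ne: "ds \<noteq> []"
        and nxt: "\<And>i. i < ?L \<Longrightarrow> head X (ds ! i) = tail X (ds ! (Suc i mod ?L))"
        and nrev: "\<And>i. i < ?L \<Longrightarrow> ds ! (Suc i mod ?L) \<noteq> opp X (ds ! i)"
        using cyc by (auto simp: is_cycle_def Let_def)
      have L: "?L > 0" "?L - 1 < ?L" "Suc (?L - 1) mod ?L = 0" using ne by auto
      have mem: "ds ! i \<in> ?D" if "i < ?L" for i using sub nth_mem[OF that] by blast
      consider "P (ds ! 0)" | "P (opp X (ds ! 0))" using mem[OF L(1)] by blast
      then show False
      proof cases
        case 1
        have "opp X (ds ! (?L - 1)) = ds ! 0"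
          using uniq[OF 1 Dopp[OF mem[OF L(2)]]] nxt[OF L(2)] L(3) by (simp add: head_def)
        then show False using nrev[OF L(2)] L(3) by simp
      next
        case 2
        have lt: "Suc 0 mod ?L < ?L" using L(1) by (rule mod_less_divisor)
        have "ds ! (Suc 0 mod ?L) = opp X (ds ! 0)"
          using nxt[OF L(1)] by (intro uniq[OF 2 mem[OF lt]]) (simp only: head_def)
        then show False using nrev[OF L(1)] by simp
      qed
    qed
  qed (use Dopp in auto)
  then show False using adm by (simp add: admissible_def)
qed

section \<open>Actions all of whose orbits are trivial or standard\<close>

text \<open>A coset representative for the stabilizer of the base label \<open>b\<close>.\<close>

definition shift :: "'a set \<Rightarrow> 'a \<Rightarrow> 'a \<Rightarrow> 'a \<Rightarrow> 'a" where
  "shift S b i = (SOME p. p \<in> alternating S \<and> p b = i)"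

lemma exists_fixing_moving:
  assumes "finite S" "card S \<ge> 4" "i \<in> S" "j \<in> S" "i \<noteq> j"
  obtains p where "p \<in> alternating S" "p i = i" "p j \<noteq> j"
proof -
  have "card (S - {i, j}) \<ge> 2" using assms by (simp add: card_Diff_subset)
  then obtain k l where "k \<in> S - {i, j}" "l \<in> S - {i, j}" "k \<noteq> l"
    by (metis card_le_Suc0_iff_eq card.infinite not_less_eq_eq numeral_2_eq_2 zero_le)
  then have "three_cycle j k l \<in> alternating S" "three_cycle j k l i = i" "three_cycle j k l j \<noteq> j"
    using assms by (auto intro!: three_cycle_alternating simp: three_cycle_apply)
  then show ?thesis by (rule that)
qed

lemma exists_carrying:
  assumes "finite S" "card S \<ge> 3" "i \<in> S" "j \<in> S"
  obtains p where "p \<in> alternating S" "p i = j"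
proof (cases "i = j")
  case True
  then show ?thesis using that[of id] alternating_id by auto
next
  case False
  have "card (S - {i, j}) \<ge> 1" using assms False by (simp add: card_Diff_subset)
  then have "S - {i, j} \<noteq> {}" by force
  then obtain k where "k \<in> S - {i, j}" by blast
  then have "three_cycle i j k \<in> alternating S" "three_cycle i j k i = j"
    using assms False by (auto intro!: three_cycle_alternating simp: three_cycle_apply)
  then show ?thesis by (rule that)
qed

lemma shift:
  assumes "finite S" "card S \<ge> 3" "b \<in> S" "i \<in> S"
  shows "shift S b i \<in> alternating S" "shift S b i b = i"
proof -
  have "\<exists>p. p \<in> alternating S \<and> p b = i" using exists_carrying[OF assms] by metis
  from someI_ex[OF this] show "shift S b i \<in> alternating S" "shift S b i b = i"
    unfolding shift_def by auto
qed

text \<open>Every orbit is a point or a copy of \<open>S\<close>. Four labels are what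
  \<open>exists_fixing_moving\<close> asks for, so that the stabilizers of different labels are not
  contained in each other.\<close>

locale labelled_action = alternating_action +
  fixes b :: 'a
  assumes card_points: "card S \<ge> 4" and base: "b \<in> S"
    and labelled: "\<And>x. x \<in> \<Omega> \<Longrightarrow>
      stab x = alternating S \<or> (\<exists>i\<in>S. stab x = {p \<in> alternating S. p i = i})"
begin

definition fixed :: "'b set" where
  "fixed = {x \<in> \<Omega>. stab x = alternating S}"

definition slice :: "'a \<Rightarrow> 'b set" where
  "slice i = {x \<in> \<Omega>. stab x = {p \<in> alternating S. p i = i}}"

definition mv :: "'a \<Rightarrow> 'b \<Rightarrow> 'b" where
  "mv i x = act (shift S b i) x"

lemma shiftS: "i \<in> S \<Longrightarrow> shift S b i \<in> alternating S" "i \<in> S \<Longrightarrow> shift S b i b = i"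
  using shift[OF finite_points _ base] card_points by auto

lemma in_fixed_iff: "x \<in> fixed \<longleftrightarrow> x \<in> \<Omega> \<and> (\<forall>p\<in>alternating S. act p x = x)"
  by (auto simp: fixed_def stab_def)

lemma in_slice_iff: "x \<in> slice i \<longleftrightarrow> x \<in> \<Omega> \<and> (\<forall>p\<in>alternating S. act p x = x \<longleftrightarrow> p i = i)"
  by (auto simp: slice_def stab_def)

lemma slice_fixed_disjoint: "i \<in> S \<Longrightarrow> x \<in> slice i \<Longrightarrow> x \<notin> fixed"
proof
  assume i: "i \<in> S" and x: "x \<in> slice i" "x \<in> fixed"
  have "card (S - {i}) \<noteq> 0" using card_points i by simp
  then have "S - {i} \<noteq> {}" by (metis card.empty)
  then obtain j where "j \<in> S" "j \<noteq> i" by blast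
  then obtain p where "p \<in> alternating S" "p i \<noteq> i"
    using exists_fixing_moving[OF finite_points card_points, of j i] i by metis
  then show False using x by (auto simp: in_fixed_iff in_slice_iff)
qed

lemma stab_fixes_point:
  assumes "i \<in> S" "j \<in> S" "\<And>p. p \<in> alternating S \<Longrightarrow> p i = i \<Longrightarrow> p j = j"
  shows "i = j"
  using exists_fixing_moving[OF finite_points card_points assms(1,2)] assms(3) by metis

lemma slice_unique: "i \<in> S \<Longrightarrow> j \<in> S \<Longrightarrow> x \<in> slice i \<Longrightarrow> x \<in> slice j \<Longrightarrow> i = j"
  by (rule stab_fixes_point) (auto simp: in_slice_iff)

lemma in_fixed_or_slice: "x \<in> \<Omega> \<Longrightarrow> x \<in> fixed \<or> (\<exists>i\<in>S. x \<in> slice i)"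
  using labelled by (auto simp: fixed_def slice_def)

lemma act_slice:
  assumes "p \<in> alternating S" "i \<in> S" "x \<in> slice i"
  shows "act p x \<in> slice (p i)"
proof -
  have x: "x \<in> \<Omega>" using assms by (simp add: in_slice_iff)
  have "act q (act p x) = act p x \<longleftrightarrow> q (p i) = p i" if q: "q \<in> alternating S" for q
  proof -
    have "act q (act p x) = act p x \<longleftrightarrow> act (q \<circ> p) x = act p x"
      using assms q x by (simp add: act_comp)
    also have "\<dots> \<longleftrightarrow> inv' p \<circ> (q \<circ> p) \<in> stab x"
      using assms q x by (intro act_eq_iff comp_alternating)
    also have "\<dots> \<longleftrightarrow> (inv' p \<circ> (q \<circ> p)) i = i"
      using assms q by (simp add: slice_def comp_alternating inv_alternating)
    also have "\<dots> \<longleftrightarrow> q (p i) = p i"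
      using bij_inv_eq_iff[OF bij_alternating[OF assms(1)], of i "q (p i)"] by auto
    finally show ?thesis .
  qed
  then show ?thesis using act_closed assms x by (auto simp: in_slice_iff)
qed

lemma act_fixed: "p \<in> alternating S \<Longrightarrow> x \<in> fixed \<Longrightarrow> act p x = x"
  by (simp add: in_fixed_iff)

lemma act_base:
  assumes "p \<in> alternating S" "p b = b" "x \<in> fixed \<union> slice b"
  shows "act p x = x"
  using assms by (auto simp: in_fixed_iff in_slice_iff)

lemma subset_\<Omega>: "fixed \<subseteq> \<Omega>" "slice i \<subseteq> \<Omega>"
  by (auto simp: fixed_def slice_def)

text \<open>The element \<open>p\<close> followed by the inverse of one shift and preceded by the
  other fixes \<open>b\<close>, hence acts trivially on \<open>fixed \<union> slice b\<close>. The
  same argument makes the arbitrary choice in \<open>shift\<close> harmless.\<close>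

lemma act_mv:
  assumes "p \<in> alternating S" "i \<in> S" "x \<in> fixed \<union> slice b"
  shows "act p (mv i x) = mv (p i) x"
proof -
  have pi: "p i \<in> S" using assms by (auto simp: alternating_def permutes_in_image)
  have x: "x \<in> \<Omega>" using assms subset_\<Omega> by blast
  let ?q = "inv' (shift S b (p i)) \<circ> (p \<circ> shift S b i)"
  have "?q b = b"
    using bij_inv_eq_iff[OF bij_alternating[OF shiftS(1)[OF pi]], of b "p i"] shiftS(2) pi assms(2)
    by simp
  moreover have q: "?q \<in> alternating S"
    using assms pi by (intro comp_alternating inv_alternating shiftS)
  ultimately have "?q \<in> stab x" using act_base assms by (simp add: stab_def)
  then have "act (p \<circ> shift S b i) x = act (shift S b (p i)) x"
    using act_eq_iff[OF comp_alternating[OF assms(1) shiftS(1)[OF assms(2)]] shiftS(1)[OF pi] x]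
    by blast
  then show ?thesis using assms x shiftS by (simp add: mv_def act_comp)
qed

lemma mv_fixed: "i \<in> S \<Longrightarrow> x \<in> fixed \<Longrightarrow> mv i x = x"
  by (simp add: mv_def act_fixed shiftS)

lemma mv_slice: "i \<in> S \<Longrightarrow> x \<in> slice b \<Longrightarrow> mv i x \<in> slice i"
  unfolding mv_def using act_slice[OF shiftS(1) base] shiftS(2) by metis

lemma mv_inj: "i \<in> S \<Longrightarrow> x \<in> \<Omega> \<Longrightarrow> y \<in> \<Omega> \<Longrightarrow> mv i x = mv i y \<Longrightarrow> x = y"
  unfolding mv_def using act_inj shiftS by blast

lemma mv_eq_iff:
  assumes "i \<in> S" "j \<in> S" "x \<in> slice b" "y \<in> slice b"
  shows "mv i x = mv j y \<longleftrightarrow> i = j \<and> x = y"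
  using slice_unique[OF assms(1,2)] mv_slice assms mv_inj subset_\<Omega> by (metis subsetD)

lemma in_slice_mv:
  assumes "i \<in> S" "x \<in> slice i"
  shows "\<exists>y\<in>slice b. x = mv i y"
proof
  let ?p = "inv' (shift S b i)"
  have x: "x \<in> \<Omega>" using assms subset_\<Omega> by blast
  show "x = mv i (act ?p x)"
    unfolding mv_def using act_inv(2)[OF shiftS(1)] assms(1) x by simp
  have "?p i = b"
    using bij_alternating[OF shiftS(1)[OF assms(1)]] shiftS(2)[OF assms(1)]
    by (metis bij_inv_eq_iff)
  then show "act ?p x \<in> slice b"
    using act_slice[OF inv_alternating[OF shiftS(1)] assms(1)] assms by metis
qed

text \<open>Reduces the moved part to one slice: its points become pairs of a label and a point of
  \<open>slice b\<close>, and by \<open>act_mv\<close> the group acts on the label only.\<close>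

lemma bij_betw_mv: "bij_betw (\<lambda>(i, x). mv i x) (S \<times> slice b) (\<Omega> - fixed)"
  unfolding bij_betw_def
proof
  show "inj_on (\<lambda>(i, x). mv i x) (S \<times> slice b)"
    by (auto simp: inj_on_def mv_eq_iff)
  have "mv i x \<in> \<Omega> - fixed" if "i \<in> S" "x \<in> slice b" for i x
    using mv_slice[OF that] slice_fixed_disjoint[OF that(1)] subset_\<Omega> by blast
  moreover have "\<exists>i\<in>S. \<exists>y\<in>slice b. x = mv i y" if "x \<in> \<Omega> - fixed" for x
    using in_fixed_or_slice that in_slice_mv by blast
  ultimately show "(\<lambda>(i, x). mv i x) ` (S \<times> slice b) = \<Omega> - fixed" by force
qed

lemma card_moved: "card (\<Omega> - fixed) = card S * card (slice b)"
  using bij_betw_same_card[OF bij_betw_mv] by (simp add: card_cartesian_product)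

end

section \<open>Actions on graphs\<close>

text \<open>
  Otherwise the simplifier turns \<open>{1..n}\<close> into \<open>{Suc 0..n}\<close> inside the constants of the
  interpreted locales, whose defining equations then no longer apply.
\<close>

declare One_nat_def [simp del]

lemma carrier_alt_group: "carrier (alt_group n) = alternating {1..n}"
  by (auto simp: alt_group_carrier alternating_def)

lemma Aut_mult:
  assumes "x \<in> carrier (Aut X)" "y \<in> carrier (Aut X)"
  shows "v \<in> verts X \<Longrightarrow> fst (x \<otimes>\<^bsub>Aut X\<^esub> y) v = fst x (fst y v)"
    "d \<in> darts X \<Longrightarrow> snd (x \<otimes>\<^bsub>Aut X\<^esub> y) d = snd x (snd y d)"
  using assms by (cases x; cases y; auto simp: Aut_def BijGroup_def mult_DirProd' compose_def)+

locale graph_action =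
  fixes n :: nat and X :: "('v, 'd) graph" and \<rho> :: "(nat \<Rightarrow> nat, 'v, 'd) action"
  assumes graph: "is_graph X" and action: "acts_on (alt_group n) \<rho> X"
begin

abbreviation va :: "(nat \<Rightarrow> nat) \<Rightarrow> 'v \<Rightarrow> 'v" where "va p \<equiv> fst (\<rho> p)"
abbreviation da :: "(nat \<Rightarrow> nat) \<Rightarrow> 'd \<Rightarrow> 'd" where "da p \<equiv> snd (\<rho> p)"

lemma rho_Aut: "p \<in> alternating {1..n} \<Longrightarrow> (va p, da p) \<in> carrier (Aut X)"
  using action by (auto simp: acts_on_def hom_def carrier_alt_group)

lemma bij_va: "p \<in> alternating {1..n} \<Longrightarrow> bij_betw (va p) (verts X) (verts X)"
  and bij_da: "p \<in> alternating {1..n} \<Longrightarrow> bij_betw (da p) (darts X) (darts X)"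
  and tail_da: "p \<in> alternating {1..n} \<Longrightarrow> d \<in> darts X \<Longrightarrow> tail X (da p d) = va p (tail X d)"
  and opp_da: "p \<in> alternating {1..n} \<Longrightarrow> d \<in> darts X \<Longrightarrow> opp X (da p d) = da p (opp X d)"
  using AutD[OF rho_Aut] by auto

lemma rho_comp:
  assumes "p \<in> alternating {1..n}" "q \<in> alternating {1..n}"
  shows "v \<in> verts X \<Longrightarrow> va (p \<circ> q) v = va p (va q v)"
    "d \<in> darts X \<Longrightarrow> da (p \<circ> q) d = da p (da q d)"
proof -
  have "\<rho> (p \<circ> q) = \<rho> p \<otimes>\<^bsub>Aut X\<^esub> \<rho> q"
    using action assms by (auto simp: acts_on_def hom_def carrier_alt_group alt_group_mult)
  then show "v \<in> verts X \<Longrightarrow> va (p \<circ> q) v = va p (va q v)"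
    "d \<in> darts X \<Longrightarrow> da (p \<circ> q) d = da p (da q d)"
    using Aut_mult rho_Aut assms by (metis prod.collapse)+
qed

lemma da_in: "p \<in> alternating {1..n} \<Longrightarrow> d \<in> darts X \<Longrightarrow> da p d \<in> darts X"
  using bij_da by (auto simp: bij_betw_def)

lemma va_in: "p \<in> alternating {1..n} \<Longrightarrow> v \<in> verts X \<Longrightarrow> va p v \<in> verts X"
  using bij_va by (auto simp: bij_betw_def)

text \<open>The identity acts as an idempotent bijection.\<close>

lemma rho_id:
  shows "v \<in> verts X \<Longrightarrow> va id v = v" "d \<in> darts X \<Longrightarrow> da id d = d"
proof -
  note i = alternating_id[of "{1..n}"]
  show "va id v = v" if "v \<in> verts X"
    using rho_comp(1)[OF i i that] bij_va[OF i] va_in[OF i that] that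
    by (auto simp: bij_betw_def inj_on_def)
  show "da id d = d" if "d \<in> darts X"
    using rho_comp(2)[OF i i that] bij_da[OF i] da_in[OF i that] that
    by (auto simp: bij_betw_def inj_on_def)
qed

sublocale V: alternating_action "{1..n}" "verts X" va
  by unfold_locales (auto simp: va_in rho_id(1) rho_comp(1))

sublocale D: alternating_action "{1..n}" "darts X" da
  by unfold_locales (auto simp: da_in rho_id(2) rho_comp(2))

lemma da_edge: "p \<in> alternating {1..n} \<Longrightarrow> d \<in> darts X \<Longrightarrow> da p ` edge X d = edge X (da p d)"
  by (simp add: edge_def opp_da)

text \<open>Orbits are to be counted on unoriented edges, as in \<open>edge_orbit\<close>; an edge
  is the set of its two darts.\<close>

sublocale E: alternating_action "{1..n}" "edge X ` darts X" "\<lambda>p. image (da p)"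
proof
  fix p q x assume x: "x \<in> edge X ` darts X"
  then obtain d where d: "d \<in> darts X" "x = edge X d" by blast
  show "da id ` x = x"
    using d alternating_id[of "{1..n}"] by (simp add: da_edge rho_id(2))
  assume p: "p \<in> alternating {1..n}"
  then show "da p ` x \<in> edge X ` darts X" using d by (simp add: da_edge da_in)
  assume q: "q \<in> alternating {1..n}"
  show "da (p \<circ> q) ` x = da p ` da q ` x"
    using d p q D.comp_alternating[OF p q] by (simp only: da_edge da_in rho_comp(2))
qed simp

lemma stab_dart_subset_stab_edge:
  assumes "d \<in> darts X"
  shows "D.stab d \<subseteq> E.stab (edge X d)"
proof
  fix p assume p: "p \<in> D.stab d"
  then have "da p ` edge X d = edge X d" using assms by (simp add: D.stab_def da_edge)
  then show "p \<in> E.stab (edge X d)" using p by (simp add: D.stab_def E.stab_def)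
qed

lemma stab_dart_subset_stab_tail: "d \<in> darts X \<Longrightarrow> D.stab d \<subseteq> V.stab (tail X d)"
  by (auto simp: D.stab_def V.stab_def) (metis tail_da)

lemma stab_opp: "d \<in> darts X \<Longrightarrow> D.stab (opp X d) = D.stab d"
proof -
  assume d: "d \<in> darts X"
  have "da p (opp X d) = opp X d \<longleftrightarrow> da p d = d" if "p \<in> alternating {1..n}" for p
    by (metis d that da_in opp_da opp_opp[OF graph])
  then show ?thesis by (auto simp: D.stab_def)
qed

text \<open>An element of order 3 cannot reverse an edge.\<close>

lemma alternating_fixes_dart:
  assumes d: "d \<in> darts X" and B: "B \<subseteq> {1..n}" "alternating B \<subseteq> E.stab (edge X d)"
  shows "alternating B \<subseteq> D.stab d"
proof -
  interpret alternating_subgroup "{1..n}" "D.stab d" by (rule D.stab_subgroup[OF d])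
  have "three_full (D.stab d) B"
    unfolding three_full_def
  proof (intro ballI impI)
    fix i j k assume ijk: "i \<in> B" "j \<in> B" "k \<in> B" "distinct [i, j, k]"
    let ?t = "three_cycle i j k"
    have "?t \<in> alternating B" using ijk three_cycle_alternating by metis
    then have t: "?t \<in> alternating {1..n}" "da ?t ` edge X d = edge X d"
      using B alternating_mono[OF B(1)] by (auto simp: E.stab_def)
    have t3: "?t \<circ> (?t \<circ> ?t) = id"
      using ijk(4) by (auto simp: fun_eq_iff three_cycle_def transpose_def)
    have "da ?t d = d"
    proof (rule ccontr)
      assume "da ?t d \<noteq> d"
      then have 1: "da ?t d = opp X d" using t(2) by (auto simp: edge_def)
      then have 2: "da ?t (opp X d) = d" using opp_da[OF t(1) d] opp_opp[OF graph d] by simp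
      have "da (?t \<circ> (?t \<circ> ?t)) d = opp X d"
        using t(1) d 1 2 by (simp add: rho_comp D.comp_alternating opp_in_darts[OF graph])
      then show False using t3 rho_id(2)[OF d] opp_neq[OF graph d] by simp
    qed
    then show "?t \<in> D.stab d" using t by (simp add: D.stab_def)
  qed
  then show ?thesis using three_full_alternating B(1) by blast
qed

lemma alternating_fixing_point: "{p \<in> alternating S. p i = i} = alternating (S - {i})"
  unfolding alternating_def by (auto simp: permutes_def)

text \<open>A point stabilizer is again an alternating group, hence generated by 3-cycles, and these
  reverse no edge. So a dart carries the same label as its edge.\<close>

lemma stab_edge:
  assumes d: "d \<in> darts X" and e: "E.stab (edge X d) = alternating {1..n} \<or>
    (\<exists>i\<in>{1..n}. E.stab (edge X d) = {p \<in> alternating {1..n}. p i = i})"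
  shows "D.stab d = E.stab (edge X d)"
proof -
  obtain B where "B \<subseteq> {1..n}" "E.stab (edge X d) = alternating B"
    using e unfolding alternating_fixing_point by blast
  then show ?thesis
    using alternating_fixes_dart[OF d] stab_dart_subset_stab_edge[OF d] by blast
qed

text \<open>Translates the condition in \<open>moved_subgraph\<close>, which speaks of unoriented
  edges, into stabilizers of darts.\<close>

lemma card_edge_orbit_gt_1_iff:
  assumes d: "d \<in> darts X"
  shows "card (edge_orbit (alt_group n) \<rho> X d) > 1 \<longleftrightarrow> D.stab d \<noteq> alternating {1..n}"
proof -
  have orb: "edge_orbit (alt_group n) \<rho> X d = E.orb (edge X d)"
    by (simp add: edge_orbit_def E.orb_def carrier_alt_group)
  have e: "edge X d \<in> E.orb (edge X d)" using d by (intro E.orb_refl) auto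
  have "card (E.orb (edge X d)) > 1 \<longleftrightarrow> \<not> card (E.orb (edge X d)) \<le> Suc 0" by auto
  also have "\<dots> \<longleftrightarrow> \<not> (\<forall>y\<in>E.orb (edge X d). y = edge X d)"
    using e unfolding card_le_Suc0_iff_eq[OF E.finite_orb] by blast
  also have "\<dots> \<longleftrightarrow> E.stab (edge X d) \<noteq> alternating {1..n}"
    by (auto simp: E.orb_def E.stab_def)
  also have "\<dots> \<longleftrightarrow> D.stab d \<noteq> alternating {1..n}"
  proof -
    have "E.stab (edge X d) \<subseteq> alternating {1..n}" unfolding E.stab_def by blast
    then have "E.stab (edge X d) = alternating {1..n}" if "D.stab d = alternating {1..n}"
      using stab_dart_subset_stab_edge[OF d] that by (intro subset_antisym) auto
    moreover have "D.stab d = alternating {1..n}" if "E.stab (edge X d) = alternating {1..n}"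
      using stab_edge[OF d] that by simp
    ultimately show ?thesis by blast
  qed
  finally show ?thesis by (simp add: orb)
qed

end

section \<open>Valences and cuts\<close>

lemma handshake:
  assumes "is_graph X" "finite_graph X" "T \<subseteq> verts X"
  shows "(\<Sum>v\<in>T. valence X v) = card {d \<in> darts X. tail X d \<in> T}"
proof -
  have "{d \<in> darts X. tail X d \<in> T} = (\<Union>v\<in>T. {d \<in> darts X. tail X d = v})" by auto
  moreover have "card \<dots> = (\<Sum>v\<in>T. card {d \<in> darts X. tail X d = v})"
    using assms by (intro card_UN_disjoint) (auto simp: finite_graph_def intro: finite_subset)
  ultimately show ?thesis by (simp add: valence_def)
qed

lemma connected_leaving:
  assumes X: "is_graph X" "connected_graph X" and U: "U \<subseteq> verts X" "U \<noteq> {}" "U \<noteq> verts X"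
  shows "leaving X U \<noteq> {}"
proof
  assume none: "leaving X U = {}"
  obtain u v where uv: "u \<in> U" "v \<in> verts X" "v \<notin> U" using U by blast
  then have "(u, v) \<in> {(tail X d, head X d) |d. d \<in> darts X}\<^sup>*"
    using X(2) U(1) by (auto simp: connected_graph_def)
  then have "v \<in> U" using uv(1)
    by (induction rule: rtrancl_induct) (use none in \<open>auto simp: leaving_def\<close>)
  then show False using uv by simp
qed

lemma finite_leaving: "finite_graph X \<Longrightarrow> finite (leaving X U)"
  by (simp add: leaving_def finite_graph_def)

text \<open>Connectedness forbids an empty cut, the absence of invariant forests a cut with one
  dart.\<close>

lemma admissible_leaving_ge_2:
  assumes adm: "admissible X" and U: "U \<subseteq> verts X" "U \<noteq> {}" "U \<noteq> verts X"
  shows "card (leaving X U) \<ge> 2"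
proof -
  have "card (leaving X U) \<noteq> 0"
    using connected_leaving[of X U] finite_leaving[of X U] adm U by (auto simp: admissible_def)
  then show ?thesis 
    using no_single_leaving_dart[of X U] adm U(1) unfolding admissible_def by linarith
qed

context labelled_action
begin

lemma card_orb_le:
  assumes "x \<in> \<Omega>"
  shows "card (orb x) \<le> card S"
proof -
  obtain y i where y: "i \<in> S" "x = mv i y" "y \<in> fixed \<union> slice b"
    using in_fixed_or_slice[OF assms] in_slice_mv mv_fixed base by (metis UnCI)
  have "orb x \<subseteq> (\<lambda>j. mv j y) ` S"
    using y by (auto simp: orb_def act_mv alternating_def permutes_in_image)
  then show ?thesis using finite_points surj_card_le by blast
qed

end

section \<open>Graphs of small genus\<close>

locale small_graph = graph_action n X \<rho>
  for n :: nat and X :: "('v, 'd) graph" and \<rho> :: "(nat \<Rightarrow> nat, 'v, 'd) action" +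
  assumes adm: "admissible X" and faithful: "inj_on \<rho> (alternating {1..n})"
    and n: "n > 8" and genus: "genus X \<le> 2 * n"
begin

lemma finite_X: "finite_graph X" "finite (verts X)" "finite (darts X)"
  using adm by (auto simp: admissible_def finite_graph_def)

lemma connected: "connected_graph X"
  using adm by (simp add: admissible_def)

lemma exists_moved: "\<exists>p\<in>alternating {1..n}. (\<exists>v\<in>verts X. va p v \<noteq> v) \<or> (\<exists>d\<in>darts X. da p d \<noteq> d)"
proof (rule ccontr)
  assume none: "\<not> ?thesis"
  let ?t = "three_cycle 1 2 (3::nat)"
  have t: "?t \<in> alternating {1..n}" using n by (intro three_cycle_alternating) auto
  note i = alternating_id[of "{1..n}"]
  \<comment> \<open>Elements of \<open>Bij\<close> are extensional, so agreement on vertices and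
    darts is equality of the functions.\<close>
  have "va ?t = va id" "da ?t = da id"
    using rho_Aut[OF t] rho_Aut[OF i] none t rho_id
    by (auto simp: Aut_def Bij_def intro!: extensionalityI)
  then have "\<rho> ?t = \<rho> id" by (simp add: prod_eq_iff)
  then have "?t = id" using faithful t i by (auto simp: inj_on_def)
  then have "?t 1 = 1" by simp
  then show False by (simp add: three_cycle_apply)
qed

text \<open>Admissibility does not mention valence 0. A connected graph with an isolated vertex is a
  point, on which no faithful action exists.\<close>

lemma valence_ge_3:
  assumes v: "v \<in> verts X"
  shows "valence X v \<ge> 3"
proof -
  have "valence X v \<noteq> 0"
  proof
    assume "valence X v = 0"
    then have none: "{d \<in> darts X. tail X d = v} = {}"
      using finite_X by (simp add: valence_def)
    have "verts X = {v}"
    proof (rule ccontr)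
      assume "verts X \<noteq> {v}"
      then have "leaving X {v} \<noteq> {}"
        using connected_leaving[OF graph connected, of "{v}"] v by auto
      then show False using none by (auto simp: leaving_def)
    qed
    then have "darts X = {}" using none tail_in_verts[OF graph] by blast
    then show False using exists_moved va_in \<open>verts X = {v}\<close> by auto
  qed
  moreover have "valence X v \<noteq> 1" "valence X v \<noteq> 2" using adm v by (auto simp: admissible_def)
  ultimately show ?thesis by linarith
qed

lemma card_darts_le: "card (darts X) + 2 \<le> 4 * n + 2 * card (verts X)"
proof -
  have "verts X \<noteq> {}" using connected by (simp add: connected_graph_def)
  then show ?thesis using genus_lower_bound[OF graph finite_X(1)] genus by linarith
qed

text \<open>The excesses \<open>valence X v - 2\<close> are positive and add up to at most 4 n - 2
  over the whole graph, so the bound passes to every set of vertices.\<close>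

lemma valence_sum_le:
  assumes T: "T \<subseteq> verts X"
  shows "(\<Sum>v\<in>T. valence X v) + 2 \<le> 4 * n + 2 * card T"
proof -
  have fT: "finite T" using T finite_X(2) finite_subset by blast
  have "card (darts X) = (\<Sum>v\<in>verts X. valence X v)"
    using handshake[OF graph finite_X(1) subset_refl] tail_in_verts[OF graph]
    by (auto intro: arg_cong[where f = card])
  also have "\<dots> = (\<Sum>v\<in>T. valence X v) + (\<Sum>v\<in>verts X - T. valence X v)"
    using T finite_X(2) by (metis add.commute sum.subset_diff)
  finally have "card (darts X) = (\<Sum>v\<in>T. valence X v) + (\<Sum>v\<in>verts X - T. valence X v)" .
  moreover have "2 * card (verts X - T) \<le> (\<Sum>v\<in>verts X - T. valence X v)"
  proof -
    have "(\<Sum>v\<in>verts X - T. 2) \<le> (\<Sum>v\<in>verts X - T. valence X v)"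
      using valence_ge_3 by (intro sum_mono) fastforce
    then show ?thesis by simp
  qed
  moreover have "card (verts X) = card T + card (verts X - T)"
    using T fT finite_X(2) by (simp add: card_Diff_subset card_mono)
  ultimately show ?thesis using card_darts_le by linarith
qed

lemma choose_bound: "4 * n - 1 < n choose 2"
proof -
  obtain j where j: "n = j + 9" using n by (metis Suc_leI add.commute le_Suc_ex eval_nat_numeral(3))
  have "2 * (4 * n) \<le> n * (n - 1)" unfolding j by (simp add: algebra_simps)
  then have "4 * n \<le> n choose 2" by (simp add: choose_two less_eq_div_iff_mult_less_eq)
  then show ?thesis using n by linarith
qed

lemma card_verts_lt: "card (verts X) < n choose 2"
proof -
  have "card (verts X) * 3 \<le> (\<Sum>v\<in>verts X. valence X v)"
    using sum_mono[of "verts X" "\<lambda>_. 3" "valence X"] valence_ge_3 by simp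
  then show ?thesis using valence_sum_le[OF subset_refl] choose_bound by linarith
qed

lemma labelled_verts: "labelled_action {1..n} (verts X) va 1"
proof
  show "V.stab x = alternating {1..n} \<or> (\<exists>i\<in>{1..n}. V.stab x = {p \<in> alternating {1..n}. p i = i})"
    if x: "x \<in> verts X" for x
  proof (rule V.small_orbit_stabilizer[OF x])
    have "card (V.orb x) \<le> card (verts X)"
      using V.orb_subset[OF x] finite_X(2) by (rule card_mono[rotated])
    then show "card (V.orb x) < card {1..n} choose 2" using card_verts_lt by simp
  qed (use n in simp)
  show "4 \<le> card {1..n}" "1 \<in> {1..n}" using n by simp_all
qed

sublocale V: labelled_action "{1..n}" "verts X" va 1
  by (rule labelled_verts)

lemma card_Union_edges:
  assumes "O' \<subseteq> edge X ` darts X"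
  shows "card (\<Union> O') = 2 * card O'"
proof -
  have "card (\<Union> O') = (\<Sum>e\<in>O'. card e)"
  proof (rule card_Union_disjoint)
    show "pairwise disjnt O'"
    proof (rule pairwiseI)
      fix e f assume ef: "e \<in> O'" "f \<in> O'" "e \<noteq> f"
      have "edge X x = g" if gx: "x \<in> g" and g: "g \<in> O'" for x g
      proof -
        obtain d where d: "d \<in> darts X" "g = edge X d" using g assms by blast
        then have "x = d \<or> x = opp X d" using gx by (simp add: edge_def)
        then show ?thesis using d opp_opp[OF graph d(1)] by (auto simp: edge_def)
      qed
      then show "disjnt e f" using ef unfolding disjnt_def by blast
    qed
  qed (use assms in \<open>auto simp: edge_def\<close>)
  also have "\<dots> = (\<Sum>e\<in>O'. 2)"
  proof (rule sum.cong)
    fix e assume "e \<in> O'"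
    then obtain d where "d \<in> darts X" "e = edge X d" using assms by blast
    then show "card e = 2" using opp_neq[OF graph] by (force simp: edge_def)
  qed simp
  finally show ?thesis by simp
qed

text \<open>The end points of the orbit lie in two vertex orbits, of at most n points each by
  \<open>card_orb_le\<close>. The valences over these at most 2 n vertices sum to at most 8 n - 2,
  and this sum counts both darts of every edge of the orbit; so there are at most 4 n - 1
  edges.\<close>

lemma card_edge_orbit_lt:
  assumes d: "d \<in> darts X"
  shows "card (E.orb (edge X d)) < n choose 2"
proof -
  let ?O = "E.orb (edge X d)"
  let ?T = "V.orb (tail X d) \<union> V.orb (head X d)"
  have th: "tail X d \<in> verts X" "head X d \<in> verts X"
    using d tail_in_verts[OF graph] head_in_verts[OF graph] by auto
  have T: "?T \<subseteq> verts X" using V.orb_subset th by blast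
  have O: "?O \<subseteq> edge X ` darts X" using d by (intro E.orb_subset) auto
  have "\<Union> ?O \<subseteq> {x \<in> darts X. tail X x \<in> ?T}"
  proof
    fix x assume "x \<in> \<Union> ?O"
    then obtain p where p: "p \<in> alternating {1..n}" "x \<in> da p ` edge X d" by (auto simp: E.orb_def)
    then obtain y where "y = d \<or> y = opp X d" "x = da p y" by (auto simp: edge_def)
    then show "x \<in> {x \<in> darts X. tail X x \<in> ?T}"
      using p(1) d opp_in_darts[OF graph d] by (auto simp: da_in tail_da V.orb_def head_def)
  qed
  then have "card (\<Union> ?O) \<le> (\<Sum>v\<in>?T. valence X v)"
    unfolding handshake[OF graph finite_X(1) T] using finite_X(3) by (intro card_mono) auto
  moreover have "card ?T \<le> n + n"
    using V.card_orb_le[OF th(1)] V.card_orb_le[OF th(2)] card_Un_le[of "V.orb (tail X d)" "V.orb (head X d)"]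
    by simp
  ultimately have "2 * card ?O + 2 \<le> 8 * n"
    using valence_sum_le[OF T] card_Union_edges[OF O] by linarith
  then show ?thesis using choose_bound by linarith
qed

lemma labelled_darts: "labelled_action {1..n} (darts X) da 1"
proof
  show "D.stab d = alternating {1..n} \<or> (\<exists>i\<in>{1..n}. D.stab d = {p \<in> alternating {1..n}. p i = i})"
    if d: "d \<in> darts X" for d
  proof -
    have e: "edge X d \<in> edge X ` darts X" using d by blast
    have "E.stab (edge X d) = alternating {1..n} \<or>
        (\<exists>i\<in>{1..n}. E.stab (edge X d) = {p \<in> alternating {1..n}. p i = i})"
      using E.small_orbit_stabilizer[OF e] card_edge_orbit_lt[OF d] n by simp
    then show ?thesis using stab_edge[OF d] by simp
  qed
  show "4 \<le> card {1..n}" "1 \<in> {1..n}" using n by simp_all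
qed

sublocale D: labelled_action "{1..n}" "darts X" da 1
  by (rule labelled_darts)

end

section \<open>Counting a slice\<close>

lemma even_card_opp_closed:
  assumes X: "is_graph X" and S: "S \<subseteq> darts X" "finite S" "\<And>d. d \<in> S \<Longrightarrow> opp X d \<in> S"
  obtains P where "S = P \<union> opp X ` P" "P \<inter> opp X ` P = {}" "card S = 2 * card P" "finite P"
proof -
  let ?Y = "X\<lparr>darts := S\<rparr>"
  have "is_graph ?Y" using X S by (auto simp: is_graph_def)
  then obtain P where P: "P \<subseteq> S" "opp X ` P = S - P" "card S = 2 * card P"
    using oriented_edges[of ?Y] S(2) by auto
  show ?thesis
    using P S(2) finite_subset by (intro that[of P]) auto
qed

text \<open>The rank is the distance to \<open>W\<close> along \<open>R\<close>.\<close>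

lemma rank_towards:
  assumes "\<And>v. v \<in> F \<Longrightarrow> \<exists>w\<in>W. (v, w) \<in> R\<^sup>*"
  obtains r :: "'a \<Rightarrow> nat" where "\<And>v. v \<in> F - W \<Longrightarrow> \<exists>u. (v, u) \<in> R \<and> r u < r v"
proof -
  define Q where "Q v k \<longleftrightarrow> (\<exists>w\<in>W. (v, w) \<in> R ^^ k)" for v k
  define r where "r v = (LEAST k. Q v k)" for v
  have "\<exists>u. (v, u) \<in> R \<and> r u < r v" if v: "v \<in> F - W" for v
  proof -
    have "\<exists>k. Q v k" using assms[of v] v by (auto simp: Q_def rtrancl_power)
    then have "Q v (r v)" unfolding r_def by (rule LeastI_ex)
    then obtain w where w: "w \<in> W" "(v, w) \<in> R ^^ r v" by (auto simp: Q_def)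
    have "r v \<noteq> 0" using w v by (metis DiffD2 pair_in_Id_conv relpow.simps(1))
    then obtain k where k: "r v = Suc k" using not0_implies_Suc by blast
    then obtain u where u: "(v, u) \<in> R" "(u, w) \<in> R ^^ k" using w(2) relpow_Suc_D2 by metis
    then have "Q u k" using w(1) by (auto simp: Q_def)
    then have "r u \<le> k" unfolding r_def by (rule Least_le)
    then show ?thesis using u k by auto
  qed
  then show ?thesis by (rule that)
qed

section \<open>One slice and the fixed part\<close>

context small_graph
begin

abbreviation "slice_darts \<equiv> D.slice 1"
abbreviation "slice_verts \<equiv> V.slice 1"

text \<open>The places where moved edges are glued to the fixed part; by equivariance they are the
  same for every label.\<close>

definition attach :: "'v set" where
  "attach = V.fixed \<inter> tail X ` slice_darts"

definition attached_darts :: "'d set" where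
  "attached_darts = {d \<in> slice_darts. tail X d \<in> attach}"

lemma slice_darts: "d \<in> slice_darts \<Longrightarrow> d \<in> darts X"
  using D.subset_\<Omega> by blast

lemma finite_slices: "finite slice_darts" "finite slice_verts" "finite V.fixed" "finite D.fixed"
  using finite_X D.subset_\<Omega> V.subset_\<Omega> finite_subset by metis+

lemma one_in: "1 \<in> {1..n}" "2 \<in> {1..n}"
  using n by auto

lemma slice_opp: "d \<in> slice_darts \<Longrightarrow> opp X d \<in> slice_darts"
  using stab_opp opp_in_darts[OF graph] by (simp add: D.slice_def)

lemma fixed_opp: "d \<in> D.fixed \<Longrightarrow> opp X d \<in> D.fixed"
  using stab_opp opp_in_darts[OF graph] by (simp add: D.fixed_def)

text \<open>The stabilizer of a dart is contained in that of its tail, and point stabilizers of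
  different labels are not nested.\<close>

lemma slice_tail:
  assumes d: "d \<in> slice_darts"
  shows "tail X d \<in> V.fixed \<union> slice_verts"
proof -
  have dX: "d \<in> darts X" using d slice_darts by blast
  have v: "tail X d \<in> verts X" using tail_in_verts[OF graph dX] .
  have sub: "{p \<in> alternating {1..n}. p 1 = 1} \<subseteq> V.stab (tail X d)"
    using stab_dart_subset_stab_tail[OF dX] d by (simp add: D.slice_def)
  from V.in_fixed_or_slice[OF v] show ?thesis
  proof
    assume "\<exists>i\<in>{1..n}. tail X d \<in> V.slice i"
    then obtain i where i: "i \<in> {1..n}" "tail X d \<in> V.slice i" by blast
    have "1 = i"
      by (rule V.stab_fixes_point[OF one_in(1) i(1)]) (use sub i(2) in \<open>auto simp: V.slice_def\<close>)
    then show ?thesis using i by blast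
  qed simp
qed

lemma fixed_slice_verts_disjoint: "V.fixed \<inter> slice_verts = {}"
  using V.slice_fixed_disjoint one_in by blast

lemma attach_tail: "d \<in> slice_darts \<Longrightarrow> tail X d \<notin> slice_verts \<Longrightarrow> tail X d \<in> attach"
  using slice_tail by (auto simp: attach_def)

lemma attach_head: "d \<in> slice_darts \<Longrightarrow> head X d \<notin> slice_verts \<Longrightarrow> head X d \<in> attach"
  using attach_tail[OF slice_opp] by (simp add: head_def)

lemma attach_not_slice: "v \<in> attach \<Longrightarrow> v \<notin> slice_verts"
  using fixed_slice_verts_disjoint by (auto simp: attach_def)

lemma fixed_dart_tail: "d \<in> D.fixed \<Longrightarrow> tail X d \<in> V.fixed"
  using stab_dart_subset_stab_tail tail_in_verts[OF graph] by (auto simp: D.fixed_def V.fixed_def V.stab_def)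

lemma fixed_dart_head: "d \<in> D.fixed \<Longrightarrow> head X d \<in> V.fixed"
  using fixed_dart_tail[OF fixed_opp] by (simp add: head_def)

text \<open>By the same inclusion of stabilizers, a dart at a vertex with label 1 cannot be fixed or
  carry another label.\<close>

lemma star_slice:
  assumes d: "d \<in> darts X" "tail X d \<in> slice_verts"
  shows "d \<in> slice_darts"
proof -
  have sub: "D.stab d \<subseteq> {p \<in> alternating {1..n}. p 1 = 1}"
    using stab_dart_subset_stab_tail[OF d(1)] d(2) by (simp add: V.slice_def)
  have "d \<notin> D.fixed"
    using fixed_dart_tail fixed_slice_verts_disjoint d(2) by blast
  then obtain i where i: "i \<in> {1..n}" "d \<in> D.slice i" using D.in_fixed_or_slice[OF d(1)] by blast
  have "i = 1"
    by (rule V.stab_fixes_point[OF i(1) one_in(1)]) (use sub i(2) in \<open>auto simp: D.slice_def\<close>)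
  then show ?thesis using i by simp
qed

lemma tail_mv: "i \<in> {1..n} \<Longrightarrow> d \<in> darts X \<Longrightarrow> tail X (D.mv i d) = V.mv i (tail X d)"
  unfolding D.mv_def V.mv_def using tail_da D.shiftS by blast

lemma opp_mv: "i \<in> {1..n} \<Longrightarrow> d \<in> darts X \<Longrightarrow> opp X (D.mv i d) = D.mv i (opp X d)"
  unfolding D.mv_def using opp_da D.shiftS by blast

lemma moved_dart:
  assumes "d \<in> darts X - D.fixed"
  obtains i e where "i \<in> {1..n}" "e \<in> slice_darts" "d = D.mv i e"
  using D.in_fixed_or_slice D.in_slice_mv assms by (metis DiffD1 DiffD2)

lemma moved_dart_tail:
  assumes "d \<in> darts X - D.fixed" "tail X d \<in> V.fixed"
  shows "tail X d \<in> attach"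
proof -
  obtain i e where e: "i \<in> {1..n}" "e \<in> slice_darts" "d = D.mv i e" using moved_dart[OF assms(1)] .
  have t: "tail X d = V.mv i (tail X e)" using tail_mv e slice_darts by simp
  have "tail X e \<notin> slice_verts"
  proof
    assume "tail X e \<in> slice_verts"
    then have "V.mv i (tail X e) \<in> V.slice i" using V.mv_slice[OF e(1)] by blast
    then show False using V.slice_fixed_disjoint[OF e(1)] t assms(2) by simp
  qed
  then have "tail X e \<in> attach" using attach_tail e by blast
  moreover from this have "V.mv i (tail X e) = tail X e"
    using V.mv_fixed[OF e(1)] by (simp add: attach_def)
  ultimately show ?thesis using t by simp
qed

lemma card_darts: "card (darts X) = n * card slice_darts + card D.fixed"
  using D.card_moved card_Diff_subset[of D.fixed "darts X"] card_mono[OF finite_X(3) D.subset_\<Omega>(1)]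
    finite_slices D.subset_\<Omega>(1) by simp

lemma card_verts: "card (verts X) = n * card slice_verts + card V.fixed"
  using V.card_moved card_Diff_subset[of V.fixed "verts X"] card_mono[OF finite_X(2) V.subset_\<Omega>(1)]
    finite_slices V.subset_\<Omega>(1) by simp

lemma slice_verts_proper: "slice_verts \<subseteq> verts X" "slice_verts \<noteq> verts X"
proof -
  show "slice_verts \<subseteq> verts X" by (rule V.subset_\<Omega>)
  show "slice_verts \<noteq> verts X"
  proof
    assume eq: "slice_verts = verts X"
    then obtain v where v: "v \<in> slice_verts" using connected by (auto simp: connected_graph_def)
    then have "V.mv 2 v \<in> V.slice 2" using V.mv_slice one_in by blast
    moreover from this have "V.mv 2 v \<in> slice_verts" using eq V.subset_\<Omega> by blast
    ultimately show False using V.slice_unique one_in by fastforce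
  qed
qed

lemma leaving_slice:
  assumes "U \<subseteq> slice_verts"
  shows "leaving X U \<subseteq> slice_darts"
  using assms star_slice by (auto simp: leaving_def)

lemma opp_leaving_slice: "opp X ` leaving X slice_verts \<subseteq> attached_darts"
proof
  fix x assume "x \<in> opp X ` leaving X slice_verts"
  then obtain d where d: "d \<in> leaving X slice_verts" "x = opp X d" by blast
  then have "d \<in> slice_darts" "head X d \<notin> slice_verts"
    using leaving_slice[of slice_verts] by (auto simp: leaving_def)
  then show "x \<in> attached_darts"
    using attach_head slice_opp d(2) by (simp add: attached_darts_def head_def)
qed

lemma inj_opp: "S \<subseteq> darts X \<Longrightarrow> inj_on (opp X) S"
  by (rule inj_on_inverseI[of _ "opp X"]) (use opp_opp[OF graph] in blast)

lemma card_opp: "S \<subseteq> darts X \<Longrightarrow> card (opp X ` S) = card S"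
  using inj_opp card_image by blast

lemma slice_darts_nonempty: "slice_darts \<noteq> {}"
proof
  assume none: "slice_darts = {}"
  then have fixed: "darts X \<subseteq> D.fixed" using moved_dart by (metis DiffI empty_iff subsetI)
  have "v \<in> V.fixed" if "v \<in> verts X" for v
  proof -
    have "{d \<in> darts X. tail X d = v} \<noteq> {}"
    proof
      assume "{d \<in> darts X. tail X d = v} = {}"
      then have "valence X v = 0" unfolding valence_def by (metis card.empty)
      then show False using valence_ge_3[OF that] by simp
    qed
    then show ?thesis using fixed fixed_dart_tail by blast
  qed
  then show False using exists_moved fixed V.act_fixed D.act_fixed by blast
qed

text \<open>Without moved vertices both ends of a slice edge are fixed; otherwise the cut around the
  slice has two darts, and their opposites are attached.\<close>

lemma attached_darts_ge_2: "card attached_darts \<ge> 2"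
proof (cases "slice_verts = {}")
  case True
  obtain d where d: "d \<in> slice_darts" using slice_darts_nonempty by blast
  then have "{d, opp X d} \<subseteq> attached_darts"
    using attach_tail slice_opp True by (auto simp: attached_darts_def)
  moreover have "card {d, opp X d} = 2" using opp_neq[OF graph slice_darts[OF d]] by auto
  moreover have "finite attached_darts" using finite_slices by (simp add: attached_darts_def)
  ultimately show ?thesis by (metis card_mono)
next
  case False
  have "card (leaving X slice_verts) \<ge> 2"
    using admissible_leaving_ge_2[OF adm slice_verts_proper(1) False slice_verts_proper(2)] .
  also have "card (leaving X slice_verts) = card (opp X ` leaving X slice_verts)"
    by (rule card_opp[symmetric]) (auto simp: leaving_def)
  also have "\<dots> \<le> card attached_darts"
    using opp_leaving_slice finite_slices by (intro card_mono) (auto simp: attached_darts_def)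
  finally show ?thesis .
qed

lemma attach_eq: "attach = tail X ` attached_darts"
  by (auto simp: attach_def attached_darts_def)

lemma card_attach_le: "card attach \<le> card attached_darts"
  unfolding attach_eq using finite_slices by (intro card_image_le) (simp add: attached_darts_def)

lemma attach_nonempty: "attach \<noteq> {}"
  using attached_darts_ge_2 unfolding attach_eq by auto

lemma finite_attach: "finite attach"
  using finite_slices by (simp add: attach_def)

lemma slice_darts_split:
  "slice_darts = {d \<in> darts X. tail X d \<in> slice_verts} \<union> attached_darts"
  "{d \<in> darts X. tail X d \<in> slice_verts} \<inter> attached_darts = {}"
proof -
  show "slice_darts = {d \<in> darts X. tail X d \<in> slice_verts} \<union> attached_darts"
    unfolding attached_darts_def using star_slice attach_tail slice_darts by blast
  show "{d \<in> darts X. tail X d \<in> slice_verts} \<inter> attached_darts = {}"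
    unfolding attached_darts_def using attach_not_slice by blast
qed

lemma card_slice_darts:
  "card slice_darts = (\<Sum>v\<in>slice_verts. valence X v) + card attached_darts"
proof -
  have f: "finite {d \<in> darts X. tail X d \<in> slice_verts}" "finite attached_darts"
    using finite_X(3) finite_slices by (simp_all add: attached_darts_def)
  have "card slice_darts = card ({d \<in> darts X. tail X d \<in> slice_verts} \<union> attached_darts)"
    by (rule arg_cong[OF slice_darts_split(1)])
  also have "\<dots> = card {d \<in> darts X. tail X d \<in> slice_verts} + card attached_darts"
    by (rule card_Un_disjoint[OF f slice_darts_split(2)])
  finally show ?thesis using handshake[OF graph finite_X(1) slice_verts_proper(1)] by simp
qed

text \<open>Follow a path of \<open>X\<close> towards \<open>attach\<close> up to the first dart
  that is moved: its tail already lies in \<open>attach\<close>.\<close>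

lemma fixed_reaches_attach:
  assumes "v \<in> V.fixed"
  shows "\<exists>w\<in>attach. (v, w) \<in> {(tail X d, head X d) |d. d \<in> D.fixed}\<^sup>*"
proof -
  obtain w where w: "w \<in> attach" using attach_nonempty by blast
  then have "(v, w) \<in> {(tail X d, head X d) |d. d \<in> darts X}\<^sup>*"
    using connected assms V.subset_\<Omega>(1) by (auto simp: connected_graph_def attach_def)
  then show ?thesis using assms
  proof (induction rule: converse_rtrancl_induct)
    case base
    then show ?case using w by blast
  next
    case (step u v)
    then obtain d where d: "d \<in> darts X" "u = tail X d" "v = head X d" by blast
    show ?case
    proof (cases "d \<in> D.fixed")
      case True
      then have "v \<in> V.fixed" using fixed_dart_head d by blast
      then obtain w where "w \<in> attach" "(v, w) \<in> {(tail X d, head X d) |d. d \<in> D.fixed}\<^sup>*"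
        using step.IH by blast
      then show ?thesis using d True
        by (intro bexI[of _ w] converse_rtrancl_into_rtrancl[of u v]) auto
    next
      case False
      then have "u \<in> attach" using moved_dart_tail d step.prems by blast
      then show ?thesis by blast
    qed
  qed
qed

text \<open>Chooses a forest in the fixed part, directed towards \<open>attach\<close>; the
  decreasing rank will show that no edge is chosen from both of its ends.\<close>

lemma fixed_parents:
  "\<exists>par (r :: 'v \<Rightarrow> nat). \<forall>v\<in>V.fixed - attach.
    par v \<in> D.fixed \<and> tail X (par v) = v \<and> r (head X (par v)) < r v"
proof -
  obtain r :: "'v \<Rightarrow> nat" where r: "\<And>v. v \<in> V.fixed - attach \<Longrightarrow>
      \<exists>u. (v, u) \<in> {(tail X d, head X d) |d. d \<in> D.fixed} \<and> r u < r v"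
    using rank_towards[OF fixed_reaches_attach] by blast
  have "\<forall>v\<in>V.fixed - attach. \<exists>d. d \<in> D.fixed \<and> tail X d = v \<and> r (head X d) < r v"
    using r by blast
  then show ?thesis by metis
qed

text \<open>
  The parent darts form a forest in the fixed part; every further fixed edge raises the genus.
\<close>

lemma fixed_darts_count:
  assumes par: "\<And>v. v \<in> V.fixed - attach \<Longrightarrow>
      par v \<in> D.fixed \<and> tail X (par v) = v \<and> r (head X (par v)) < (r v :: nat)"
    and L: "L \<subseteq> D.fixed" "L \<inter> opp X ` L = {}"
      "\<And>d. d \<in> L \<Longrightarrow> d \<notin> par ` (V.fixed - attach) \<and> opp X d \<notin> par ` (V.fixed - attach)"
  shows "2 * card V.fixed + 2 * card L \<le> card D.fixed + 2 * card attach"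
proof -
  let ?P = "par ` (V.fixed - attach)"
  have P: "?P \<subseteq> D.fixed" using par by blast
  have DX: "D.fixed \<subseteq> darts X" by (rule D.subset_\<Omega>)
  have oo: "opp X (opp X d) = d" if "d \<in> D.fixed" for d using opp_opp[OF graph] that DX by blast
  have "inj_on par (V.fixed - attach)"
    by (rule inj_on_inverseI[of _ "tail X"]) (use par in blast)
  then have cP: "card ?P = card (V.fixed - attach)" by (rule card_image)
  \<comment> \<open>Two opposite parent darts would make each of their end points closer to
    \<open>attach\<close> than the other.\<close>
  have "?P \<inter> opp X ` ?P = {}"
  proof (rule ccontr)
    assume "?P \<inter> opp X ` ?P \<noteq> {}"
    then obtain u v where uv: "u \<in> V.fixed - attach" "v \<in> V.fixed - attach" "par u = opp X (par v)"
      by blast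
    have "head X (par v) = u" using par[OF uv(1)] uv(3) by (simp add: head_def)
    moreover have "head X (par u) = v" using par[OF uv(2)] uv(3) oo by (simp add: head_def)
    ultimately show False using par[OF uv(1)] par[OF uv(2)] by simp
  qed
  moreover have PL: "?P \<inter> L = {}" using L(3) by blast
  moreover have "?P \<inter> opp X ` L = {}" 
  proof (rule ccontr)
    assume "?P \<inter> opp X ` L \<noteq> {}"
    then obtain x where x: "x \<in> ?P" "x \<in> opp X ` L" by (meson Int_emptyI)
    from x(2) obtain l where "l \<in> L" "x = opp X l" by (rule imageE)
    then show False using L(3)[of l] x(1) by simp
  qed
  moreover have "L \<inter> opp X ` ?P = {}"
  proof (rule ccontr)
    assume "L \<inter> opp X ` ?P \<noteq> {}"
    then obtain x where x: "x \<in> opp X ` ?P" "x \<in> L" by (meson Int_emptyI)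
    from x(1) obtain y where "y \<in> ?P" "x = opp X y" by (rule imageE)
    with x(2) have y: "y \<in> ?P" "opp X y \<in> L" by simp_all
    then have "opp X (opp X y) = y" using oo P by blast
    then show False using L(3)[OF y(2)] y(1) by simp
  qed
  moreover have "opp X ` ?P \<inter> opp X ` L = {}"
  proof (rule ccontr)
    assume "opp X ` ?P \<inter> opp X ` L \<noteq> {}"
    then obtain x where x: "x \<in> opp X ` ?P" "x \<in> opp X ` L" by (meson Int_emptyI)
    from x(1) obtain y where "y \<in> ?P" "x = opp X y" by (rule imageE)
    moreover from x(2) obtain l where "l \<in> L" "x = opp X l" by (rule imageE)
    ultimately have y: "y \<in> ?P" "l \<in> L" "opp X y = opp X l" by simp_all
    then have "y \<in> D.fixed" "l \<in> D.fixed" using P L(1) by (simp_all add: subsetD)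
    then have "y = l" using oo y(3) by metis
    then show False using y PL by blast
  qed
  ultimately have disj: "(?P \<union> L) \<inter> opp X ` (?P \<union> L) = {}"
    using L(2) by (simp only: image_Un Int_Un_distrib Int_Un_distrib2 Un_empty_left Un_empty_right)
  have sub: "?P \<union> L \<subseteq> D.fixed" using P L by blast
  have fin: "finite (?P \<union> L)" using sub finite_slices finite_subset by blast
  have "card (?P \<union> L) = card ?P + card L"
    using PL fin by (intro card_Un_disjoint) auto
  moreover have "card ((?P \<union> L) \<union> opp X ` (?P \<union> L)) = 2 * card (?P \<union> L)"
    unfolding card_Un_disjoint[OF fin finite_imageI[OF fin] disj] card_opp[OF subset_trans[OF sub DX]]
    by (rule mult_2[symmetric])
  moreover have "(?P \<union> L) \<union> opp X ` (?P \<union> L) \<subseteq> D.fixed"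
    by (intro Un_least sub image_subsetI fixed_opp subsetD[OF sub])
  then have "card ((?P \<union> L) \<union> opp X ` (?P \<union> L)) \<le> card D.fixed"
    using finite_slices by (intro card_mono)
  moreover have "card V.fixed = card (V.fixed - attach) + card attach"
  proof -
    have sub: "attach \<subseteq> V.fixed" by (simp add: attach_def)
    show ?thesis
      using card_Diff_subset[OF finite_attach sub] card_mono[OF finite_slices(3) sub] by simp
  qed
  ultimately show ?thesis using cP by linarith
qed

lemma genus_slice:
  "n * card slice_darts + card D.fixed + 2 \<le> 2 * genus X + 2 * (n * card slice_verts) + 2 * card V.fixed"
proof -
  have "verts X \<noteq> {}" using connected by (simp add: connected_graph_def)
  then show ?thesis
    using genus_lower_bound[OF graph finite_X(1)] card_darts card_verts by linarith
qed

text \<open>The parent darts pay for every fixed vertex off \<open>attach\<close>. What remains says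
  that E - V + 1, taken for the moved subgraph alone, is at most the genus of
  \<open>X\<close>.\<close>

lemma genus_attach:
  "n * card slice_darts + 2 \<le> 2 * genus X + 2 * (n * card slice_verts) + 2 * card attach"
proof -
  obtain par and r :: "'v \<Rightarrow> nat" where
    "\<forall>v\<in>V.fixed - attach. par v \<in> D.fixed \<and> tail X (par v) = v \<and> r (head X (par v)) < r v"
    using fixed_parents by blast
  note par = bspec[OF this]
  show ?thesis using fixed_darts_count[OF par, of "{}"] genus_slice by simp
qed

text \<open>
  If the moved edges split into two parts without common vertices, the fixed part must join them
  by at least two edges outside the forest of parent darts.
\<close>

lemma genus_attach_disconnected:
  assumes V1: "slice_verts = {}" and W: "attach = W1 \<union> W2" "W1 \<inter> W2 = {}" "W1 \<noteq> {}" "W2 \<noteq> {}"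
    and sep: "\<And>d. d \<in> slice_darts \<Longrightarrow> tail X d \<in> W1 \<Longrightarrow> head X d \<in> W1"
  shows "n * card slice_darts + 6 \<le> 2 * genus X + 2 * card attach"
proof -
  obtain par and r :: "'v \<Rightarrow> nat" where
    "\<forall>v\<in>V.fixed - attach. par v \<in> D.fixed \<and> tail X (par v) = v \<and> r (head X (par v)) < r v"
    using fixed_parents by blast
  note par = bspec[OF this]
  have fixed: "V.fixed = verts X"
  proof -
    have "card V.fixed = card (verts X)" using card_verts V1 by simp
    then show ?thesis using card_subset_eq[OF finite_X(2) V.subset_\<Omega>(1)] by simp
  qed
  define R where "R = {(v, head X (par v)) |v. v \<in> V.fixed - attach}"
  \<comment> \<open>The vertices whose path of parents ends in \<open>W1\<close>. A vertex lies in
    \<open>U\<close> exactly if its parent does, so no parent dart crosses the boundary of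
    \<open>U\<close>, and by \<open>sep\<close> no moved dart leaves \<open>U\<close>.\<close>
  define U where "U = {v \<in> verts X. \<exists>w\<in>W1. (v, w) \<in> R\<^sup>*}"
  have U_attach: "v \<in> U \<longleftrightarrow> v \<in> W1" if "v \<in> attach" for v
  proof
    assume "v \<in> U"
    then obtain w where w: "w \<in> W1" "(v, w) \<in> R\<^sup>*" by (auto simp: U_def)
    from w(2) have "v = w" by (cases rule: converse_rtranclE) (use that in \<open>auto simp: R_def\<close>)
    then show "v \<in> W1" using w by simp
  next
    assume "v \<in> W1"
    then show "v \<in> U" using that V.subset_\<Omega>(1) by (auto simp: U_def attach_def)
  qed
  have U_par: "v \<in> U \<longleftrightarrow> head X (par v) \<in> U" if v: "v \<in> V.fixed - attach" for v
  proof
    assume "v \<in> U"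
    then obtain w where w: "w \<in> W1" "(v, w) \<in> R\<^sup>*" by (auto simp: U_def)
    have "head X (par v) \<in> verts X"
      using par[OF v] fixed_dart_head fixed by blast
    from w(2) show "head X (par v) \<in> U"
    proof (cases rule: converse_rtranclE)
      case base
      then show ?thesis using w v W by auto
    next
      case (step u)
      then show ?thesis using w \<open>head X (par v) \<in> verts X\<close> by (auto simp: R_def U_def)
    qed
  next
    assume "head X (par v) \<in> U"
    moreover have "(v, head X (par v)) \<in> R" using v by (auto simp: R_def)
    ultimately show "v \<in> U"
      using v fixed by (auto simp: U_def intro: converse_rtrancl_into_rtrancl)
  qed
  let ?L = "leaving X U"
  have UX: "U \<subseteq> verts X" by (auto simp: U_def)
  have "U \<noteq> {}" "U \<noteq> verts X"
    using W U_attach V.subset_\<Omega>(1) by (auto simp: attach_def)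
  then have L2: "card ?L \<ge> 2" using admissible_leaving_ge_2[OF adm UX] by blast
  have Lfix: "?L \<subseteq> D.fixed"
  proof
    fix d assume d: "d \<in> ?L"
    then have dX: "d \<in> darts X" "tail X d \<in> U" "head X d \<notin> U" by (auto simp: leaving_def)
    show "d \<in> D.fixed"
    proof (rule ccontr)
      assume nf: "d \<notin> D.fixed"
      obtain i e where e: "i \<in> {1..n}" "e \<in> slice_darts" "d = D.mv i e"
        using moved_dart[of d] dX nf by blast
      have te: "tail X e \<in> attach" "head X e \<in> attach" using attach_tail attach_head e V1 by auto
      have eX: "e \<in> darts X" using e slice_darts by blast
      have "tail X d = tail X e"
        using tail_mv[OF e(1) eX] e(3) te V.mv_fixed[OF e(1)] by (simp add: attach_def)
      moreover have "head X d = head X e"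
        using tail_mv[OF e(1) opp_in_darts[OF graph eX]] opp_mv[OF e(1) eX] e(3) te V.mv_fixed[OF e(1)]
        by (simp add: attach_def head_def)
      ultimately show False using dX sep[OF e(2)] U_attach te by metis
    qed
  qed
  have "?L \<inter> opp X ` ?L = {}"
    using head_opp[OF graph] by (auto simp: leaving_def)
  moreover have "d \<notin> par ` (V.fixed - attach) \<and> opp X d \<notin> par ` (V.fixed - attach)" if "d \<in> ?L" for d
  proof (intro conjI notI)
    have d: "d \<in> darts X" "tail X d \<in> U" "head X d \<notin> U" using that by (auto simp: leaving_def)
    show False if "d \<in> par ` (V.fixed - attach)" using that d U_par par by fastforce
    show False if od: "opp X d \<in> par ` (V.fixed - attach)"
    proof -
      obtain v where v: "v \<in> V.fixed - attach" "opp X d = par v" using od by blast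
      have "head X (par v) = tail X d" using head_opp[OF graph d(1)] v(2) by simp
      moreover have "v = head X d" using par[OF v(1)] v(2) by (simp add: head_def)
      ultimately show False using U_par[OF v(1)] d by simp
    qed
  qed
  \<comment> \<open>At least two leaving darts, each counted with its opposite, raise the constant 2
    of \<open>genus_attach\<close> to 6.\<close>
  ultimately have "2 * card V.fixed + 2 * card ?L \<le> card D.fixed + 2 * card attach"
    by (intro fixed_darts_count[OF par Lfix])
  then show ?thesis using genus_slice L2 V1 by simp
qed

text \<open>In \<open>genus_attach\<close> each dart in excess of
  \<open>2 * card slice_verts\<close> costs n and gains at most 2, through a new point of
  \<open>attach\<close>. The genus contributes at most 4 n, which pays for four such darts but not
  for a fifth.\<close>

lemma slice_bound: "card slice_darts \<le> 2 * card slice_verts + 4"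
proof (rule ccontr)
  assume big: "\<not> ?thesis"
  obtain k where k: "card slice_darts = 2 * card slice_verts + (k + 5)"
  proof -
    have "2 * card slice_verts + 5 \<le> card slice_darts" using big by simp
    then obtain k where "card slice_darts = 2 * card slice_verts + 5 + k" by (auto simp: le_iff_add)
    then show ?thesis using that[of k] by simp
  qed
  have "3 * card slice_verts \<le> (\<Sum>v\<in>slice_verts. valence X v)"
    using sum_mono[of slice_verts "\<lambda>_. 3" "valence X"] valence_ge_3 V.subset_\<Omega>(2)
    by (simp add: subset_iff mult.commute)
  then have "card attach \<le> k + 5"
    using card_slice_darts card_attach_le k by linarith
  then have "n * (k + 5) + 2 \<le> 4 * n + 2 * (k + 5)"
    using genus_attach genus unfolding k by (simp add: algebra_simps)
  moreover obtain j where "n = j + 9" using n by (metis Suc_leI add.commute le_Suc_ex eval_nat_numeral(3))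
  ultimately show False by (simp add: algebra_simps)
qed

lemma slice_card_bounds: "card slice_verts + card attached_darts \<le> 4"
proof -
  have "3 * card slice_verts \<le> (\<Sum>v\<in>slice_verts. valence X v)"
    using sum_mono[of slice_verts "\<lambda>_. 3" "valence X"] valence_ge_3 V.subset_\<Omega>(2)
    by (simp add: subset_iff mult.commute)
  then show ?thesis using card_slice_darts slice_bound by linarith
qed

section \<open>The possible slices\<close>

lemma star_card: "v \<in> verts X \<Longrightarrow> card {d \<in> darts X. tail X d = v} = valence X v"
  by (simp add: valence_def)

lemma head_tail_iff:
  assumes "d \<in> darts X"
  shows "tail X (opp X d) = head X d" "head X (opp X d) = tail X d"
  using assms head_opp[OF graph] by (simp_all add: head_def)

text \<open>Loops contribute their darts in pairs, so the valence and the size of the cut around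
  \<open>v\<close> have the same parity.\<close>

lemma leaving_single_parity:
  assumes v: "v \<in> verts X"
  obtains P where "{d \<in> darts X. tail X d = v} = leaving X {v} \<union> P \<union> opp X ` P"
    "valence X v = card (leaving X {v}) + 2 * card P" "finite P"
    "P \<subseteq> {d \<in> darts X. tail X d = v \<and> head X d = v}"
proof -
  let ?L = "{d \<in> darts X. tail X d = v \<and> head X d = v}"
  have "finite ?L" using finite_X by simp
  then obtain P where P: "?L = P \<union> opp X ` P" "P \<inter> opp X ` P = {}" "card ?L = 2 * card P" "finite P"
    using even_card_opp_closed[OF graph, of ?L] opp_in_darts[OF graph] head_tail_iff by auto
  have eq: "{d \<in> darts X. tail X d = v} = leaving X {v} \<union> ?L" by (auto simp: leaving_def)
  have "card (leaving X {v} \<union> ?L) = card (leaving X {v}) + card ?L"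
    by (intro card_Un_disjoint finite_leaving finite_X \<open>finite ?L\<close>) (auto simp: leaving_def)
  then have "valence X v = card (leaving X {v}) + 2 * card P"
    using eq P(3) by (simp add: valence_def)
  moreover have "{d \<in> darts X. tail X d = v} = leaving X {v} \<union> P \<union> opp X ` P"
    using eq P(1) by (simp only: Un_assoc)
  ultimately show ?thesis using that[of P] P(1,4) by blast
qed

text \<open>An attached dart either leads to a moved vertex or has an opposite that is attached
  too.\<close>

lemma attached_parity:
  obtains P where "attached_darts = opp X ` leaving X slice_verts \<union> P \<union> opp X ` P"
    "card attached_darts = card (leaving X slice_verts) + 2 * card P" "finite P"
proof -
  let ?L = "{d \<in> slice_darts. tail X d \<notin> slice_verts \<and> head X d \<notin> slice_verts}"
  have fin: "finite ?L" using finite_slices by simp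
  have L: "d \<in> ?L \<Longrightarrow> opp X d \<in> ?L" for d
    using slice_opp head_tail_iff slice_darts by auto
  obtain P where P: "?L = P \<union> opp X ` P" "P \<inter> opp X ` P = {}" "card ?L = 2 * card P" "finite P"
    using even_card_opp_closed[OF graph, of ?L] fin L slice_darts by blast
  have eq: "attached_darts = opp X ` leaving X slice_verts \<union> ?L"
  proof
    show "attached_darts \<subseteq> opp X ` leaving X slice_verts \<union> ?L"
    proof
      fix d assume d: "d \<in> attached_darts"
      then have ds: "d \<in> slice_darts" "tail X d \<notin> slice_verts"
        using attach_not_slice by (auto simp: attached_darts_def)
      have dX: "d \<in> darts X" using ds slice_darts by blast
      show "d \<in> opp X ` leaving X slice_verts \<union> ?L"
      proof (cases "head X d \<in> slice_verts")
        case True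
        then have "opp X d \<in> leaving X slice_verts"
          using ds dX head_tail_iff[OF dX] opp_in_darts[OF graph dX] by (simp add: leaving_def)
        then have "opp X (opp X d) \<in> opp X ` leaving X slice_verts" by (rule imageI)
        then show ?thesis using opp_opp[OF graph dX] by simp
      qed (use ds in simp)
    qed
    show "opp X ` leaving X slice_verts \<union> ?L \<subseteq> attached_darts"
      using opp_leaving_slice attach_tail by (auto simp: attached_darts_def)
  qed
  have "card (opp X ` leaving X slice_verts \<union> ?L) = card (opp X ` leaving X slice_verts) + card ?L"
    using head_tail_iff
    by (intro card_Un_disjoint finite_imageI finite_leaving finite_X fin) (auto simp: leaving_def)
  moreover have "card (opp X ` leaving X slice_verts) = card (leaving X slice_verts)"
    by (rule card_opp) (auto simp: leaving_def)
  ultimately have "card attached_darts = card (leaving X slice_verts) + 2 * card P"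
    using eq P(3) by simp
  moreover have "attached_darts = opp X ` leaving X slice_verts \<union> P \<union> opp X ` P"
    using eq P(1) by (simp only: Un_assoc)
  ultimately show ?thesis using that[of P] P(4) by blast
qed

lemma leaving_slice_ge_2: "slice_verts \<noteq> {} \<Longrightarrow> card (leaving X slice_verts) \<ge> 2"
  using admissible_leaving_ge_2[OF adm slice_verts_proper(1) _ slice_verts_proper(2)] by blast

lemma slice_star: "slice_verts = {v} \<Longrightarrow>
  slice_darts = {d \<in> darts X. tail X d = v} \<union> attached_darts"
  using slice_darts_split(1) by simp

text \<open>
  With two moved vertices per label, both would be joined by a pair of parallel edges and have a
  third edge to a fixed vertex.
\<close>

lemma card_slice_verts_neq_2: "card slice_verts \<noteq> 2"
proof
  assume c2: "card slice_verts = 2"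
  then obtain u v where uv: "slice_verts = {u, v}" "u \<noteq> v" by (meson card_2_iff)
  have uX: "u \<in> verts X" "v \<in> verts X" using uv V.subset_\<Omega>(2) by blast+
  \<comment> \<open>The eight darts allowed by \<open>slice_bound\<close> are used up by two
    valences of at least 3 and two attached darts.\<close>
  have val: "valence X u = 3" "valence X v = 3"
  proof -
    have "card slice_darts = valence X u + valence X v + card attached_darts"
      using card_slice_darts uv by simp
    moreover have "card slice_darts \<le> 8" using slice_bound c2 by simp
    ultimately show "valence X u = 3" "valence X v = 3"
      using attached_darts_ge_2 valence_ge_3[OF uX(1)] valence_ge_3[OF uX(2)] by linarith+
  qed
  have att: "card attached_darts = 2"
    using attached_darts_ge_2 slice_card_bounds c2 by simp
  obtain w where w: "w \<in> attach" using attach_nonempty by blast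
  have wX: "w \<in> verts X" "w \<notin> {u, v}"
    using w attach_not_slice uv V.subset_\<Omega>(1) by (auto simp: attach_def)
  have star: "{d \<in> darts X. tail X d = x} = leaving X {x}" if x: "x \<in> {u, v}" for x
  proof -
    have xX: "x \<in> verts X" "valence X x = 3" using x uX val by auto
    obtain P where P: "{d \<in> darts X. tail X d = x} = leaving X {x} \<union> P \<union> opp X ` P"
      "valence X x = card (leaving X {x}) + 2 * card P" "finite P"
      "P \<subseteq> {d \<in> darts X. tail X d = x \<and> head X d = x}"
      by (rule leaving_single_parity[OF xX(1)])
    have "card (leaving X {x}) \<ge> 2"
      using admissible_leaving_ge_2[OF adm, of "{x}"] xX wX x by auto
    then have "card P = 0" using P(2) xX(2) by linarith
    then show ?thesis using P by simp
  qed
  let ?Q = "\<lambda>x y. {d \<in> darts X. tail X d = x \<and> head X d = y}"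
  have opp_Q: "?Q v u = opp X ` ?Q u v"
  proof
    show "?Q v u \<subseteq> opp X ` ?Q u v"
    proof
      fix d assume d: "d \<in> ?Q v u"
      then have "opp X d \<in> ?Q u v" using head_tail_iff opp_in_darts[OF graph] by auto
      then have "opp X (opp X d) \<in> opp X ` ?Q u v" by (rule imageI)
      then show "d \<in> opp X ` ?Q u v" using d opp_opp[OF graph] by simp
    qed
    show "opp X ` ?Q u v \<subseteq> ?Q v u" using head_tail_iff opp_in_darts[OF graph] by auto
  qed
  then have cQ: "card (?Q v u) = card (?Q u v)" using card_opp[of "?Q u v"] by auto
  have fQ: "finite (?Q x y)" for x y using finite_X by simp
  have "leaving X slice_verts = (leaving X {u} - ?Q u v) \<union> (leaving X {v} - ?Q v u)"
    using uv by (auto simp: leaving_def)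
  then have "card (leaving X slice_verts) = card ((leaving X {u} - ?Q u v) \<union> (leaving X {v} - ?Q v u))"
    by (rule arg_cong)
  moreover have "card ((leaving X {u} - ?Q u v) \<union> (leaving X {v} - ?Q v u))
      = card (leaving X {u} - ?Q u v) + card (leaving X {v} - ?Q v u)"
    using uv(2)
    by (intro card_Un_disjoint finite_Diff finite_leaving finite_X) (auto simp: leaving_def)
  moreover have "card (leaving X {u} - ?Q u v) = 3 - card (?Q u v)"
    using star[of u] val fQ star_card[OF uX(1)] uv(2)
    by (subst card_Diff_subset) (auto simp: leaving_def)
  moreover have "card (leaving X {v} - ?Q v u) = 3 - card (?Q v u)"
    using star[of v] val fQ star_card[OF uX(2)] uv(2)
    by (subst card_Diff_subset) (auto simp: leaving_def)
  moreover have "card (leaving X slice_verts) = 2"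
  proof -
    obtain P where "attached_darts = opp X ` leaving X slice_verts \<union> P \<union> opp X ` P"
      "card attached_darts = card (leaving X slice_verts) + 2 * card P" "finite P"
      by (rule attached_parity)
    then have "card (leaving X slice_verts) \<le> card attached_darts" by simp
    then show ?thesis using leaving_slice_ge_2 uv att by force
  qed
  \<comment> \<open>If q edges join \<open>u\<close> and \<open>v\<close>, the cut around both has
    (3 - q) + (3 - q) = 2 darts.\<close>
  ultimately have "card (?Q u v) = 2" using cQ by linarith
  then obtain d1 d2 where d12: "?Q u v = {d1, d2}" "d1 \<noteq> d2" by (meson card_2_iff)
  have "card ({d \<in> darts X. tail X d = u} - ?Q u v) = 1"
    using star_card[OF uX(1)] val(1) \<open>card (?Q u v) = 2\<close> fQ by (subst card_Diff_subset) auto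
  then obtain d where d: "{d \<in> darts X. tail X d = u} - ?Q u v = {d}" by (meson card_1_singletonE)
  have "d \<in> darts X" "tail X d = u" "head X d \<noteq> v" using d by auto
  have "d1 \<in> ?Q u v" "d2 \<in> ?Q u v" using d12 by auto
  have "head X d = head X d1"
  proof (rule no_trivalent_digon[OF adm \<open>d \<in> darts X\<close>])
    show "{x \<in> darts X. tail X x = tail X d} = {d, d1, d2}"
      using d d12 \<open>tail X d = u\<close> by blast
    show "distinct [d, d1, d2]" using \<open>d1 \<in> ?Q u v\<close> \<open>d2 \<in> ?Q u v\<close> d12(2) \<open>head X d \<noteq> v\<close> by auto
    show "head X d1 = head X d2" "head X d1 \<noteq> tail X d"
      using \<open>d1 \<in> ?Q u v\<close> \<open>d2 \<in> ?Q u v\<close> \<open>tail X d = u\<close> uv(2) by auto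
  qed
  then show False using \<open>d1 \<in> ?Q u v\<close> \<open>head X d \<noteq> v\<close> by auto
qed

lemma no_slice_verts_cases:
  assumes "slice_verts = {}"
  shows "(\<exists>d. slice_darts = {d, opp X d}) \<or>
    (\<exists>d e. slice_darts = {d, opp X d, e, opp X e} \<and> distinct [d, opp X d, e, opp X e])"
proof -
  obtain P where P: "slice_darts = P \<union> opp X ` P" "P \<inter> opp X ` P = {}"
    "card slice_darts = 2 * card P" "finite P"
    using even_card_opp_closed[OF graph, of slice_darts] slice_darts slice_opp finite_slices by blast
  have "card P \<le> 2" using slice_bound P(3) assms by simp
  moreover have "card P \<noteq> 0" using slice_darts_nonempty P by auto
  ultimately consider "card P = 1" | "card P = 2" by linarith
  then show ?thesis
  proof cases
    case 1
    then obtain d where "P = {d}" by (meson card_1_singletonE)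
    then have "slice_darts = {d, opp X d}" using P by auto
    then show ?thesis by blast
  next
    case 2
    then obtain d e where de: "P = {d, e}" "d \<noteq> e" by (meson card_2_iff)
    then have eq: "slice_darts = {d, opp X d, e, opp X e}" using P(1) by auto
    have dX: "d \<in> darts X" "e \<in> darts X" using slice_darts eq by auto
    have "distinct [d, opp X d, e, opp X e]"
      using de P(2) opp_opp[OF graph dX(1)] opp_opp[OF graph dX(2)] opp_neq[OF graph dX(1)]
        opp_neq[OF graph dX(2)] by auto
    then show ?thesis using eq by blast
  qed
qed

text \<open>Let L be the size of the cut around \<open>v\<close>, p the number of loops at
  \<open>v\<close> and q the number of slice edges between fixed vertices. Then
  \<open>slice_bound\<close> reads 2 L + 2 p + 2 q \<le> 6, while L \<ge> 2 and L + 2 p \<ge> 3.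
  This leaves three legs, or two legs and a loop. Two legs with a common end force the third to end
  there as well, by \<open>no_trivalent_digon\<close>.\<close>

lemma one_slice_vert_cases:
  assumes v: "slice_verts = {v}"
  shows "(\<exists>a b c. slice_darts = {a, b, c} \<union> opp X ` {a, b, c} \<and> distinct [a, b, c] \<and>
      (\<forall>d\<in>{a, b, c}. tail X d = v \<and> head X d \<in> attach) \<and>
      (head X b = head X a \<and> head X c = head X a \<or> distinct [head X a, head X b, head X c])) \<or>
    (\<exists>a b l. slice_darts = {a, b} \<union> opp X ` {a, b} \<union> {l, opp X l} \<and> a \<noteq> b \<and> tail X l = v \<and> head X l = v \<and>
      (\<forall>d\<in>{a, b}. tail X d = v \<and> head X d \<in> attach))"
proof -
  have vX: "v \<in> verts X" using v V.subset_\<Omega>(2) by blast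
  obtain P where P: "{d \<in> darts X. tail X d = v} = leaving X {v} \<union> P \<union> opp X ` P"
    "valence X v = card (leaving X {v}) + 2 * card P" "finite P"
    "P \<subseteq> {d \<in> darts X. tail X d = v \<and> head X d = v}"
    by (rule leaving_single_parity[OF vX])
  obtain Q where "attached_darts = opp X ` leaving X slice_verts \<union> Q \<union> opp X ` Q"
    "card attached_darts = card (leaving X slice_verts) + 2 * card Q" "finite Q"
    by (rule attached_parity)
  note Q = this[unfolded v]
  have sum: "valence X v + card attached_darts \<le> 6"
    using card_slice_darts slice_bound v by simp
  have L2: "card (leaving X {v}) \<ge> 2" using leaving_slice_ge_2 v by simp
  have "card Q = 0" using Q(2) L2 sum P(2) valence_ge_3[OF vX] by linarith
  then have att: "attached_darts = opp X ` leaving X {v}" using Q by simp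
  have slice: "slice_darts = leaving X {v} \<union> opp X ` leaving X {v} \<union> (P \<union> opp X ` P)"
    using slice_star[OF v] P(1) att by blast
  have Lhead: "tail X d = v \<and> head X d \<in> attach" if "d \<in> leaving X {v}" for d
    using that attach_head[of d] star_slice[of d] v by (auto simp: leaving_def)
  have "card (leaving X {v}) = 3 \<and> card P = 0 \<or> card (leaving X {v}) = 2 \<and> card P = 1"
    using L2 sum P(2) valence_ge_3[OF vX] Q(2) by linarith
  then show ?thesis
  proof
    assume "card (leaving X {v}) = 3 \<and> card P = 0"
    then have L: "card (leaving X {v}) = 3" "P = {}" using P(3) by auto
    then obtain a b c where abc: "leaving X {v} = {a, b, c}" "distinct [a, b, c]"
      by (auto simp: card_3_iff)
    have star: "{x \<in> darts X. tail X x = v} = {a, b, c}" using P(1) L abc by simp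
    have X: "a \<in> darts X" "b \<in> darts X" "c \<in> darts X" using star by auto
    have ht: "\<forall>d\<in>{a, b, c}. tail X d = v \<and> head X d \<in> attach" using Lhead abc by blast
    have nv: "head X d \<noteq> v" if "d \<in> {a, b, c}" for d
      using that ht attach_not_slice v by blast
    have digon: "head X x = head X y" if "{x, y, z} = {a, b, c}" "distinct [x, y, z]" "head X y = head X z"
      for x y z
    proof -
      have x: "x \<in> {a, b, c}" "y \<in> {a, b, c}" "z \<in> {a, b, c}" using that(1) by blast+
      then have "x \<in> darts X" "tail X x = v" using X ht by auto
      then show ?thesis
        using no_trivalent_digon[OF adm, of x y z] that star nv[OF x(2)] by simp
    qed
    have 1: "head X b = head X c \<Longrightarrow> head X a = head X b"
      by (rule digon[of a b c]) (use abc(2) in auto)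
    have 2: "head X a = head X c \<Longrightarrow> head X b = head X a"
      by (rule digon[of b a c]) (use abc(2) in auto)
    have 3: "head X a = head X b \<Longrightarrow> head X c = head X a"
      by (rule digon[of c a b]) (use abc(2) in auto)
    have "head X b = head X a \<and> head X c = head X a \<or>
        head X a \<noteq> head X b \<and> head X a \<noteq> head X c \<and> head X b \<noteq> head X c"
      using 1 2 3 by metis
    then have "head X b = head X a \<and> head X c = head X a \<or> distinct [head X a, head X b, head X c]"
      by simp
    moreover have "slice_darts = {a, b, c} \<union> opp X ` {a, b, c}" using slice L abc by simp
    ultimately show ?thesis using abc(2) ht by blast
  next
    assume "card (leaving X {v}) = 2 \<and> card P = 1"
    then obtain a b l where abl: "leaving X {v} = {a, b}" "a \<noteq> b" "P = {l}"
      by (metis card_1_singletonE card_2_iff)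
    moreover have "{l} \<union> opp X ` {l} = {l, opp X l}" by auto
    ultimately have "slice_darts = {a, b} \<union> opp X ` {a, b} \<union> {l, opp X l}"
      using slice by metis
    moreover have "\<forall>d\<in>{a, b}. tail X d = v \<and> head X d \<in> attach" using Lhead abl by blast
    moreover have "tail X l = v" "head X l = v" using P(4) abl(3) by simp_all
    ultimately show ?thesis using abl(2) by blast
  qed
qed

lemma slice_verts_le_1: "slice_verts = {} \<or> (\<exists>v. slice_verts = {v})"
proof -
  have "card slice_verts \<le> 2" using slice_card_bounds attached_darts_ge_2 by linarith
  then have "card slice_verts = 0 \<or> card slice_verts = 1" using card_slice_verts_neq_2 by linarith
  then show ?thesis using finite_slices card_1_singletonE by auto
qed

end

section \<open>Recognizing the models\<close>

text \<open>What all model graphs have in common: no isolated vertices, invariance under the action,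
  and an equivariant labelling of the edges. Both the recognition of a slice and the converse start
  from it.\<close>

definition labelled_graph ::
  "nat \<Rightarrow> (nat \<Rightarrow> nat, 'w, 'e) action \<Rightarrow> ('w, 'e) graph \<Rightarrow> ('e \<Rightarrow> nat) \<Rightarrow> bool" where
  "labelled_graph n \<sigma> T lab \<longleftrightarrow>
     verts T = tail T ` darts T \<and> lab ` darts T = {1..n} \<and>
     (\<forall>e\<in>darts T. opp T e \<in> darts T \<and> lab (opp T e) = lab e) \<and>
     (\<forall>p\<in>alternating {1..n}.
        (\<forall>w\<in>verts T. fst (\<sigma> p) w \<in> verts T) \<and>
        (\<forall>e\<in>darts T. snd (\<sigma> p) e \<in> darts T \<and> lab (snd (\<sigma> p) e) = p (lab e)))"

lemma labelled_graphI:
  assumes "verts T = tail T ` darts T" "lab ` darts T = {1..n}"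
    and "\<And>e. e \<in> darts T \<Longrightarrow> opp T e \<in> darts T"
    and "\<And>e. e \<in> darts T \<Longrightarrow> lab (opp T e) = lab e"
    and "\<And>p w. p \<in> alternating {1..n} \<Longrightarrow> w \<in> verts T \<Longrightarrow> fst (\<sigma> p) w \<in> verts T"
    and "\<And>p e. p \<in> alternating {1..n} \<Longrightarrow> e \<in> darts T \<Longrightarrow> snd (\<sigma> p) e \<in> darts T"
    and "\<And>p e. p \<in> alternating {1..n} \<Longrightarrow> e \<in> darts T \<Longrightarrow> lab (snd (\<sigma> p) e) = p (lab e)"
  shows "labelled_graph n \<sigma> T lab"
  using assms by (simp add: labelled_graph_def)

lemma labelled_graphD:
  assumes "labelled_graph n \<sigma> T lab"
  shows "verts T = tail T ` darts T" "lab ` darts T = {1..n}"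
    and "\<And>e. e \<in> darts T \<Longrightarrow> opp T e \<in> darts T"
    and "\<And>e. e \<in> darts T \<Longrightarrow> lab (opp T e) = lab e"
    and "\<And>p w. p \<in> alternating {1..n} \<Longrightarrow> w \<in> verts T \<Longrightarrow> fst (\<sigma> p) w \<in> verts T"
    and "\<And>p e. p \<in> alternating {1..n} \<Longrightarrow> e \<in> darts T \<Longrightarrow> snd (\<sigma> p) e \<in> darts T"
    and "\<And>p e. p \<in> alternating {1..n} \<Longrightarrow> e \<in> darts T \<Longrightarrow> lab (snd (\<sigma> p) e) = p (lab e)"
  using assms by (auto simp: labelled_graph_def)

lemma alternating_in: "p \<in> alternating S \<Longrightarrow> p i \<in> S \<longleftrightarrow> i \<in> S"
  by (simp add: alternating_def permutes_in_image)

lemma alternating_interval: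
  assumes "p \<in> alternating {1..n}"
  shows "Suc 0 \<le> i \<Longrightarrow> i \<le> n \<Longrightarrow> Suc 0 \<le> p i" "Suc 0 \<le> i \<Longrightarrow> i \<le> n \<Longrightarrow> p i \<le> n"
    "1 \<le> i \<Longrightarrow> i \<le> n \<Longrightarrow> 1 \<le> p i"
  using alternating_in[OF assms, of i] by auto

section \<open>Labellings of the model graphs\<close>

lemma labelled_rose: "labelled_graph n permute_edges (rose n) fst" if "n \<ge> 1"
  using that by (auto simp: labelled_graph_def rose_def permute_edges_def alternating_interval)

lemma labelled_cage: "labelled_graph n permute_edges (cage n) fst" if "n \<ge> 1"
proof -
  have "(1, b) \<in> {1..n} \<times> UNIV" for b :: bool using that by simp
  then have "b \<in> snd ` ({1..n} \<times> UNIV)" for b :: bool by (metis image_eqI snd_conv)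
  then show ?thesis
    using that by (auto simp: labelled_graph_def cage_def permute_edges_def alternating_interval)
qed

text \<open>The edges i and n + i share the label i: both belong to the same slice.\<close>

lemma labelled_cage_twice:
  assumes "n \<ge> 1"
  shows "labelled_graph n (permute_edges_twice n) (cage (2 * n)) (\<lambda>(i, b). if i \<le> n then i else i - n)"
proof (rule labelled_graphI)
  have p: "1 \<le> p i \<and> p i \<le> n" if "p \<in> alternating {1..n}" "1 \<le> i" "i \<le> n" for p i
    using alternating_in[OF that(1), of i] that by simp
  have q: "1 \<le> p (i - n) \<and> p (i - n) \<le> n" if "p \<in> alternating {1..n}" "\<not> i \<le> n" "i \<le> 2 * n" for p i
    using p[OF that(1), of "i - n"] that by simp
  show "verts (cage (2 * n)) = tail (cage (2 * n)) ` darts (cage (2 * n))"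
    using assms by (simp add: cage_def snd_image_times)
  show "(\<lambda>(i, b). if i \<le> n then i else i - n) ` darts (cage (2 * n)) = {1..n}"
  proof
    show "{1..n} \<subseteq> (\<lambda>(i, b). if i \<le> n then i else i - n) ` darts (cage (2 * n))"
    proof
      fix i assume "i \<in> {1..n}"
      then show "i \<in> (\<lambda>(i, b). if i \<le> n then i else i - n) ` darts (cage (2 * n))"
        by (intro image_eqI[where x = "(i, False)"]) (auto simp: cage_def)
    qed
  qed (auto simp: cage_def)
  fix p e assume pe: "p \<in> alternating {1..n}" "e \<in> darts (cage (2 * n))"
  obtain i b where e: "e = (i, b)" "1 \<le> i" "i \<le> 2 * n" using pe(2) by (auto simp: cage_def)
  show "snd (permute_edges_twice n p) e \<in> darts (cage (2 * n))"
    using p[OF pe(1), of i] q[OF pe(1), of i] e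
    by (cases "i \<le> n") (simp_all add: cage_def permute_edges_def permute_edges_twice_def)
  show "(\<lambda>(i, b). if i \<le> n then i else i - n) (snd (permute_edges_twice n p) e)
      = p ((\<lambda>(i, b). if i \<le> n then i else i - n) e)"
    using p[OF pe(1), of i] q[OF pe(1), of i] e
    by (cases "i \<le> n") (simp_all add: permute_edges_def permute_edges_twice_def)
qed (auto simp: cage_def)

lemma labelled_disjoint_union:
  assumes "labelled_graph n \<sigma> T lab" "labelled_graph n \<tau> U lab'"
  shows "labelled_graph n (diagonal \<sigma> \<tau>) (disjoint_union T U) (case_sum lab lab')"
proof (rule labelled_graphI)
  note T = labelled_graphD[OF assms(1)] and U = labelled_graphD[OF assms(2)]
  show "verts (disjoint_union T U) = tail (disjoint_union T U) ` darts (disjoint_union T U)"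
    by (simp add: disjoint_union_def T(1) U(1) Plus_def image_Un image_image)
  show "case_sum lab lab' ` darts (disjoint_union T U) = {1..n}"
    by (simp add: disjoint_union_def Plus_def image_Un image_image T(2) U(2))
qed (use labelled_graphD[OF assms(1)] labelled_graphD[OF assms(2)] in
    \<open>auto simp: disjoint_union_def diagonal_def\<close>)

text \<open>By \<open>base\<close> and \<open>inj\<close> no vertex other than \<open>y\<close> is
  sent to \<open>y\<close>, so the action commutes with the identification of the base
  points.\<close>

lemma labelled_wedge:
  assumes "labelled_graph n \<sigma> T lab" "labelled_graph n \<tau> U lab'" "x \<in> verts T" "y \<in> verts U"
    and base: "\<And>p. p \<in> alternating {1..n} \<Longrightarrow> fst (\<sigma> p) x = x \<and> fst (\<tau> p) y = y"
    and inj: "\<And>p. p \<in> alternating {1..n} \<Longrightarrow> inj_on (fst (\<tau> p)) (verts U)"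
  shows "labelled_graph n (diagonal \<sigma> \<tau>) (wedge T x U y) (case_sum lab lab')"
proof (rule labelled_graphI)
  note D = labelled_graphD[OF labelled_disjoint_union[OF assms(1,2)]]
  let ?q = "\<lambda>v. if v = Inr y then Inl x else v"
  let ?D = "disjoint_union T U"
  have W: "wedge T x U y = ?D\<lparr>verts := ?q ` verts ?D, tail := \<lambda>d. ?q (tail ?D d)\<rparr>"
    by (simp add: wedge_def Let_def)
  show "fst (diagonal \<sigma> \<tau> p) v \<in> verts (wedge T x U y)"
    if p: "p \<in> alternating {1..n}" and v: "v \<in> verts (wedge T x U y)" for p v
  proof -
    obtain w where w: "w \<in> verts ?D" "v = ?q w" using v W by auto
    have "fst (diagonal \<sigma> \<tau> p) (?q w) = ?q (fst (diagonal \<sigma> \<tau> p) w)"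
      using base[OF p] inj[OF p] w(1) assms(4)
      by (cases w) (auto simp: diagonal_def disjoint_union_def inj_on_def)
    moreover have "fst (diagonal \<sigma> \<tau> p) w \<in> verts ?D" using D(5) p w(1) by blast
    ultimately show ?thesis unfolding W w(2) by simp
  qed
  show "verts (wedge T x U y) = tail (wedge T x U y) ` darts (wedge T x U y)"
    by (auto simp: W D(1))
  show "case_sum lab lab' ` darts (wedge T x U y) = {1..n}" unfolding W using D(2) by simp
  show "opp (wedge T x U y) e \<in> darts (wedge T x U y)" if "e \<in> darts (wedge T x U y)" for e
    using that D(3) unfolding W by simp
  show "case_sum lab lab' (opp (wedge T x U y) e) = case_sum lab lab' e"
    if "e \<in> darts (wedge T x U y)" for e
    using that D(4) unfolding W by simp
  fix p e assume pe: "p \<in> alternating {1..n}" "e \<in> darts (wedge T x U y)"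
  show "snd (diagonal \<sigma> \<tau> p) e \<in> darts (wedge T x U y)"
    using pe D(6) unfolding W by simp
  show "case_sum lab lab' (snd (diagonal \<sigma> \<tau> p) e) = p (case_sum lab lab' e)"
    using pe D(7) unfolding W by simp
qed

definition loop_label :: "('d \<Rightarrow> nat) \<Rightarrow> 'd loop_dart \<Rightarrow> nat" where
  "loop_label lab a = (case a of To_Mid d \<Rightarrow> lab d | From_Mid d \<Rightarrow> lab d | Mid_Loop d \<Rightarrow> lab d)"

lemma labelled_with_loops:
  assumes T: "labelled_graph n \<sigma> T lab"
    and opp: "\<And>p e. p \<in> alternating {1..n} \<Longrightarrow> e \<in> darts T \<Longrightarrow> opp T (snd (\<sigma> p) e) = snd (\<sigma> p) (opp T e)"
  shows "labelled_graph n (with_loops_action \<sigma>) (with_loops T) (loop_label lab)"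
proof (rule labelled_graphI)
  note D = labelled_graphD[OF T]
  have E: "snd (\<sigma> p) ` edge T e \<in> edge T ` darts T" if "p \<in> alternating {1..n}" "e \<in> darts T" for p e
  proof -
    have "snd (\<sigma> p) ` edge T e = edge T (snd (\<sigma> p) e)" using opp that by (simp add: edge_def)
    then show ?thesis using D(6) that by simp
  qed
  show "verts (with_loops T) = tail (with_loops T) ` darts (with_loops T)"
    by (auto simp: with_loops_def image_Un image_image D(1))
  show "loop_label lab ` darts (with_loops T) = {1..n}"
    by (simp add: with_loops_def image_Un image_image loop_label_def D(2))
  show "fst (with_loops_action \<sigma> p) w \<in> verts (with_loops T)"
    if "p \<in> alternating {1..n}" "w \<in> verts (with_loops T)" for p w
    using that E D(5) by (auto simp: with_loops_def with_loops_action_def)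
qed (use labelled_graphD[OF T] in
    \<open>auto simp: with_loops_def with_loops_action_def loop_label_def\<close>)

lemma labelled_bipartite:
  assumes "n \<ge> 1"
  shows "labelled_graph n permute_right (complete_bipartite 3 n) (\<lambda>((j, i), b). i)"
proof (rule labelled_graphI)
  let ?T = "complete_bipartite 3 n"
  show "verts ?T = tail ?T ` darts ?T"
  proof
    show "verts ?T \<subseteq> tail ?T ` darts ?T"
    proof
      fix w :: "nat + nat" assume "w \<in> verts ?T"
      then consider j where "w = Inl j" "j \<in> {1..3}" | i where "w = Inr i" "i \<in> {1..n}"
        by (auto simp: complete_bipartite_def)
      then show "w \<in> tail ?T ` darts ?T"
      proof cases
        case 1
        then show ?thesis
          using assms by (intro image_eqI[where x = "((j, 1), False)"]) (auto simp: complete_bipartite_def)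
      next
        case 2
        then show ?thesis
          by (intro image_eqI[where x = "((1, i), True)"]) (auto simp: complete_bipartite_def)
      qed
    qed
  qed (auto simp: complete_bipartite_def)
  show "(\<lambda>((j, i), b). i) ` darts ?T = {1..n}"
  proof
    show "{1..n} \<subseteq> (\<lambda>((j, i), b). i) ` darts ?T"
    proof
      fix i assume "i \<in> {1..n}"
      then show "i \<in> (\<lambda>((j, i), b). i) ` darts ?T"
        by (intro image_eqI[where x = "((1, i), False)"]) (auto simp: complete_bipartite_def)
    qed
  qed (auto simp: complete_bipartite_def)
qed (auto simp: complete_bipartite_def permute_right_def alternating_interval)

lemma labelled_wedge_copies:
  assumes "n \<ge> 1"
  shows "labelled_graph n permute_copies (wedge_copies n (cage 3) False) fst"
proof (rule labelled_graphI)
  let ?T = "wedge_copies n (cage 3) False"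
  show "verts ?T = tail ?T ` darts ?T"
  proof
    show "verts ?T \<subseteq> tail ?T ` darts ?T"
    proof
      fix w assume "w \<in> verts ?T"
      then consider "w = None" | i where "w = Some (i, True)" "i \<in> {1..n}"
        by (auto simp: wedge_copies_def split: if_splits)
      then show "w \<in> tail ?T ` darts ?T"
      proof cases
        case 1
        then show ?thesis
          using assms by (intro image_eqI[where x = "(1, (1, False))"]) (auto simp: wedge_copies_def cage_def)
      next
        case 2
        then show ?thesis
          by (intro image_eqI[where x = "(i, (1, True))"]) (auto simp: wedge_copies_def cage_def)
      qed
    qed
  qed (auto simp: wedge_copies_def cage_def)
  show "fst ` darts ?T = {1..n}"
    by (simp add: wedge_copies_def cage_def fst_image_times)
  show "fst (permute_copies p) w \<in> verts ?T" if "p \<in> alternating {1..n}" "w \<in> verts ?T" for p w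
    using that by (auto simp: wedge_copies_def cage_def permute_copies_def alternating_interval image_iff
        split: if_splits)
qed (auto simp: wedge_copies_def cage_def permute_copies_def alternating_interval)

text \<open>Formulas are available for maps from the model to \<open>Y\<close>, while the definition
  asks for maps from \<open>Y\<close> to the model.\<close>

lemma equivariantly_isomorphicI:
  assumes f: "bij_betw f (verts T) (verts Y)" and g: "bij_betw g (darts T) (darts Y)"
    and T: "\<And>e. e \<in> darts T \<Longrightarrow> tail T e \<in> verts T \<and> opp T e \<in> darts T"
    and compat: "\<And>e. e \<in> darts T \<Longrightarrow> tail Y (g e) = f (tail T e) \<and> opp Y (g e) = g (opp T e)"
    and fe: "\<And>p w. p \<in> carrier G \<Longrightarrow> w \<in> verts T \<Longrightarrow>
      fst (\<sigma> p) w \<in> verts T \<and> fst (\<rho> p) (f w) = f (fst (\<sigma> p) w)"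
    and ge: "\<And>p e. p \<in> carrier G \<Longrightarrow> e \<in> darts T \<Longrightarrow>
      snd (\<sigma> p) e \<in> darts T \<and> snd (\<rho> p) (g e) = g (snd (\<sigma> p) e)"
  shows "equivariantly_isomorphic G Y \<rho> T \<sigma>"
  unfolding equivariantly_isomorphic_def
proof (intro exI conjI ballI)
  let ?f = "inv_into (verts T) f" and ?g = "inv_into (darts T) g"
  have fi: "?f (f w) = w" if "w \<in> verts T" for w using f that by (simp add: bij_betw_def)
  have gi: "?g (g e) = e" if "e \<in> darts T" for e using g that by (simp add: bij_betw_def)
  have fY: "\<exists>w\<in>verts T. v = f w" if "v \<in> verts Y" for v using f that by (auto simp: bij_betw_def)
  have gY: "\<exists>e\<in>darts T. d = g e" if "d \<in> darts Y" for d using g that by (auto simp: bij_betw_def)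
  show "bij_betw ?f (verts Y) (verts T)" using f by (rule bij_betw_inv_into)
  show "bij_betw ?g (darts Y) (darts T)" using g by (rule bij_betw_inv_into)
  show "tail T (?g d) = ?f (tail Y d)" "opp T (?g d) = ?g (opp Y d)" if "d \<in> darts Y" for d
    using gY[OF that] fi gi T compat by auto
  show "?f (fst (\<rho> p) v) = fst (\<sigma> p) (?f v)" if "p \<in> carrier G" "v \<in> verts Y" for p v
    using fY[OF that(2)] fe[OF that(1)] fi by auto
  show "?g (snd (\<rho> p) d) = snd (\<sigma> p) (?g d)" if "p \<in> carrier G" "d \<in> darts Y" for p d
    using gY[OF that(2)] ge[OF that(1)] gi by auto
qed

lemma (in graph_action) moved_subgraph_eq:
  "moved_subgraph (alt_group n) \<rho> X = X\<lparr>verts := tail X ` {d \<in> darts X. D.stab d \<noteq> alternating {1..n}},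
     darts := {d \<in> darts X. D.stab d \<noteq> alternating {1..n}}\<rparr>"
proof -
  have "{d \<in> darts X. card (edge_orbit (alt_group n) \<rho> X d) > 1} = {d \<in> darts X. D.stab d \<noteq> alternating {1..n}}"
    using card_edge_orbit_gt_1_iff by blast
  then show ?thesis by (simp add: moved_subgraph_def Let_def)
qed

context small_graph
begin

lemma moved_subgraph: "moved_subgraph (alt_group n) \<rho> X =
    X\<lparr>verts := tail X ` (darts X - D.fixed), darts := darts X - D.fixed\<rparr>"
proof -
  have "{d \<in> darts X. D.stab d \<noteq> alternating {1..n}} = darts X - D.fixed" by (auto simp: D.fixed_def)
  then show ?thesis by (simp add: moved_subgraph_eq)
qed

text \<open>
  A dart \<open>e\<close> of the model is sent to the dart with label \<open>lab e\<close> in the orbit of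
  \<open>rep e\<close>, and similarly for vertices, where the label of a fixed vertex is irrelevant.
\<close>

lemma slice_isomorphism:
  fixes T :: "('w, 'e) graph"
  assumes T: "labelled_graph n \<sigma> T lab"
    and inj: "inj_on (\<lambda>e. (lab e, rep e)) (darts T)"
    and rep: "\<And>e. e \<in> darts T \<Longrightarrow> rep e \<in> slice_darts"
    and surj: "\<And>i d. i \<in> {1..n} \<Longrightarrow> d \<in> slice_darts \<Longrightarrow> \<exists>e\<in>darts T. lab e = i \<and> rep e = d"
    and inj_v: "\<And>w w'. w \<in> verts T \<Longrightarrow> w' \<in> verts T \<Longrightarrow> vr w = vr w' \<Longrightarrow>
      (vr w \<in> slice_verts \<Longrightarrow> vl w = vl w') \<Longrightarrow> w = w'"
    and tail: "\<And>e. e \<in> darts T \<Longrightarrow> vr (tail T e) = tail X (rep e) \<and>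
      (vr (tail T e) \<in> slice_verts \<longrightarrow> vl (tail T e) = lab e)"
    and opp: "\<And>e. e \<in> darts T \<Longrightarrow> rep (opp T e) = opp X (rep e)"
    and eqv: "\<And>p e. p \<in> alternating {1..n} \<Longrightarrow> e \<in> darts T \<Longrightarrow> rep (snd (\<sigma> p) e) = rep e"
    and eqv_v: "\<And>p w. p \<in> alternating {1..n} \<Longrightarrow> w \<in> verts T \<Longrightarrow> vr (fst (\<sigma> p) w) = vr w \<and>
      (vr w \<in> slice_verts \<longrightarrow> vl (fst (\<sigma> p) w) = p (vl w))"
  shows "equivariantly_isomorphic (alt_group n) (moved_subgraph (alt_group n) \<rho> X) \<rho> T \<sigma>"
proof -
  define g where "g e = D.mv (lab e) (rep e)" for e
  \<comment> \<open>On \<open>attach\<close> every \<open>V.mv i\<close> is the identity, so 1 is a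
    mere default.\<close>
  define f where "f w = V.mv (if vr w \<in> slice_verts then vl w else 1) (vr w)" for w
  have vT: "verts T = tail T ` darts T" and labT: "lab ` darts T = {1..n}"
    and oppT: "\<And>e. e \<in> darts T \<Longrightarrow> opp T e \<in> darts T \<and> lab (opp T e) = lab e"
    and actT: "\<And>p w. p \<in> alternating {1..n} \<Longrightarrow> w \<in> verts T \<Longrightarrow> fst (\<sigma> p) w \<in> verts T"
      "\<And>p e. p \<in> alternating {1..n} \<Longrightarrow> e \<in> darts T \<Longrightarrow>
        snd (\<sigma> p) e \<in> darts T \<and> lab (snd (\<sigma> p) e) = p (lab e)"
    using T by (auto simp: labelled_graph_def)
  have lab: "lab e \<in> {1..n}" if "e \<in> darts T" for e using labT that by blast
  have vr: "vr w \<in> attach \<union> slice_verts" "vr w \<in> slice_verts \<Longrightarrow> vl w \<in> {1..n}"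
    if w: "w \<in> verts T" for w
  proof -
    obtain e where e: "e \<in> darts T" "w = tail T e" using w vT by blast
    show "vr w \<in> attach \<union> slice_verts" using tail[OF e(1)] attach_tail[OF rep[OF e(1)]] e(2) by auto
    show "vl w \<in> {1..n}" if "vr w \<in> slice_verts" using tail[OF e(1)] lab[OF e(1)] e(2) that by simp
  qed
  have f_slice: "f w = V.mv (vl w) (vr w)" if "vr w \<in> slice_verts" for w using that by (simp add: f_def)
  have f_attach: "f w = vr w" if "vr w \<in> attach" for w
    using that attach_not_slice[OF that] V.mv_fixed one_in by (simp add: f_def attach_def)
  have "bij_betw (\<lambda>e. (lab e, rep e)) (darts T) ({1..n} \<times> slice_darts)"
    unfolding bij_betw_def
  proof
    show "(\<lambda>e. (lab e, rep e)) ` darts T = {1..n} \<times> slice_darts"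
      using lab rep surj by (auto simp: image_iff) metis
  qed (rule inj)
  from bij_betw_trans[OF this D.bij_betw_mv]
  have bg: "bij_betw g (darts T) (darts X - D.fixed)"
    by (rule bij_betw_cong[THEN iffD1, rotated]) (simp add: g_def)
  have tail_g: "tail X (g e) = f (tail T e)" if e: "e \<in> darts T" for e
  proof -
    have "tail X (g e) = V.mv (lab e) (vr (tail T e))"
      unfolding g_def using tail_mv[OF lab[OF e]] slice_darts[OF rep[OF e]] tail[OF e] by simp
    also have "\<dots> = f (tail T e)"
    proof (cases "vr (tail T e) \<in> slice_verts")
      case True
      then show ?thesis using f_slice tail[OF e] by simp
    next
      case False
      then have "vr (tail T e) \<in> attach" using vr(1) vT e by blast
      then show ?thesis using f_attach V.mv_fixed[OF lab[OF e]] by (simp add: attach_def)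
    qed
    finally show ?thesis .
  qed
  have opp_g: "opp X (g e) = g (opp T e)" if e: "e \<in> darts T" for e
    unfolding g_def using opp_mv[OF lab[OF e]] slice_darts[OF rep[OF e]] opp[OF e] oppT[OF e] by simp
  have mv_slice: "V.mv i v \<notin> attach" if "i \<in> {1..n}" "v \<in> slice_verts" for i v
    using V.slice_fixed_disjoint[OF that(1) V.mv_slice[OF that]] by (simp add: attach_def)
  have inj_f: "w = w'" if w: "w \<in> verts T" "w' \<in> verts T" "f w = f w'" for w w'
  proof -
    consider "vr w \<in> attach" "vr w' \<in> attach" | "vr w \<in> attach" "vr w' \<in> slice_verts"
      | "vr w \<in> slice_verts" "vr w' \<in> attach" | "vr w \<in> slice_verts" "vr w' \<in> slice_verts"
      using vr(1) w(1,2) by blast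
    then show ?thesis
    proof cases
      case 1
      then show ?thesis using inj_v[OF w(1,2)] f_attach w(3) attach_not_slice by metis
    next
      case 2
      then show ?thesis using f_attach f_slice mv_slice vr(2)[OF w(2)] w(3) by metis
    next
      case 3
      then show ?thesis using f_attach f_slice mv_slice vr(2)[OF w(1)] w(3) by metis
    next
      case 4
      then have "vl w = vl w' \<and> vr w = vr w'"
        using V.mv_eq_iff vr(2)[OF w(1)] vr(2)[OF w(2)] f_slice w(3) by simp
      then show ?thesis using inj_v[OF w(1,2)] by blast
    qed
  qed
  have bf: "bij_betw f (verts T) (tail X ` (darts X - D.fixed))"
    unfolding bij_betw_def
  proof
    show "inj_on f (verts T)" using inj_f by (rule inj_onI)
    have "f ` verts T = (\<lambda>e. tail X (g e)) ` darts T"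
      unfolding vT image_image using tail_g by (intro image_cong) simp_all
    also have "\<dots> = tail X ` g ` darts T" by (simp add: image_image)
    finally show "f ` verts T = tail X ` (darts X - D.fixed)" using bg by (simp add: bij_betw_def)
  qed
  show ?thesis
    unfolding moved_subgraph
  proof (rule equivariantly_isomorphicI)
    show "bij_betw f (verts T) (verts (X\<lparr>verts := tail X ` (darts X - D.fixed), darts := darts X - D.fixed\<rparr>))"
      using bf by simp
    show "bij_betw g (darts T) (darts (X\<lparr>verts := tail X ` (darts X - D.fixed), darts := darts X - D.fixed\<rparr>))"
      using bg by simp
    show "tail T e \<in> verts T \<and> opp T e \<in> darts T" if "e \<in> darts T" for e
      using that vT oppT by blast
    show "tail (X\<lparr>verts := tail X ` (darts X - D.fixed), darts := darts X - D.fixed\<rparr>) (g e) = f (tail T e) \<and>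
        opp (X\<lparr>verts := tail X ` (darts X - D.fixed), darts := darts X - D.fixed\<rparr>) (g e) = g (opp T e)"
      if "e \<in> darts T" for e
      using tail_g[OF that] opp_g[OF that] by simp
    show "fst (\<sigma> p) w \<in> verts T \<and> va p (f w) = f (fst (\<sigma> p) w)"
      if p: "p \<in> carrier (alt_group n)" and w: "w \<in> verts T" for p w
    proof -
      have p: "p \<in> alternating {1..n}" using p by (simp add: carrier_alt_group)
      have "va p (f w) = f (fst (\<sigma> p) w)"
      proof (cases "vr w \<in> slice_verts")
        case True
        then show ?thesis
          using f_slice eqv_v[OF p w] V.act_mv[OF p vr(2)[OF w]] by simp
      next
        case False
        then have "vr w \<in> attach" using vr(1)[OF w] by blast
        then show ?thesis using f_attach eqv_v[OF p w] V.act_fixed[OF p] by (simp add: attach_def)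
      qed
      then show ?thesis using actT(1)[OF p w] by blast
    qed
    show "snd (\<sigma> p) e \<in> darts T \<and> da p (g e) = g (snd (\<sigma> p) e)"
      if p: "p \<in> carrier (alt_group n)" and e: "e \<in> darts T" for p e
    proof -
      have p: "p \<in> alternating {1..n}" using p by (simp add: carrier_alt_group)
      show ?thesis
        unfolding g_def using actT(2)[OF p e] eqv[OF p e] D.act_mv[OF p lab[OF e]] rep[OF e] by simp
    qed
  qed
qed

end

text \<open>Indexes the two darts of an edge by the Boolean in the model darts
  \<open>(i, b)\<close>, with \<open>False\<close> for \<open>d\<close> itself.\<close>

definition half :: "('v, 'd) graph \<Rightarrow> 'd \<Rightarrow> bool \<Rightarrow> 'd" where
  "half X d b = (if b then opp X d else d)"

lemma opp_half: "is_graph X \<Longrightarrow> d \<in> darts X \<Longrightarrow> opp X (half X d b) = half X d (\<not> b)"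
  by (simp add: half_def opp_opp)

lemma tail_half: "tail X (half X d b) = (if b then head X d else tail X d)"
  by (simp add: half_def head_def)

lemma half_eq_iff: "is_graph X \<Longrightarrow> d \<in> darts X \<Longrightarrow> half X d b = half X d c \<longleftrightarrow> b = c"
  using opp_neq[of X d] by (auto simp: half_def)

lemma range_half: "{d, opp X d} = range (half X d)"
  by (auto simp: half_def UNIV_bool)

section \<open>Slices without moved vertices\<close>

context small_graph
begin

abbreviation "Y \<equiv> moved_subgraph (alt_group n) \<rho> X"

lemma n_ge_1: "n \<ge> 1" using n by simp

lemma attach_no_slice_verts: "slice_verts = {} \<Longrightarrow> attach = tail X ` slice_darts"
  using attach_tail by (auto simp: attach_def)

lemma rose_iso:
  assumes V: "slice_verts = {}" and D: "slice_darts = {d, opp X d}" and loop: "head X d = tail X d"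
  shows "equivariantly_isomorphic (alt_group n) Y \<rho> (rose n) permute_edges"
proof -
  have dX: "d \<in> darts X" using D slice_darts by blast
  note half = opp_half[OF graph dX] half_eq_iff[OF graph dX] tail_half
  have D': "slice_darts = range (half X d)" using D range_half by metis
  show ?thesis
  proof (rule slice_isomorphism[OF labelled_rose[OF n_ge_1],
        where rep = "\<lambda>(i, b). half X d b" and vr = "\<lambda>_. tail X d" and vl = "\<lambda>_. 0"])
    show "\<exists>e\<in>darts (rose n). fst e = i \<and> (case e of (i, b) \<Rightarrow> half X d b) = x"
      if "i \<in> {1..n}" "x \<in> slice_darts" for i x
      using that by (auto simp: rose_def D' image_iff)
  qed (auto simp: V D' half loop rose_def permute_edges_def inj_on_def)
qed

lemma cage_iso:
  assumes V: "slice_verts = {}" and D: "slice_darts = {d, opp X d}" and edge: "head X d \<noteq> tail X d"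
  shows "equivariantly_isomorphic (alt_group n) Y \<rho> (cage n) permute_edges"
proof -
  have dX: "d \<in> darts X" using D slice_darts by blast
  note half = opp_half[OF graph dX] half_eq_iff[OF graph dX] tail_half
  have D': "slice_darts = range (half X d)" using D range_half by metis
  show ?thesis
  proof (rule slice_isomorphism[OF labelled_cage[OF n_ge_1], where rep = "\<lambda>(i, b). half X d b"
        and vr = "\<lambda>b. if b then head X d else tail X d" and vl = "\<lambda>_. 0"])
    show "\<exists>e\<in>darts (cage n). fst e = i \<and> (case e of (i, b) \<Rightarrow> half X d b) = x"
      if "i \<in> {1..n}" "x \<in> slice_darts" for i x
      using that by (auto simp: cage_def D' image_iff)
  qed (use edge in \<open>auto simp: V D' half cage_def permute_edges_def inj_on_def split: if_splits\<close>)
qed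

end

locale two_edges = small_graph n X \<rho>
  for n :: nat and X :: "('v, 'd) graph" and \<rho> :: "(nat \<Rightarrow> nat, 'v, 'd) action" +
  fixes d e :: 'd
  assumes no_slice_verts: "slice_verts = {}"
    and slice: "slice_darts = {d, opp X d, e, opp X e}"
    and distinct: "distinct [d, opp X d, e, opp X e]"
begin

lemma dX: "d \<in> darts X" "e \<in> darts X"
  using slice slice_darts by auto

lemmas half = opp_half[OF graph dX(1)] opp_half[OF graph dX(2)]
  half_eq_iff[OF graph dX(1)] half_eq_iff[OF graph dX(2)] tail_half

lemma half_neq: "half X d b \<noteq> half X e c" "half X e c \<noteq> half X d b"
  using distinct by (auto simp: half_def)

lemma slice_half: "slice_darts = range (half X d) \<union> range (half X e)"
  using slice range_half[of d X] range_half[of e X] by auto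

lemma attach_two: "attach = {tail X d, head X d, tail X e, head X e}"
  unfolding attach_no_slice_verts[OF no_slice_verts] slice by (auto simp: head_def)

lemma card_slice: "card slice_darts = 4"
  unfolding slice using distinct by simp

text \<open>With \<open>reverse\<close>, this generates all ways to name and orient the two edges,
  so each configuration needs to be recognized in one position only.\<close>

lemma swap: "two_edges n X \<rho> e d"
  using no_slice_verts slice distinct by unfold_locales auto

lemma reverse: "two_edges n X \<rho> (opp X d) e"
  using no_slice_verts slice distinct opp_opp[OF graph dX(1)] by unfold_locales auto

text \<open>In other words, the genus is at least 2 n + 1 - \<open>card attach\<close>: the
  thresholds 2 n, 2 n - 1 and 2 n - 2 belong to one, two and three points of
  \<open>attach\<close>.\<close>

lemma genus_two: "4 * n + 2 \<le> 2 * genus X + 2 * card attach"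
  using genus_attach card_slice no_slice_verts by simp

text \<open>The fixed edges that join the two parts raise the bound by 2, to 2 n + 3 -
  \<open>card attach\<close>.\<close>

lemma genus_two_disconnected:
  assumes "{tail X d, head X d} \<inter> {tail X e, head X e} = {}"
  shows "4 * n + 6 \<le> 2 * genus X + 2 * card attach"
proof -
  have "n * card slice_darts + 6 \<le> 2 * genus X + 2 * card attach"
  proof (rule genus_attach_disconnected[OF no_slice_verts _ assms])
    show "attach = {tail X d, head X d} \<union> {tail X e, head X e}" using attach_two by auto
    show "head X x \<in> {tail X d, head X d}" if "x \<in> slice_darts" "tail X x \<in> {tail X d, head X d}" for x
      using that assms dX head_tail_iff unfolding slice by auto
  qed auto
  then show ?thesis using card_slice by simp
qed

lemma surj_sum:
  assumes "x \<in> slice_darts"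
  shows "(\<exists>b. x = half X d b) \<or> (\<exists>b. x = half X e b)"
  using assms slice_half by auto

lemma sum_cases:
  assumes "i \<in> {1..n}" "x \<in> slice_darts"
  shows "\<exists>a\<in>({1..n} \<times> UNIV) <+> ({1..n} \<times> UNIV). case_sum fst fst a = i \<and>
    case_sum (\<lambda>(i, b). half X d b) (\<lambda>(i, b). half X e b) a = x"
  using surj_sum[OF assms(2)]
proof (elim disjE exE)
  show ?thesis if "x = half X d b" for b
    using that assms(1) by (intro bexI[of _ "Inl (i, b)"]) auto
  show ?thesis if "x = half X e b" for b
    using that assms(1) by (intro bexI[of _ "Inr (i, b)"]) auto
qed

lemma wedge_roses_iso:
  assumes "head X d = tail X d" "head X e = tail X e" "tail X e = tail X d"
  shows "equivariantly_isomorphic (alt_group n) Y \<rho>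
    (wedge (rose n) () (rose n) ()) (diagonal permute_edges permute_edges)"
proof (rule slice_isomorphism[where lab = "case_sum fst fst" and vl = "\<lambda>_. 0"
      and rep = "case_sum (\<lambda>(i, b). half X d b) (\<lambda>(i, b). half X e b)" and vr = "\<lambda>_. tail X d"])
  show "labelled_graph n (diagonal permute_edges permute_edges) (wedge (rose n) () (rose n) ()) (case_sum fst fst)"
    by (intro labelled_wedge labelled_rose n_ge_1) (auto simp: rose_def permute_edges_def)
qed (use sum_cases assms no_slice_verts half_neq slice_half in
    \<open>auto simp: wedge_def disjoint_union_def rose_def Let_def diagonal_def permute_edges_def inj_on_def half
      split: if_splits sum.splits\<close>)

lemma wedge_cage_rose_iso:
  assumes "head X d \<noteq> tail X d" "head X e = tail X e" "tail X e = tail X d"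
  shows "equivariantly_isomorphic (alt_group n) Y \<rho>
    (wedge (cage n) False (rose n) ()) (diagonal permute_edges permute_edges)"
proof (rule slice_isomorphism[where lab = "case_sum fst fst" and vl = "\<lambda>_. 0"
      and rep = "case_sum (\<lambda>(i, b). half X d b) (\<lambda>(i, b). half X e b)"
      and vr = "case_sum (\<lambda>b. if b then head X d else tail X d) (\<lambda>_. tail X e)"])
  show "labelled_graph n (diagonal permute_edges permute_edges) (wedge (cage n) False (rose n) ()) (case_sum fst fst)"
    by (intro labelled_wedge labelled_rose labelled_cage n_ge_1) (auto simp: rose_def cage_def permute_edges_def)
qed (use sum_cases assms no_slice_verts half_neq slice_half in
    \<open>auto simp: wedge_def disjoint_union_def rose_def cage_def Let_def diagonal_def permute_edges_def inj_on_def half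
      split: if_splits sum.splits\<close>)

lemma disjoint_rose_cage_iso:
  assumes "head X d = tail X d" "head X e \<noteq> tail X e" "tail X d \<noteq> tail X e" "tail X d \<noteq> head X e"
  shows "equivariantly_isomorphic (alt_group n) Y \<rho>
    (disjoint_union (rose n) (cage n)) (diagonal permute_edges permute_edges)"
proof (rule slice_isomorphism[where lab = "case_sum fst fst" and vl = "\<lambda>_. 0"
      and rep = "case_sum (\<lambda>(i, b). half X d b) (\<lambda>(i, b). half X e b)"
      and vr = "case_sum (\<lambda>_. tail X d) (\<lambda>b. if b then head X e else tail X e)"])
  show "labelled_graph n (diagonal permute_edges permute_edges) (disjoint_union (rose n) (cage n)) (case_sum fst fst)"
    by (intro labelled_disjoint_union labelled_rose labelled_cage n_ge_1)
qed (use sum_cases assms no_slice_verts half_neq slice_half in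
    \<open>auto simp: disjoint_union_def rose_def cage_def diagonal_def permute_edges_def inj_on_def half
      split: if_splits sum.splits\<close>)

lemma wedge_cages_iso:
  assumes "head X d \<noteq> tail X d" "head X e \<noteq> tail X e" "tail X e = tail X d" "head X e \<noteq> head X d"
  shows "equivariantly_isomorphic (alt_group n) Y \<rho>
    (wedge (cage n) False (cage n) False) (diagonal permute_edges permute_edges)"
proof (rule slice_isomorphism[where lab = "case_sum fst fst" and vl = "\<lambda>_. 0"
      and rep = "case_sum (\<lambda>(i, b). half X d b) (\<lambda>(i, b). half X e b)"
      and vr = "case_sum (\<lambda>b. if b then head X d else tail X d) (\<lambda>b. if b then head X e else tail X e)"])
  show "labelled_graph n (diagonal permute_edges permute_edges) (wedge (cage n) False (cage n) False) (case_sum fst fst)"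
    by (intro labelled_wedge labelled_cage n_ge_1) (auto simp: cage_def permute_edges_def)
qed (use sum_cases assms no_slice_verts half_neq slice_half in
    \<open>auto simp: wedge_def disjoint_union_def cage_def Let_def diagonal_def permute_edges_def inj_on_def half
      split: if_splits sum.splits\<close>)

lemma disjoint_cages_iso:
  assumes "head X d \<noteq> tail X d" "head X e \<noteq> tail X e" "{tail X d, head X d} \<inter> {tail X e, head X e} = {}"
  shows "equivariantly_isomorphic (alt_group n) Y \<rho>
    (disjoint_union (cage n) (cage n)) (diagonal permute_edges permute_edges)"
proof (rule slice_isomorphism[where lab = "case_sum fst fst" and vl = "\<lambda>_. 0"
      and rep = "case_sum (\<lambda>(i, b). half X d b) (\<lambda>(i, b). half X e b)"
      and vr = "case_sum (\<lambda>b. if b then head X d else tail X d) (\<lambda>b. if b then head X e else tail X e)"])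
  show "labelled_graph n (diagonal permute_edges permute_edges) (disjoint_union (cage n) (cage n)) (case_sum fst fst)"
    by (intro labelled_disjoint_union labelled_cage n_ge_1)
qed (use sum_cases assms no_slice_verts half_neq slice_half in
    \<open>auto simp: disjoint_union_def cage_def diagonal_def permute_edges_def inj_on_def half
      split: if_splits sum.splits\<close>)

lemma cage_twice_iso:
  assumes "head X d \<noteq> tail X d" "tail X e = tail X d" "head X e = head X d"
  shows "equivariantly_isomorphic (alt_group n) Y \<rho> (cage (2 * n)) (permute_edges_twice n)"
proof (rule slice_isomorphism[OF labelled_cage_twice[OF n_ge_1], where vl = "\<lambda>_. 0"
      and rep = "\<lambda>(i, b). if i \<le> n then half X d b else half X e b"
      and vr = "\<lambda>b. if b then head X d else tail X d"])
  show "\<exists>a\<in>darts (cage (2 * n)). (case a of (i, b) \<Rightarrow> if i \<le> n then i else i - n) = i \<and>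
      (case a of (i, b) \<Rightarrow> if i \<le> n then half X d b else half X e b) = x"
    if i: "i \<in> {1..n}" and x: "x \<in> slice_darts" for i x
    using surj_sum[OF x]
  proof (elim disjE exE)
    show ?thesis if "x = half X d b" for b
      using that i by (intro bexI[of _ "(i, b)"]) (auto simp: cage_def)
    show ?thesis if "x = half X e b" for b
      using that i by (intro bexI[of _ "(n + i, b)"]) (auto simp: cage_def)
  qed
  show "(case snd (permute_edges_twice n p) a of (i, b) \<Rightarrow> if i \<le> n then half X d b else half X e b)
      = (case a of (i, b) \<Rightarrow> if i \<le> n then half X d b else half X e b)"
    if p: "p \<in> alternating {1..n}" and a: "a \<in> darts (cage (2 * n))" for p a
  proof -
    obtain i b where ib: "a = (i, b)" "1 \<le> i" "i \<le> 2 * n" using a by (auto simp: cage_def)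
    show ?thesis
      using alternating_in[OF p, of i] alternating_in[OF p, of "i - n"] ib
      by (cases "i \<le> n") (auto simp: permute_edges_twice_def permute_edges_def)
  qed
qed (use assms no_slice_verts half_neq slice_half in
    \<open>auto simp: cage_def permute_edges_twice_def permute_edges_def inj_on_def half split: if_splits\<close>)

lemma head_tail_opp:
  "head X (opp X d) = tail X d" "tail X (opp X d) = head X d"
  "head X (opp X e) = tail X e" "tail X (opp X e) = head X e"
  using head_tail_iff dX by auto

lemma two_loops_list:
  assumes "head X d = tail X d" "head X e = tail X e"
  shows "2 * n \<le> genus X \<and> in_list_5 n \<rho> Y"
proof (cases "tail X e = tail X d")
  case True
  have "card attach = 1" unfolding attach_two using assms True by simp
  then show ?thesis
    using wedge_roses_iso assms True genus_two by (auto simp: in_list_5_def)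
next
  case False
  have "card attach \<le> 2" unfolding attach_two using assms by (simp add: card_insert_if)
  \<comment> \<open>Two disjoint roses would need genus 2 n + 1.\<close>
  then have "4 * n + 6 \<le> 2 * genus X + 4" using genus_two_disconnected assms False by simp
  then show ?thesis using genus by simp
qed

lemma wedge_cage_rose_list:
  assumes "head X d \<noteq> tail X d" "head X e = tail X e" "tail X e = tail X d"
  shows "2 * n \<le> genus X + 1 \<and> in_list_4 n \<rho> Y"
proof -
  have "card attach \<le> 2" unfolding attach_two using assms by (simp add: card_insert_if)
  then show ?thesis using wedge_cage_rose_iso[OF assms] genus_two by (auto simp: in_list_4_def)
qed

lemma disjoint_rose_cage_list:
  assumes "head X d = tail X d" "head X e \<noteq> tail X e" "tail X d \<noteq> tail X e" "tail X d \<noteq> head X e"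
  shows "2 * n \<le> genus X \<and> in_list_5 n \<rho> Y"
proof -
  have "card attach \<le> 3" unfolding attach_two using assms by (simp add: card_insert_if)
  then show ?thesis
    using disjoint_rose_cage_iso[OF assms] genus_two_disconnected assms by (auto simp: in_list_5_def)
qed

lemma cage_twice_list:
  assumes "head X d \<noteq> tail X d" "tail X e = tail X d" "head X e = head X d"
  shows "2 * n \<le> genus X + 1 \<and> in_list_4 n \<rho> Y"
proof -
  have "card attach \<le> 2" unfolding attach_two using assms by (simp add: card_insert_if)
  then show ?thesis using cage_twice_iso[OF assms] genus_two by (auto simp: in_list_4_def)
qed

lemma wedge_cages_list:
  assumes "head X d \<noteq> tail X d" "head X e \<noteq> tail X e" "tail X e = tail X d" "head X e \<noteq> head X d"
  shows "2 * n \<le> genus X + 2 \<and> in_list_3 n \<rho> Y"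
proof -
  have "card attach \<le> 3" unfolding attach_two using assms by (simp add: card_insert_if)
  then show ?thesis using wedge_cages_iso[OF assms] genus_two by (auto simp: in_list_3_def)
qed

lemma disjoint_cages_list:
  assumes "head X d \<noteq> tail X d" "head X e \<noteq> tail X e" "{tail X d, head X d} \<inter> {tail X e, head X e} = {}"
  shows "2 * n \<le> genus X + 1 \<and> in_list_4 n \<rho> Y"
proof -
  have "card attach \<le> 4" unfolding attach_two by (simp add: card_insert_if)
  then show ?thesis
    using disjoint_cages_iso[OF assms] genus_two_disconnected[OF assms(3)] by (auto simp: in_list_4_def)
qed

lemma common_tail_list:
  assumes "head X d \<noteq> tail X d" "head X e \<noteq> tail X e" "tail X e = tail X d"
  shows "2 * n \<le> genus X + 2 \<and> in_list_3 n \<rho> Y \<or> 2 * n \<le> genus X + 1 \<and> in_list_4 n \<rho> Y"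
  using assms cage_twice_list wedge_cages_list by metis

lemma edge_rose_list:
  assumes "head X d \<noteq> tail X d" "head X e = tail X e"
  shows "2 * n \<le> genus X + 1 \<and> in_list_4 n \<rho> Y \<or> 2 * n \<le> genus X \<and> in_list_5 n \<rho> Y"
proof -
  interpret r: two_edges n X \<rho> "opp X d" e by (rule reverse)
  interpret s: two_edges n X \<rho> e d by (rule swap)
  consider "tail X e = tail X d" | "tail X e = head X d" | "tail X e \<noteq> tail X d" "tail X e \<noteq> head X d"
    by blast
  then show ?thesis
  proof cases
    case 1
    then show ?thesis using wedge_cage_rose_list assms by blast
  next
    case 2
    then show ?thesis using r.wedge_cage_rose_list assms head_tail_opp by metis
  next
    case 3
    then show ?thesis using s.disjoint_rose_cage_list assms by metis
  qed
qed

lemma two_edges_list: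
  "2 * n \<le> genus X + 2 \<and> in_list_3 n \<rho> Y \<or> 2 * n \<le> genus X + 1 \<and> in_list_4 n \<rho> Y \<or>
    2 * n \<le> genus X \<and> in_list_5 n \<rho> Y"
proof -
  interpret s: two_edges n X \<rho> e d by (rule swap)
  interpret r: two_edges n X \<rho> "opp X d" e by (rule reverse)
  interpret sr: two_edges n X \<rho> "opp X e" d by (rule s.reverse)
  interpret rs: two_edges n X \<rho> e "opp X d" by (rule r.swap)
  interpret rsr: two_edges n X \<rho> "opp X e" "opp X d" by (rule rs.reverse)
  consider "head X d = tail X d" "head X e = tail X e" | "head X d \<noteq> tail X d" "head X e = tail X e"
    | "head X d = tail X d" "head X e \<noteq> tail X e"
    | "head X d \<noteq> tail X d" "head X e \<noteq> tail X e"
    by blast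
  then show ?thesis
  proof cases
    case 1
    then show ?thesis using two_loops_list by blast
  next
    case 2
    then show ?thesis using edge_rose_list by blast
  next
    case 3
    then show ?thesis using s.edge_rose_list by blast
  next
    case 4
    \<comment> \<open>A shared vertex may be either end of either edge; reversing edges makes it the
      common tail.\<close>
    consider "tail X e = tail X d" | "tail X e = head X d" | "head X e = tail X d" | "head X e = head X d"
      | "{tail X d, head X d} \<inter> {tail X e, head X e} = {}"
      by auto
    then show ?thesis
    proof cases
      case 1
      then show ?thesis using common_tail_list 4 by blast
    next
      case 2
      then show ?thesis using r.common_tail_list 4 head_tail_opp by metis
    next
      case 3
      then show ?thesis using sr.common_tail_list 4 head_tail_opp by metis
    next
      case h: 4
      then show ?thesis using rsr.common_tail_list 4 head_tail_opp by metis
    next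
      case 5
      then show ?thesis using disjoint_cages_list 4 by blast
    qed
  qed
qed

end

text \<open>The legs are indexed by \<open>{1..3}\<close>, like the fixed vertices of
  \<open>complete_bipartite 3 n\<close> and the edges of \<open>cage 3\<close>.\<close>

locale tripod = small_graph n X \<rho>
  for n :: nat and X :: "('v, 'd) graph" and \<rho> :: "(nat \<Rightarrow> nat, 'v, 'd) action" +
  fixes v :: 'v and a :: "nat \<Rightarrow> 'd"
  assumes slice_vert: "slice_verts = {v}"
    and slice: "slice_darts = a ` {1..3} \<union> opp X ` a ` {1..3}"
    and inj: "inj_on a {1..3}"
    and ends: "\<And>j. j \<in> {1..3} \<Longrightarrow> tail X (a j) = v \<and> head X (a j) \<in> attach"
begin

lemma aX: "j \<in> {1..3} \<Longrightarrow> a j \<in> darts X"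
  using slice slice_darts by auto

lemma head_neq: "j \<in> {1..3} \<Longrightarrow> head X (a j) \<noteq> v"
  using ends attach_not_slice slice_vert by blast

lemma half_a_eq_iff:
  assumes "j \<in> {1..3}" "k \<in> {1..3}"
  shows "half X (a j) b = half X (a k) c \<longleftrightarrow> j = k \<and> b = c"
proof
  assume eq: "half X (a j) b = half X (a k) c"
  have "tail X (half X (a j) b) = (if b then head X (a j) else v)"
    "tail X (half X (a k) c) = (if c then head X (a k) else v)"
    using ends assms by (auto simp: tail_half)
  then have "(if b then head X (a j) else v) = (if c then head X (a k) else v)" using eq by simp
  then have bc: "b = c"
    using head_neq[OF assms(1)] head_neq[OF assms(2)] by (cases b; cases c) simp_all
  have "opp X (a j) = opp X (a k) \<Longrightarrow> a j = a k"
    by (metis opp_opp[OF graph aX[OF assms(1)]] opp_opp[OF graph aX[OF assms(2)]])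
  then have "a j = a k" using eq bc by (cases b) (simp_all add: half_def)
  then show "j = k \<and> b = c" using inj assms bc by (auto simp: inj_on_def)
qed simp

lemma slice_half: "x \<in> slice_darts \<longleftrightarrow> (\<exists>j\<in>{1..3}. \<exists>b. x = half X (a j) b)"
  unfolding slice half_def by (auto simp: ex_bool_eq)

lemma half_tripod: "j \<in> {1..3} \<Longrightarrow> opp X (half X (a j) b) = half X (a j) (\<not> b)"
  "j \<in> {1..3} \<Longrightarrow> tail X (half X (a j) b) = (if b then head X (a j) else v)"
  using opp_half[OF graph aX] ends by (auto simp: tail_half)

lemma attach_sub: "attach \<subseteq> (\<lambda>j. head X (a j)) ` {1..3}"
proof
  fix w assume w: "w \<in> attach"
  then obtain x where x: "x \<in> slice_darts" "w = tail X x" by (auto simp: attach_def)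
  then obtain j b where j: "j \<in> {1..3}" "x = half X (a j) b" using slice_half by blast
  have "w \<noteq> v" using w attach_not_slice slice_vert by blast
  then show "w \<in> (\<lambda>j. head X (a j)) ` {1..3}"
    using x(2) j half_tripod(2)[OF j(1), of b] by (auto split: if_splits)
qed

text \<open>Six darts per label, less twice the one vertex, again leave 4 n, so the thresholds are
  those of two edges.\<close>

lemma genus_tripod: "4 * n + 2 \<le> 2 * genus X + 2 * card attach"
proof -
  have "card (a ` {1..3}) = 3" using card_image[OF inj] by simp
  moreover have "card (opp X ` a ` {1..3}) = card (a ` {1..3})"
    by (rule card_opp) (use aX in auto)
  moreover have "card (a ` {1..3} \<union> opp X ` a ` {1..3}) = card (a ` {1..3}) + card (opp X ` a ` {1..3})"
  proof (rule card_Un_disjoint)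
    have "a j \<noteq> opp X (a k)" if "j \<in> {1..3}" "k \<in> {1..3}" for j k
      using half_a_eq_iff[OF that, of False True] by (simp add: half_def)
    then show "a ` {1..3} \<inter> opp X ` a ` {1..3} = {}" by blast
  qed auto
  ultimately have "card slice_darts = 6" using slice by simp
  then show ?thesis using genus_attach slice_vert by simp
qed

lemma bipartite_iso:
  assumes inj_head: "inj_on (\<lambda>j. head X (a j)) {1..3}"
  shows "equivariantly_isomorphic (alt_group n) Y \<rho> (complete_bipartite 3 n) permute_right"
proof (rule slice_isomorphism[OF labelled_bipartite[OF n_ge_1],
      \<comment> \<open>The legs start at the moved vertex, whereas a model dart with
        \<open>b = False\<close> starts at a fixed one; hence the negation.\<close>
      where rep = "\<lambda>((j, i), b). half X (a j) (\<not> b)"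
        and vr = "case_sum (\<lambda>j. head X (a j)) (\<lambda>_. v)" and vl = "case_sum (\<lambda>_. 0) (\<lambda>i. i)"])
  let ?T = "complete_bipartite 3 n"
  show "inj_on (\<lambda>e. (case e of (x, xa) \<Rightarrow> (case x of (j, i) \<Rightarrow> \<lambda>b. i) xa,
      case e of (x, xa) \<Rightarrow> (case x of (j, i) \<Rightarrow> \<lambda>b. half X (a j) (\<not> b)) xa)) (darts ?T)"
    by (auto simp: complete_bipartite_def inj_on_def half_a_eq_iff)
  show "(case e of (x, xa) \<Rightarrow> (case x of (j, i) \<Rightarrow> \<lambda>b. half X (a j) (\<not> b)) xa) \<in> slice_darts"
    if "e \<in> darts ?T" for e
    using that by (auto simp: complete_bipartite_def slice_half)
  show "\<exists>e\<in>darts ?T. (case e of (x, xa) \<Rightarrow> (case x of (j, i) \<Rightarrow> \<lambda>b. i) xa) = i \<and>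
      (case e of (x, xa) \<Rightarrow> (case x of (j, i) \<Rightarrow> \<lambda>b. half X (a j) (\<not> b)) xa) = x"
    if i: "i \<in> {1..n}" and x: "x \<in> slice_darts" for i x
  proof -
    obtain j b where "j \<in> {1..3}" "x = half X (a j) b" using x slice_half by blast
    then show ?thesis
      using i by (intro bexI[of _ "((j, i), \<not> b)"]) (auto simp: complete_bipartite_def)
  qed
  show "w = w'" if w: "w \<in> verts ?T" "w' \<in> verts ?T"
    and eq: "case_sum (\<lambda>j. head X (a j)) (\<lambda>_. v) w = case_sum (\<lambda>j. head X (a j)) (\<lambda>_. v) w'"
    and lab: "case_sum (\<lambda>j. head X (a j)) (\<lambda>_. v) w \<in> slice_verts \<Longrightarrow>
      case_sum (\<lambda>_. 0) (\<lambda>i. i) w = case_sum (\<lambda>_. 0) (\<lambda>i. i) w'" for w w'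
  proof -
    have ne: "head X (a j) \<noteq> v" "v \<noteq> head X (a j)" if "1 \<le> j" "j \<le> 3" for j
      using head_neq[of j] that by auto
    show ?thesis
      using w eq lab ne inj_onD[OF inj_head]
      by (cases w; cases w') (auto simp: complete_bipartite_def slice_vert)
  qed
qed (auto simp: complete_bipartite_def permute_right_def half_tripod slice_vert head_neq split: if_splits)

lemma wedge_copies_iso:
  assumes heads: "\<And>j. j \<in> {1..3} \<Longrightarrow> head X (a j) = h"
  shows "equivariantly_isomorphic (alt_group n) Y \<rho> (wedge_copies n (cage 3) False) permute_copies"
proof (rule slice_isomorphism[OF labelled_wedge_copies[OF n_ge_1],
      \<comment> \<open>The base point \<open>False\<close> of the cage is the fixed vertex, so the
        legs again run against the model darts.\<close>
      where rep = "\<lambda>(i, (j, b)). half X (a j) (\<not> b)"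
        and vr = "case_option h (\<lambda>_. v)" and vl = "case_option 0 fst"])
  let ?T = "wedge_copies n (cage 3) False"
  have hv: "h \<noteq> v" using heads[of 1] head_neq[of 1] by simp
  show "\<exists>e\<in>darts ?T. fst e = i \<and> (case e of (i, (j, b)) \<Rightarrow> half X (a j) (\<not> b)) = x"
    if i: "i \<in> {1..n}" and x: "x \<in> slice_darts" for i x
  proof -
    obtain j b where "j \<in> {1..3}" "x = half X (a j) b" using x slice_half by blast
    then show ?thesis
      using i by (intro bexI[of _ "(i, (j, \<not> b))"]) (auto simp: wedge_copies_def cage_def)
  qed
  show "w = w'" if w: "w \<in> verts ?T" "w' \<in> verts ?T"
    and eq: "case_option h (\<lambda>_. v) w = case_option h (\<lambda>_. v) w'"
    and lab: "case_option h (\<lambda>_. v) w \<in> slice_verts \<Longrightarrow>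
      case_option 0 fst w = case_option 0 fst w'" for w w'
    using w eq lab hv
    by (auto simp: wedge_copies_def slice_vert split: option.splits if_splits)
  show "inj_on (\<lambda>e. (fst e, case e of (i, (j, b)) \<Rightarrow> half X (a j) (\<not> b))) (darts ?T)"
    by (auto simp: wedge_copies_def cage_def inj_on_def half_a_eq_iff)
  show "(case e of (i, (j, b)) \<Rightarrow> half X (a j) (\<not> b)) \<in> slice_darts" if "e \<in> darts ?T" for e
    using that by (auto simp: wedge_copies_def cage_def slice_half)
  show "case_option h (\<lambda>_. v) (tail ?T e) = tail X (case e of (i, (j, b)) \<Rightarrow> half X (a j) (\<not> b)) \<and>
      (case_option h (\<lambda>_. v) (tail ?T e) \<in> slice_verts \<longrightarrow> case_option 0 fst (tail ?T e) = fst e)"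
    if "e \<in> darts ?T" for e
    using that hv by (auto simp: wedge_copies_def cage_def half_tripod heads slice_vert split: if_splits)
  show "case_option h (\<lambda>_. v) (fst (permute_copies p) w) = case_option h (\<lambda>_. v) w \<and>
      (case_option h (\<lambda>_. v) w \<in> slice_verts \<longrightarrow>
        case_option 0 fst (fst (permute_copies p) w) = p (case_option 0 fst w))"
    if "p \<in> alternating {1..n}" "w \<in> verts ?T" for p w
    using hv by (cases w) (auto simp: permute_copies_def slice_vert)
qed (auto simp: wedge_copies_def cage_def permute_copies_def half_tripod)

end

text \<open>The legs are indexed by Booleans because they correspond to the two halves
  \<open>To_Mid (i, c)\<close> of the subdivided model edge i.\<close>

locale looped_path = small_graph n X \<rho>
  for n :: nat and X :: "('v, 'd) graph" and \<rho> :: "(nat \<Rightarrow> nat, 'v, 'd) action" +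
  fixes v :: 'v and a :: "bool \<Rightarrow> 'd" and l :: 'd
  assumes slice_vert: "slice_verts = {v}"
    and slice: "slice_darts = range a \<union> opp X ` range a \<union> {l, opp X l}"
    and inj: "a True \<noteq> a False"
    and ends: "\<And>c. tail X (a c) = v \<and> head X (a c) \<in> attach"
    and loop: "tail X l = v" "head X l = v"
begin

lemma aX: "a c \<in> darts X" "l \<in> darts X"
  using slice slice_darts by auto

lemma head_neq: "head X (a c) \<noteq> v"
  using ends attach_not_slice slice_vert by blast

lemma half_path:
  "opp X (half X (a c) b) = half X (a c) (\<not> b)" "opp X (half X l b) = half X l (\<not> b)"
  "tail X (half X (a c) b) = (if b then head X (a c) else v)" "tail X (half X l b) = v"
  using opp_half[OF graph] aX ends loop by (auto simp: tail_half)

lemma half_path_eq_iff: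
  "half X (a c) b = half X (a c') b' \<longleftrightarrow> c = c' \<and> b = b'"
  "half X l b = half X l b' \<longleftrightarrow> b = b'"
  "half X (a c) b \<noteq> half X l b'" "half X l b' \<noteq> half X (a c) b"
proof -
  show "half X l b = half X l b' \<longleftrightarrow> b = b'" by (rule half_eq_iff[OF graph aX(2)])
  show "half X (a c) b = half X (a c') b' \<longleftrightarrow> c = c' \<and> b = b'"
  proof
    assume eq: "half X (a c) b = half X (a c') b'"
    have bb: "b = b'" using arg_cong[OF eq, of "tail X"] head_neq[of c] head_neq[of c']
      by (auto simp: half_path split: if_splits)
    have "opp X (a c) = opp X (a c') \<Longrightarrow> a c = a c'"
      by (metis opp_opp[OF graph aX(1)])
    then have "a c = a c'" using eq bb by (cases b) (simp_all add: half_def)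
    then show "c = c' \<and> b = b'" using inj bb by (cases c; cases c') auto
  qed simp
  show ne: "half X (a c) b \<noteq> half X l b'"
  proof
    assume eq: "half X (a c) b = half X l b'"
    have "opp X (half X (a c) b) = opp X (half X l b')" using eq by simp
    then have "tail X (half X (a c) (\<not> b)) = v" by (simp only: half_path)
    moreover have "tail X (half X (a c) b) = v" using eq by (simp only: half_path)
    ultimately show False using head_neq[of c] by (auto simp: half_path split: if_splits)
  qed
  then show "half X l b' \<noteq> half X (a c) b" by metis
qed

lemma slice_half: "x \<in> slice_darts \<longleftrightarrow> (\<exists>c b. x = half X (a c) b) \<or> (\<exists>b. x = half X l b)"
  unfolding slice half_def by (auto simp: ex_bool_eq UNIV_bool)

lemma half_in_slice: "half X (a c) b \<in> slice_darts" "half X l b \<in> slice_darts"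
  using slice_half by blast+

lemma attach_sub: "attach \<subseteq> (\<lambda>c. head X (a c)) ` UNIV"
proof
  fix w assume w: "w \<in> attach"
  then obtain x where x: "x \<in> slice_darts" "w = tail X x" by (auto simp: attach_def)
  have "w \<noteq> v" using w attach_not_slice slice_vert by blast
  then show "w \<in> (\<lambda>c. head X (a c)) ` UNIV"
    using x by (auto simp: slice_half half_path split: if_splits)
qed

lemma genus_path: "4 * n + 2 \<le> 2 * genus X + 2 * card attach"
proof -
  have "distinct [half X (a True) True, half X (a True) False, half X (a False) True,
      half X (a False) False, half X l True, half X l False]"
    by (simp add: half_path_eq_iff)
  moreover have "slice_darts = set [half X (a True) True, half X (a True) False, half X (a False) True,
      half X (a False) False, half X l True, half X l False]"
    by (auto simp: slice_half ex_bool_eq)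
  ultimately have "card slice_darts = 6" by (simp only: distinct_card) simp
  then show ?thesis using genus_attach slice_vert by simp
qed

definition path_rep :: "(nat \<times> bool) loop_dart \<Rightarrow> 'd" where
  "path_rep x = (case x of To_Mid (i, c) \<Rightarrow> half X (a c) True | From_Mid (i, c) \<Rightarrow> half X (a c) False
    | Mid_Loop (i, c) \<Rightarrow> half X l c)"

lemma path_surj:
  assumes "i \<in> {1..n}" "x \<in> slice_darts"
  shows "\<exists>e\<in>To_Mid ` ({1..n} \<times> UNIV) \<union> From_Mid ` ({1..n} \<times> UNIV) \<union> Mid_Loop ` ({1..n} \<times> UNIV).
    loop_label fst e = i \<and> path_rep e = x"
proof -
  consider c where "x = half X (a c) True" | c where "x = half X (a c) False" | c where "x = half X l c"
    using assms(2) by (auto simp: slice_half ex_bool_eq)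
  then show ?thesis
  proof cases
    case 1
    then show ?thesis using assms(1)
      by (intro bexI[of _ "To_Mid (i, c)"]) (auto simp: loop_label_def path_rep_def)
  next
    case 2
    then show ?thesis using assms(1)
      by (intro bexI[of _ "From_Mid (i, c)"]) (auto simp: loop_label_def path_rep_def)
  next
    case 3
    then show ?thesis using assms(1)
      by (intro bexI[of _ "Mid_Loop (i, c)"]) (auto simp: loop_label_def path_rep_def)
  qed
qed

lemma edge_model:
  assumes "opp M = (\<lambda>(i, b). (i, \<not> b))"
  shows "edge M (i, b) = {(i, False), (i, True)}"
  using assms by (cases b) (auto simp: edge_def)

text \<open>Treats the cage and the rose at once; \<open>h\<close> tells at which fixed vertex the
  legs belonging to a vertex of \<open>M\<close> end.\<close>

lemma loops_iso:
  assumes M: "labelled_graph n permute_edges M fst" "darts M = {1..n} \<times> UNIV"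
      "opp M = (\<lambda>(i, b). (i, \<not> b))"
    and inj_h: "inj_on h (verts M)"
    and h: "\<And>i c. i \<in> {1..n} \<Longrightarrow> h (tail M (i, c)) = head X (a c)"
  shows "equivariantly_isomorphic (alt_group n) Y \<rho> (with_loops M) (with_loops_action permute_edges)"
proof (rule slice_isomorphism[where lab = "loop_label fst" and rep = path_rep
      \<comment> \<open>A midpoint is encoded by its edge \<open>{(i, False), (i, True)}\<close>;
        the minimum of the first components reads off i.\<close>
      and vr = "case_sum h (\<lambda>_. v)" and vl = "case_sum (\<lambda>_. 0) (\<lambda>S. Min (fst ` S))"])
  let ?T = "with_loops M"
  show "labelled_graph n (with_loops_action permute_edges) ?T (loop_label fst)"
    by (rule labelled_with_loops[OF M(1)]) (auto simp: M permute_edges_def)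
  have dT: "darts ?T = To_Mid ` ({1..n} \<times> UNIV) \<union> From_Mid ` ({1..n} \<times> UNIV) \<union> Mid_Loop ` ({1..n} \<times> UNIV)"
    by (simp add: with_loops_def M(2))
  have hv: "h w \<noteq> v" if "w \<in> verts M" for w
  proof -
    have "w \<in> tail M ` ({1..n} \<times> UNIV)" using that labelled_graphD(1)[OF M(1)] M(2) by simp
    then obtain i c where "w = tail M (i, c)" "i \<in> {1..n}" by auto
    then show ?thesis using h head_neq[of c] by simp
  qed
  show "\<exists>e\<in>darts ?T. loop_label fst e = i \<and> path_rep e = x" if "i \<in> {1..n}" "x \<in> slice_darts" for i x
    unfolding dT by (rule path_surj[OF that])
  show "inj_on (\<lambda>e. (loop_label fst e, path_rep e)) (darts ?T)"
    unfolding dT by (auto simp: inj_on_def loop_label_def path_rep_def half_path_eq_iff)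
  show "path_rep e \<in> slice_darts" if "e \<in> darts ?T" for e
    using that unfolding dT by (auto simp: path_rep_def half_in_slice)
  have vT: "(\<exists>u\<in>verts M. w = Inl u) \<or> (\<exists>i. w = Inr {(i, False), (i, True)})" if "w \<in> verts ?T" for w
    using that edge_model[OF M(3)] by (auto simp: with_loops_def M(2))
  show "w = w'" if w: "w \<in> verts ?T" "w' \<in> verts ?T"
    and eq: "case_sum h (\<lambda>_. v) w = case_sum h (\<lambda>_. v) w'"
    and lab: "case_sum h (\<lambda>_. v) w \<in> slice_verts \<Longrightarrow>
      case_sum (\<lambda>_. 0) (\<lambda>S. Min (fst ` S)) w = case_sum (\<lambda>_. 0) (\<lambda>S. Min (fst ` S)) w'" for w w'
    using vT[OF w(1)] vT[OF w(2)]
    by (elim disjE exE bexE) (use eq lab hv inj_onD[OF inj_h] in \<open>auto simp: slice_vert\<close>)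
  show "case_sum h (\<lambda>_. v) (tail ?T e) = tail X (path_rep e) \<and>
      (case_sum h (\<lambda>_. v) (tail ?T e) \<in> slice_verts \<longrightarrow>
        case_sum (\<lambda>_. 0) (\<lambda>S. Min (fst ` S)) (tail ?T e) = loop_label fst e)" if "e \<in> darts ?T" for e
    using that head_neq unfolding dT
    by (auto simp: with_loops_def edge_model[OF M(3)] path_rep_def half_path loop_label_def slice_vert h)
  show "path_rep (opp ?T e) = opp X (path_rep e)" if "e \<in> darts ?T" for e
    using that unfolding dT by (auto simp: with_loops_def path_rep_def half_path M(3))
  show "path_rep (snd (with_loops_action permute_edges p) e) = path_rep e"
    if "p \<in> alternating {1..n}" "e \<in> darts ?T" for p e
    using that unfolding dT by (auto simp: with_loops_action_def permute_edges_def path_rep_def)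
  show "case_sum h (\<lambda>_. v) (fst (with_loops_action permute_edges p) w) = case_sum h (\<lambda>_. v) w \<and>
      (case_sum h (\<lambda>_. v) w \<in> slice_verts \<longrightarrow>
        case_sum (\<lambda>_. 0) (\<lambda>S. Min (fst ` S)) (fst (with_loops_action permute_edges p) w) =
        p (case_sum (\<lambda>_. 0) (\<lambda>S. Min (fst ` S)) w))"
    if "p \<in> alternating {1..n}" "w \<in> verts ?T" for p w
    using vT[OF that(2)] hv by (auto simp: with_loops_action_def permute_edges_def slice_vert)
qed

lemma loops_cage_iso:
  assumes "head X (a True) \<noteq> head X (a False)"
  shows "equivariantly_isomorphic (alt_group n) Y \<rho> (with_loops (cage n)) (with_loops_action permute_edges)"
proof (rule loops_iso[OF labelled_cage[OF n_ge_1], where h = "\<lambda>c. head X (a c)"])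
  have "head X (a c) = head X (a c') \<Longrightarrow> c = c'" for c c'
    using assms by (cases c; cases c') auto
  then show "inj_on (\<lambda>c. head X (a c)) (verts (cage n))" by (rule inj_onI)
qed (simp_all add: cage_def)

lemma loops_rose_iso:
  assumes "head X (a True) = head X (a False)"
  shows "equivariantly_isomorphic (alt_group n) Y \<rho> (with_loops (rose n)) (with_loops_action permute_edges)"
proof (rule loops_iso[OF labelled_rose[OF n_ge_1], where h = "\<lambda>_. head X (a False)"])
  show "head X (a False) = head X (a c)" for c using assms by (cases c) auto
qed (simp_all add: rose_def)

end

section \<open>Classification and converse\<close>

context tripod
begin

lemma tripod_list:
  assumes "(\<exists>h. \<forall>j\<in>{1..3}. head X (a j) = h) \<or> inj_on (\<lambda>j. head X (a j)) {1..3}"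
  shows "2 * n \<le> genus X + 2 \<and> in_list_3 n \<rho> Y \<or> 2 * n \<le> genus X \<and> in_list_5 n \<rho> Y"
  using assms
proof
  assume "\<exists>h. \<forall>j\<in>{1..3}. head X (a j) = h"
  then obtain h where heads: "\<forall>j\<in>{1..3}. head X (a j) = h" by blast
  have "attach \<subseteq> {h}" using attach_sub heads by auto
  then have "card attach \<le> 1" using card_mono[of "{h}" attach] by simp
  moreover have "equivariantly_isomorphic (alt_group n) Y \<rho> (wedge_copies n (cage 3) False) permute_copies"
    using heads by (intro wedge_copies_iso) blast
  ultimately show ?thesis using genus_tripod by (auto simp: in_list_5_def)
next
  assume "inj_on (\<lambda>j. head X (a j)) {1..3}"
  then have "equivariantly_isomorphic (alt_group n) Y \<rho> (complete_bipartite 3 n) permute_right"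
    by (rule bipartite_iso)
  moreover have "card attach \<le> 3"
    using card_mono[OF _ attach_sub] card_image_le[of "{1..3}" "\<lambda>j. head X (a j)"] by simp
  ultimately show ?thesis using genus_tripod by (auto simp: in_list_3_def)
qed

end

context looped_path
begin

lemma looped_path_list:
  "2 * n \<le> genus X + 1 \<and> in_list_4 n \<rho> Y \<or> 2 * n \<le> genus X \<and> in_list_5 n \<rho> Y"
proof (cases "head X (a True) = head X (a False)")
  case True
  have "attach \<subseteq> {head X (a False)}" using attach_sub True by (auto simp: UNIV_bool)
  then have "card attach \<le> 1" using card_mono[of "{head X (a False)}" attach] by simp
  then show ?thesis using loops_rose_iso[OF True] genus_path by (auto simp: in_list_5_def)
next
  case False
  have "card attach \<le> 2"
    using card_mono[OF _ attach_sub] card_image_le[of UNIV "\<lambda>c. head X (a c)"] by simp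
  then show ?thesis using loops_cage_iso[OF False] genus_path by (auto simp: in_list_4_def)
qed

end

context small_graph
begin

lemma one_edge_list:
  assumes V: "slice_verts = {}" and D: "slice_darts = {d, opp X d}"
  shows "n \<le> genus X + 1 \<and> is_rose_or_cage n \<rho> Y"
proof -
  have dX: "d \<in> darts X" using D slice_darts by blast
  have "card slice_darts = 2" unfolding D using opp_neq[OF graph dX] by auto
  moreover have "attach = {tail X d, head X d}"
    unfolding attach_no_slice_verts[OF V] D by (auto simp: head_def)
  then have "card attach \<le> 2" by (simp add: card_insert_if)
  ultimately have "n \<le> genus X + 1" using genus_attach V by simp
  then show ?thesis
    using rose_iso[OF V D] cage_iso[OF V D] by (auto simp: is_rose_or_cage_def)
qed

theorem classification:
  "n \<le> genus X + 1 \<and> is_rose_or_cage n \<rho> Y \<or>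
    2 * n \<le> genus X + 2 \<and> in_list_3 n \<rho> Y \<or> 2 * n \<le> genus X + 1 \<and> in_list_4 n \<rho> Y \<or>
    2 * n \<le> genus X \<and> in_list_5 n \<rho> Y"
proof (cases "slice_verts = {}")
  case True
  from no_slice_verts_cases[OF True] show ?thesis
  proof (elim disjE exE conjE)
    fix d assume "slice_darts = {d, opp X d}"
    then show ?thesis using one_edge_list[OF True] by blast
  next
    fix d e assume "slice_darts = {d, opp X d, e, opp X e}" "distinct [d, opp X d, e, opp X e]"
    then interpret two_edges n X \<rho> d e using True by unfold_locales
    show ?thesis using two_edges_list by blast
  qed
next
  case False
  then obtain v where v: "slice_verts = {v}" using slice_verts_le_1 by blast
  have three: "{1..3::nat} = {1, 2, 3}" by auto
  from one_slice_vert_cases[OF v] show ?thesis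
  proof (elim disjE exE)
    fix a b c
    assume "slice_darts = {a, b, c} \<union> opp X ` {a, b, c} \<and> distinct [a, b, c] \<and>
      (\<forall>d\<in>{a, b, c}. tail X d = v \<and> head X d \<in> attach) \<and>
      (head X b = head X a \<and> head X c = head X a \<or> distinct [head X a, head X b, head X c])"
    then have D: "slice_darts = {a, b, c} \<union> opp X ` {a, b, c}" and dist: "distinct [a, b, c]"
      and ends: "\<forall>d\<in>{a, b, c}. tail X d = v \<and> head X d \<in> attach"
      and heads: "head X b = head X a \<and> head X c = head X a \<or> distinct [head X a, head X b, head X c]"
      by simp_all
    define f where "f j = (if j = 1 then a else if j = 2 then b else c)" for j :: nat
    have f: "f ` {1..3} = {a, b, c}" by (auto simp: three f_def)
    interpret tripod n X \<rho> v f
    proof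
      show "slice_darts = f ` {1..3} \<union> opp X ` f ` {1..3}" unfolding f by (rule D)
      show "inj_on f {1..3}" using dist by (auto simp: three f_def inj_on_def)
      show "tail X (f j) = v \<and> head X (f j) \<in> attach" if "j \<in> {1..3}" for j
        using ends f that by blast
    qed (rule v)
    have "(\<exists>h. \<forall>j\<in>{1..3}. head X (f j) = h) \<or> inj_on (\<lambda>j. head X (f j)) {1..3}"
      using heads by (auto simp: three f_def inj_on_def)
    then show ?thesis using tripod_list by blast
  next
    fix a b l
    assume "slice_darts = {a, b} \<union> opp X ` {a, b} \<union> {l, opp X l} \<and> a \<noteq> b \<and>
      tail X l = v \<and> head X l = v \<and> (\<forall>d\<in>{a, b}. tail X d = v \<and> head X d \<in> attach)"
    then have D: "slice_darts = {a, b} \<union> opp X ` {a, b} \<union> {l, opp X l}" and ab: "a \<noteq> b"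
      and loop: "tail X l = v" "head X l = v"
      and ends: "\<forall>d\<in>{a, b}. tail X d = v \<and> head X d \<in> attach"
      by simp_all
    define f where "f c = (if c then b else a)" for c
    have f: "range f = {a, b}" by (auto simp: f_def UNIV_bool)
    interpret looped_path n X \<rho> v f l
    proof
      show "slice_darts = range f \<union> opp X ` range f \<union> {l, opp X l}" unfolding f by (rule D)
      show "f True \<noteq> f False" using ab by (simp add: f_def)
      show "tail X (f c) = v \<and> head X (f c) \<in> attach" for c using ends by (simp add: f_def)
    qed (rule v loop)+
    show ?thesis using looped_path_list by blast
  qed
qed

text \<open>The vertices are the point to check. A vertex outside the moved subgraph carries some
  dart, and as this dart is fixed, so is its tail.\<close>

lemma obtained_by_adding_fixed: "obtained_by_adding_fixed (alt_group n) \<rho> X Y"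
proof -
  have sub: "subgraph Y X"
    using tail_in_verts[OF graph] opp_in_darts[OF graph] opp_neq[OF graph] opp_opp[OF graph]
      fixed_opp
    unfolding moved_subgraph subgraph_def is_graph_def by auto metis
  have dfix: "da p d = d" if "p \<in> alternating {1..n}" "d \<in> darts X - darts Y" for p d
    using that D.act_fixed by (simp add: moved_subgraph)
  have vfix: "va p v = v" if p: "p \<in> alternating {1..n}" and v: "v \<in> verts X - verts Y" for p v
  proof -
    have "{d \<in> darts X. tail X d = v} \<noteq> {}"
      using valence_ge_3[of v] v unfolding valence_def by (metis DiffD1 card.empty not_numeral_le_zero)
    then obtain d where d: "d \<in> darts X" "tail X d = v" by blast
    then have "d \<notin> darts Y" using v by (auto simp: moved_subgraph)
    then show ?thesis using dfix[OF p] tail_da[OF p d(1)] d by simp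
  qed
  show ?thesis
    using sub dfix vfix by (simp add: obtained_by_adding_fixed_def carrier_alt_group)
qed

end

text \<open>For the converse the labels alone suffice: being equivariant and taking all values in
  \<open>{1..n}\<close>, they show that every dart of \<open>Y\<close> is moved and that the action
  is faithful.\<close>

lemma labelled_pullback:
  assumes iso: "equivariantly_isomorphic (alt_group n) Y \<rho> T \<sigma>" and T: "labelled_graph n \<sigma> T lab"
    and Y: "is_graph Y"
  shows "\<exists>l. l ` darts Y = {1..n} \<and> verts Y = tail Y ` darts Y \<and>
    (\<forall>p\<in>alternating {1..n}. \<forall>d\<in>darts Y. l (snd (\<rho> p) d) = p (l d))"
proof -
  obtain f g where f: "bij_betw f (verts Y) (verts T)" and g: "bij_betw g (darts Y) (darts T)"
    and fg: "\<And>d. d \<in> darts Y \<Longrightarrow> tail T (g d) = f (tail Y d)"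
    and ge: "\<And>p d. p \<in> alternating {1..n} \<Longrightarrow> d \<in> darts Y \<Longrightarrow> g (snd (\<rho> p) d) = snd (\<sigma> p) (g d)"
    using iso unfolding equivariantly_isomorphic_def carrier_alt_group by blast
  have gd: "g d \<in> darts T" if "d \<in> darts Y" for d using g that by (auto simp: bij_betw_def)
  have "(lab \<circ> g) ` darts Y = {1..n}"
    using g labelled_graphD(2)[OF T] unfolding bij_betw_def by (metis image_comp)
  moreover have "verts Y = tail Y ` darts Y"
  proof
    show "tail Y ` darts Y \<subseteq> verts Y" using tail_in_verts[OF Y] by blast
    show "verts Y \<subseteq> tail Y ` darts Y"
    proof
      fix v assume v: "v \<in> verts Y"
      then have "f v \<in> tail T ` darts T" using f labelled_graphD(1)[OF T] by (auto simp: bij_betw_def)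
      then have "f v \<in> tail T ` g ` darts Y" using g by (simp add: bij_betw_def)
      then obtain d where d: "d \<in> darts Y" "f v = tail T (g d)" by blast
      then have "f v = f (tail Y d)" using fg by simp
      then have "v = tail Y d"
        using f v tail_in_verts[OF Y d(1)] by (auto simp: bij_betw_def inj_on_def)
      then show "v \<in> tail Y ` darts Y" using d by blast
    qed
  qed
  moreover have "(lab \<circ> g) (snd (\<rho> p) d) = p ((lab \<circ> g) d)"
    if "p \<in> alternating {1..n}" "d \<in> darts Y" for p d
    using ge[OF that] labelled_graphD(7)[OF T that(1) gd[OF that(2)]] by simp
  ultimately show ?thesis by blast
qed

lemma in_list_5_labelled:
  assumes n: "n \<ge> 1" and list: "in_list_5 n \<rho> Y" and Y: "is_graph Y"
  shows "\<exists>l. l ` darts Y = {1..n} \<and> verts Y = tail Y ` darts Y \<and>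
    (\<forall>p\<in>alternating {1..n}. \<forall>d\<in>darts Y. l (snd (\<rho> p) d) = p (l d))"
proof -
  note pull = labelled_pullback[OF _ _ Y]
  note rose = labelled_rose[OF n] and cage = labelled_cage[OF n]
  have wedges: "\<exists>lab. labelled_graph n (diagonal permute_edges permute_edges) (wedge (cage n) False (cage n) False) lab"
    by (rule exI, rule labelled_wedge[OF cage cage]) (auto simp: cage_def permute_edges_def)
  have wedges': "\<exists>lab. labelled_graph n (diagonal permute_edges permute_edges) (wedge (cage n) False (rose n) ()) lab"
    by (rule exI, rule labelled_wedge[OF cage rose]) (auto simp: cage_def rose_def permute_edges_def)
  have wedges'': "\<exists>lab. labelled_graph n (diagonal permute_edges permute_edges) (wedge (rose n) () (rose n) ()) lab"
    by (rule exI, rule labelled_wedge[OF rose rose]) (auto simp: rose_def permute_edges_def)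
  have loops: "\<exists>lab. labelled_graph n (with_loops_action permute_edges) (with_loops (cage n)) lab"
    by (rule exI, rule labelled_with_loops[OF cage]) (auto simp: cage_def permute_edges_def)
  have loops': "\<exists>lab. labelled_graph n (with_loops_action permute_edges) (with_loops (rose n)) lab"
    by (rule exI, rule labelled_with_loops[OF rose]) (auto simp: rose_def permute_edges_def)
  note unions = labelled_disjoint_union[OF cage cage] labelled_disjoint_union[OF rose cage]
  from list show ?thesis
    unfolding in_list_5_def in_list_4_def in_list_3_def is_rose_or_cage_def
    by (elim disjE)
      (erule pull[OF _ rose] pull[OF _ cage] pull[OF _ labelled_bipartite[OF n]]
        pull[OF _ labelled_cage_twice[OF n]] pull[OF _ labelled_wedge_copies[OF n]]
        pull[OF _ unions(1)] pull[OF _ unions(2)] pull[OF _ someI_ex[OF wedges]]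
        pull[OF _ someI_ex[OF wedges']] pull[OF _ someI_ex[OF wedges'']]
        pull[OF _ someI_ex[OF loops]] pull[OF _ someI_ex[OF loops']])+
qed

text \<open>A permutation can be recovered from its effect on the labels of the darts of
  \<open>Y\<close>, which gives faithfulness. A vertex of valence 1 would have a cut with a single
  dart, against the condition on forests.\<close>

lemma converse:
  assumes n: "n > 8" and X: "is_graph X" "finite_graph X" and act: "acts_on (alt_group n) \<rho> X"
    and list: "in_list_5 n \<rho> Y" and adding: "obtained_by_adding_fixed (alt_group n) \<rho> X Y"
    and val: "\<And>v. v \<in> verts X \<Longrightarrow> valence X v \<noteq> 2"
    and conn: "connected_graph X" and forest: "\<not> has_invariant_forest X"
  shows "admissible X \<and> realizes (alt_group n) \<rho> X \<and> moved_subgraph (alt_group n) \<rho> X = Y"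
proof -
  interpret graph_action n X \<rho> using X(1) act by unfold_locales
  have sub: "subgraph Y X" and dfix: "\<And>p d. p \<in> alternating {1..n} \<Longrightarrow> d \<in> darts X - darts Y \<Longrightarrow> da p d = d"
    using adding by (auto simp: obtained_by_adding_fixed_def carrier_alt_group)
  have YX: "darts Y \<subseteq> darts X" "tail Y = tail X" "opp Y = opp X" "is_graph Y"
    using sub by (auto simp: subgraph_def)
  obtain l where l: "l ` darts Y = {1..n}" "verts Y = tail Y ` darts Y"
    "\<And>p d. p \<in> alternating {1..n} \<Longrightarrow> d \<in> darts Y \<Longrightarrow> l (da p d) = p (l d)"
    using in_list_5_labelled[OF _ list YX(4)] n by auto
  have "D.stab d \<noteq> alternating {1..n}" if d: "d \<in> darts Y" for d
  proof -
    have ld: "l d \<in> {1..n}" using l(1) d by blast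
    obtain j where j: "j \<in> {1..n}" "j \<noteq> l d"
    proof (cases "l d = 1")
      case True
      then show ?thesis using that[of 2] n by simp
    next
      case False
      then show ?thesis using that[of 1] n by simp
    qed
    obtain p where p: "p \<in> alternating {1..n}" "p (l d) \<noteq> l d"
      using exists_fixing_moving[of "{1..n}" j "l d"] j ld n by auto
    then have "da p d \<noteq> d" using l(3)[OF p(1) d] by metis
    then show ?thesis using p by (auto simp: D.stab_def)
  qed
  moreover have "D.stab d = alternating {1..n}" if "d \<in> darts X - darts Y" for d
    using dfix that by (auto simp: D.stab_def)
  ultimately have eq: "{d \<in> darts X. D.stab d \<noteq> alternating {1..n}} = darts Y"
    using YX(1) by blast
  have "moved_subgraph (alt_group n) \<rho> X = X\<lparr>verts := tail X ` darts Y, darts := darts Y\<rparr>"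
    unfolding moved_subgraph_eq eq by (rule refl)
  also have "\<dots> = Y" using l(2) YX(2,3) by (cases X; cases Y) simp
  finally have moved: "moved_subgraph (alt_group n) \<rho> X = Y" .
  have "inj_on \<rho> (alternating {1..n})"
  proof (rule inj_onI)
    fix p q assume p: "p \<in> alternating {1..n}" and q: "q \<in> alternating {1..n}" and eq: "\<rho> p = \<rho> q"
    show "p = q"
    proof (rule ext)
      fix i show "p i = q i"
      proof (cases "i \<in> {1..n}")
        case True
        then have "i \<in> l ` darts Y" by (simp only: l(1))
        then obtain d where d: "d \<in> darts Y" "l d = i" by blast
        have "da p d = da q d" by (simp only: eq)
        then show ?thesis using l(3)[OF p d(1)] l(3)[OF q d(1)] d(2) by simp
      next
        case False
        then show ?thesis
          using permutes_not_in[OF alternatingD(1)[OF p]] permutes_not_in[OF alternatingD(1)[OF q]]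
          by simp
      qed
    qed
  qed
  then have "realizes (alt_group n) \<rho> X" using act by (simp add: realizes_def carrier_alt_group)
  moreover have "valence X v \<noteq> 1" if v: "v \<in> verts X" for v
  proof
    assume "valence X v = 1"
    then obtain d where d: "{d \<in> darts X. tail X d = v} = {d}"
      unfolding valence_def by (meson card_1_singletonE)
    then have dX: "d \<in> darts X" "tail X d = v" by auto
    have "head X d \<noteq> v"
    proof
      assume "head X d = v"
      then have "opp X d \<in> {d \<in> darts X. tail X d = v}" using opp_in_darts[OF graph dX(1)] by (simp add: head_def)
      then show False using d opp_neq[OF graph dX(1)] by simp
    qed
    then have "leaving X {v} = {d}" using d unfolding leaving_def by auto
    then show False using no_single_leaving_dart[OF X forest, of "{v}"] v by simp
  qed
  then have "admissible X" using X conn forest val by (simp add: admissible_def)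
  ultimately show ?thesis using moved by blast
qed

text \<open>The last conjunct expresses that the fixed part may be added arbitrarily: every
  extension of a listed graph meeting the stated restrictions is admissible, realizes the group and
  has the given graph as its moved part.\<close>

theorem proposition6p7:
  fixes n m :: nat
  assumes "n > 8" and "m \<le> 2 * n"
  shows
    "(m < n - 1 \<longrightarrow>
        \<not> (\<exists>(X :: ('v, 'd) graph) \<rho>. admissible X \<and> genus X = m \<and> realizes (alt_group n) \<rho> X))
     \<and>
     (\<forall>(X :: ('v, 'd) graph) \<rho>.
        admissible X \<and> genus X = m \<and> realizes (alt_group n) \<rho> X \<longrightarrow>
          (n - 1 \<le> m \<and> m < 2 * n - 2 \<longrightarrow>
             is_rose_or_cage n \<rho> (moved_subgraph (alt_group n) \<rho> X)) \<and>
          (m = 2 * n - 2 \<longrightarrow> in_list_3 n \<rho> (moved_subgraph (alt_group n) \<rho> X)) \<and>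
          (m = 2 * n - 1 \<longrightarrow> in_list_4 n \<rho> (moved_subgraph (alt_group n) \<rho> X)) \<and>
          (m = 2 * n \<longrightarrow> in_list_5 n \<rho> (moved_subgraph (alt_group n) \<rho> X)) \<and>
          obtained_by_adding_fixed (alt_group n) \<rho> X (moved_subgraph (alt_group n) \<rho> X))
     \<and>
     (\<forall>(X :: ('v, 'd) graph) (Y :: ('v, 'd) graph) \<rho>.
        is_graph X \<and> finite_graph X \<and> genus X = m \<and> acts_on (alt_group n) \<rho> X \<and>
        in_list_5 n \<rho> Y \<and> obtained_by_adding_fixed (alt_group n) \<rho> X Y \<and>
        (\<forall>v \<in> verts X. valence X v \<noteq> 2) \<and>
        connected_graph X \<and> \<not> has_invariant_forest X \<longrightarrow>
          admissible X \<and> realizes (alt_group n) \<rho> X \<and> moved_subgraph (alt_group n) \<rho> X = Y)"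
proof -
  have main: "(n \<le> m + 1 \<and> is_rose_or_cage n \<rho> (moved_subgraph (alt_group n) \<rho> X) \<or>
      2 * n \<le> m + 2 \<and> in_list_3 n \<rho> (moved_subgraph (alt_group n) \<rho> X) \<or>
      2 * n \<le> m + 1 \<and> in_list_4 n \<rho> (moved_subgraph (alt_group n) \<rho> X) \<or>
      2 * n \<le> m \<and> in_list_5 n \<rho> (moved_subgraph (alt_group n) \<rho> X)) \<and>
    obtained_by_adding_fixed (alt_group n) \<rho> X (moved_subgraph (alt_group n) \<rho> X)"
    if X: "admissible X" "genus X = m" "realizes (alt_group n) \<rho> X"
    for X :: "('v, 'd) graph" and \<rho>
  proof -
    interpret small_graph n X \<rho>
      using X assms by unfold_locales (auto simp: admissible_def realizes_def carrier_alt_group)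
    show ?thesis using classification obtained_by_adding_fixed X(2) by simp
  qed
  \<comment> \<open>The lists increase, so a graph that occurs from a smaller genus on belongs to
    all later lists.\<close>
  have lists: "is_rose_or_cage n \<rho> Z \<Longrightarrow> in_list_3 n \<rho> Z" "in_list_3 n \<rho> Z \<Longrightarrow> in_list_4 n \<rho> Z"
    "in_list_4 n \<rho> Z \<Longrightarrow> in_list_5 n \<rho> Z"
    for Z :: "('v, 'd) graph" and \<rho>
    by (simp_all add: in_list_3_def in_list_4_def in_list_5_def)
  show ?thesis
  proof (intro conjI allI impI notI; (elim conjE)?)
    show False if "m < n - 1" and ex: "\<exists>(X :: ('v, 'd) graph) \<rho>.
      admissible X \<and> genus X = m \<and> realizes (alt_group n) \<rho> X"
    proof -
      obtain X :: "('v, 'd) graph" and \<rho> where "admissible X" "genus X = m" "realizes (alt_group n) \<rho> X"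
        using ex by blast
      from main[OF this] show False using \<open>m < n - 1\<close> by linarith
    qed
  next
    fix X :: "('v, 'd) graph" and \<rho>
    assume X: "admissible X" "genus X = m" "realizes (alt_group n) \<rho> X"
    note M = main[OF X]
    show "obtained_by_adding_fixed (alt_group n) \<rho> X (moved_subgraph (alt_group n) \<rho> X)"
      using M by blast
    show "is_rose_or_cage n \<rho> (moved_subgraph (alt_group n) \<rho> X)" if "n - 1 \<le> m" "m < 2 * n - 2"
      using M that assms(1) by auto
    show "in_list_3 n \<rho> (moved_subgraph (alt_group n) \<rho> X)" if "m = 2 * n - 2"
      using M that assms(1) lists by auto
    show "in_list_4 n \<rho> (moved_subgraph (alt_group n) \<rho> X)" if "m = 2 * n - 1"
      using M that assms(1) lists by auto
    show "in_list_5 n \<rho> (moved_subgraph (alt_group n) \<rho> X)" if "m = 2 * n"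
      using M lists by blast
  qed (use converse[OF assms(1)] in blast)+
qed

end
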